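(* Let $\chi,\mu$ be probability measures on $\mathbb{R}$ and $\ddot\mu$ a symmetrization of $\mu$. Suppose that $\chi$ is absolutely continuous with density $f_\chi$ and that the density $f_{\chi*\ddot\mu}$ of $\chi*\ddot\mu$ is continuous. Let $\iota$ be an absolutely continuous probability measure on $\mathbb{R}$ with $f_\iota(\xi)=\mathcal{O}(\xi^{-2})$ as $\xi\to\pm\infty$ and $\Phi_\iota\in L^1(\mathbb{R})$, such that $\Phi_\iota$ is continuously differentiable for $|t|>0$ and there exists $a>2$ with $\Phi_\iota'(t)=\mathcal{O}(|t|^{-a})$ as $t\to\pm\infty$. Suppose there exist $T_0\ge0$, a finite complex Borel measure $\kappa$ on $\mathbb{R}$ with $|\kappa|(\mathbb{R})=|\kappa|(D_\kappa)$, and a continuous function of bounded variation $\varphi_\chi:[T_0,\infty]\to\mathbb{C}$ with $\lim_{t\to\infty}\varphi_\chi(t)=0$, such that $\Phi_\chi(t)=\Phi_\kappa(t)\varphi_\chi(t)$ for all $t\ge T_0$. Put $\mathcal{P}_{\ddot\mu}(t,m):=(1-\Phi_{\ddot\mu}(t))^{m+1}$, $m\ge0$. Assume that $\Phi_{\ddot\mu}(\infty):=\lim_{t\to\infty}\Phi_{\ddot\mu}(t)$ exists and that $\sup_{m\ge0}|\mathcal{P}_{\ddot\mu}|([0,\infty],m)<\infty$, where $|\mathcal{P}_{\ddot\mu}|([0,\infty],m)$ is the variation of $\mathcal{P}_{\ddot\mu}(\cdot,m)$ on $[0,\infty]$. Assume in addition that there exist $K\in\mathbb{N}$ and $\tau_1,\dots,\tau_{2K}\in\mathcal{N}_\mu\cap[0,\infty]$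 with $\tau_k\le\tau_{k+1}$ and $[\tau_k,\tau_{k+1}]\subseteq\mathcal{N}_\mu$ for odd $k\in\{1,\dots,2K\}$, $\tau_k<\tau_{k+1}$ for even $k<2K$, and $\mathcal{N}_\mu\cap[0,\infty]=\bigcup_{k=1}^K[\tau_{2k-1},\tau_{2k}]$. Then, for every $\xi\in\mathbb{R}$ with $\Delta(\{\xi\},D_\kappa)>0$, $$\lim_{m\to\infty}\mathfrak{d}(\xi,m)=\frac{f_\chi(\xi+)+f_\chi(\xi-)}{2}-\sum_{k=1}^K\left\{\mathcal{F}\{\psi_{\tau_{2k-1},0}\}(-\xi)-\mathcal{F}\{\psi_{\tau_{2k},0}\}(-\xi)\right\},$$ where $\mathcal{F}\{\psi_{\infty,0}\}(-\xi)=0$. The sum equals zero if $\mathcal{N}_\mu$ has Lebesgue measure zero.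
   Context: Measures are finite signed or complex Borel measures on $\mathbb{R}$. $F_\nu(\xi) := \nu((-\infty,\xi])$, $\Phi_\nu(t) := \int e^{itx}\,\nu(dx)$, $D_\nu:=\{x\in\mathbb{R}:\nu(\{x\})\ne0\}$, $|\nu|$ is the total variation measure, and $\mathcal{N}_\nu := \{t \in \mathbb{R}\cup\{\pm\infty\} : \Phi_\nu(t)=0\}$, where $\pm\infty \in \mathcal{N}_\nu$ means $\lim_{t\to\pm\infty}\Phi_\nu(t)=0$. $f_\nu$ is the Lebesgue density of an absolutely continuous $\nu$; $Q(\xi\pm)$ are one-sided limits. $\Delta(A,B):=\inf_{(a,b)\in A\times B}|a-b|$. $\nu^{*0}:=\delta_{\{0\}}$, $\nu^{*k} := \nu * \nu^{*(k-1)}$, and $F_\nu^{*k}$ is the distribution function of $\nu^{*k}$. A symmetrization of $\mu$ is a probability measure $\ddot\mu = \mu*\eta$, with $\eta$ a probability measure, such that $F_{\ddot\mu}(\xi-)=1-F_{\ddot\mu}(-\xi)$ for all $\xi$, $\Phi_{\ddot\mu}=\Phi_\mu\Phi_\eta$ is even with $0\le\Phi_{\ddot\mu}\le1$, and $\mathcal{N}_{\ddot\mu}=\mathcal{N}_\mu$. Put $\pi_{\ddot\mu} := \delta_{\{0\}} - \ddot\mu$, $\mathfrak{K}_{\ddot\mu}(\xi,m) := \sum_{\ell=0}^m F_{\pi_{\ddot\mu}}^{*\ell}(\xi)$. The deconvolution density is $\mathfrak{d}(\xi,m) := \int_{-\infty}^\infty f_{\chi*\ddot\mu}(\xi-x)\,\mathfrak{K}_{\ddot\mu}(dx,m)$,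 for $(\xi,m)\in\mathbb{R}\times\mathbb{N}_0$. $\mathcal{F}\{q\}(t) := \int_{-\infty}^\infty e^{itx}q(x)\,dx$. For finite $\tau\ge0$ and $\xi$ with $\Delta(\{\xi\},D_\kappa)>0$, $\mathcal{F}\{\psi_{\tau,0}\}(-\xi)$ denotes $$\mathcal{F}\{\psi_{\tau,0}\}(-\xi)=\mathbf{1}_{\{\tau<T_0\}}\,\mathcal{F}\{\psi_\tau\}(-\xi)+\operatorname{Re}\theta_\tau(-\xi),\qquad \psi_\tau(t):=\frac1{2\pi}\mathbf{1}_{\{\tau\le|t|\le T_0\}}\Phi_\chi(t),$$ $$\theta_\tau(-\xi):=\int_{-\infty}^\infty\int_{\max\{T_0,\tau\}}^\infty\frac{e^{i(x-\xi)\max\{T_0,\tau\}}-e^{i(x-\xi)u}}{i\pi(x-\xi)}\,\varphi_\chi(du)\,\kappa(dx);$$ it is the value of $\lim_{\delta\downarrow0}\frac1{2\pi}\int_{|t|\ge\tau}e^{-i\xi t}\Phi_\iota(\delta t)\Phi_\chi(t)\,dt$. *)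

theory Defs
  imports "HOL-Probability.Probability" "HOL-Library.Landau_Symbols"
begin

section \<open>Finite complex Borel measures on the real line\<close>

text \<open>A finite signed or complex Borel measure is represented by a countably additive set function.
  Only its values on Borel sets are meaningful.  Signed measures are the real-valued case.\<close>

definition complex_measure :: "(real set \<Rightarrow> complex) \<Rightarrow> bool" where
  "complex_measure \<nu> \<longleftrightarrow> \<nu> {} = 0 \<and>
     (\<forall>A :: nat \<Rightarrow> real set. range A \<subseteq> sets borel \<and> disjoint_family A \<longrightarrow>
        (\<lambda>n. \<nu> (A n)) sums \<nu> (\<Union>n. A n))"

definition total_variation :: "(real set \<Rightarrow> complex) \<Rightarrow> real set \<Rightarrow> ennreal" where
  "total_variation \<nu> A =
     (SUP P \<in> {P. finite P \<and> P \<subseteq> sets borel \<and> disjoint P \<and> \<Union>P = A}.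
        \<Sum>E\<in>P. ennreal (cmod (\<nu> E)))"

definition discontinuities :: "(real set \<Rightarrow> complex) \<Rightarrow> real set" where
  "discontinuities \<nu> = {x. \<nu> {x} \<noteq> 0}"

text \<open>The positive part in the Jordan decomposition of a signed measure; the negative part is the
  positive part of the negated measure.  Note that \<^const>\<open>ennreal\<close> truncates negative
  values to zero, which is harmless because the empty set competes in the supremum.\<close>

definition jordan_pos :: "(real set \<Rightarrow> real) \<Rightarrow> real measure" where
  "jordan_pos \<sigma> = measure_of UNIV (sets borel)
     (\<lambda>A. SUP B \<in> {B. B \<in> sets borel \<and> B \<subseteq> A}. ennreal (\<sigma> B))"

definition cm_integral :: "(real set \<Rightarrow> complex) \<Rightarrow> (real \<Rightarrow> complex) \<Rightarrow> complex" where
  "cm_integral \<nu> f =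
     (CLINT x | jordan_pos (\<lambda>A. Re (\<nu> A)). f x) - (CLINT x | jordan_pos (\<lambda>A. - Re (\<nu> A)). f x)
     + \<i> * ((CLINT x | jordan_pos (\<lambda>A. Im (\<nu> A)). f x)
            - (CLINT x | jordan_pos (\<lambda>A. - Im (\<nu> A)). f x))"

definition cm_char :: "(real set \<Rightarrow> complex) \<Rightarrow> real \<Rightarrow> complex" where
  "cm_char \<nu> t = cm_integral \<nu> (\<lambda>x. iexp (t * x))"

definition cm_cdf :: "(real set \<Rightarrow> complex) \<Rightarrow> real \<Rightarrow> complex" where
  "cm_cdf \<nu> \<xi> = \<nu> {..\<xi>}"

definition cm_convolution ::
    "(real set \<Rightarrow> complex) \<Rightarrow> (real set \<Rightarrow> complex) \<Rightarrow> real set \<Rightarrow> complex" where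
  "cm_convolution \<nu> \<rho> A = cm_integral \<rho> (\<lambda>x. \<nu> {y. y + x \<in> A})"

definition dirac0 :: "real set \<Rightarrow> complex" where
  "dirac0 A = indicator A 0"

primrec cm_conv_power :: "(real set \<Rightarrow> complex) \<Rightarrow> nat \<Rightarrow> real set \<Rightarrow> complex" where
  "cm_conv_power \<nu> 0 = dirac0"
| "cm_conv_power \<nu> (Suc k) = cm_convolution \<nu> (cm_conv_power \<nu> k)"

text \<open>The Lebesgue--Stieltjes measure \<open>F(dx)\<close> of a right-continuous function of bounded variation.
  It is unique on Borel sets, so the choice does not affect integrals.\<close>

definition stieltjes :: "(real \<Rightarrow> complex) \<Rightarrow> real set \<Rightarrow> complex" where
  "stieltjes F = (SOME \<nu>. complex_measure \<nu> \<and> (\<forall>a b. a \<le> b \<longrightarrow> \<nu> {a<..b} = F b - F a))"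

text \<open>Variation of a function on a subset of a linear order, in particular on compactified
  half-lines, which are intervals of \<^typ>\<open>ereal\<close>.\<close>

definition variation :: "('a :: linorder \<Rightarrow> complex) \<Rightarrow> 'a set \<Rightarrow> ennreal" where
  "variation f S =
     (SUP (n, t) \<in> {(n :: nat, t :: nat \<Rightarrow> 'a). (\<forall>i\<le>n. t i \<in> S) \<and> (\<forall>i<n. t i \<le> t (Suc i))}.
        \<Sum>i<n. ennreal (cmod (f (t (Suc i)) - f (t i))))"

text \<open>The value lies in \<^typ>\<open>ereal\<close> so that the distance to the empty set is infinite
  (\<^const>\<open>setdist\<close> would give zero).\<close>

definition set_distance :: "real set \<Rightarrow> real set \<Rightarrow> ereal" where
  "set_distance A B = (INF (a, b) \<in> A \<times> B. ereal \<bar>a - b\<bar>)"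

section \<open>Densities and one-sided limits\<close>

definition has_density :: "real measure \<Rightarrow> (real \<Rightarrow> real) \<Rightarrow> bool" where
  "has_density \<nu> f \<longleftrightarrow>
     f \<in> borel_measurable borel \<and> (\<forall>x. 0 \<le> f x) \<and> \<nu> = density lborel (\<lambda>x. ennreal (f x))"

text \<open>A density is determined only up to Lebesgue null sets, and so are its one-sided limits:
  these are taken along all points outside a null set.  Whenever the ordinary one-sided limits of
  the given version exist, they are the limits along these filters.\<close>

definition ess_at_right :: "real \<Rightarrow> real filter" where
  "ess_at_right \<xi> = inf (at_right \<xi>) (ae_filter lborel)"

definition ess_at_left :: "real \<Rightarrow> real filter" where
  "ess_at_left \<xi> = inf (at_left \<xi>) (ae_filter lborel)"

lemma tendsto_ess_at_rightI: "(f \<longlongrightarrow> l) (at_right \<xi>) \<Longrightarrow> (f \<longlongrightarrow> l) (ess_at_right \<xi>)"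
  unfolding ess_at_right_def by (rule tendsto_mono[OF inf_le1])

lemma tendsto_ess_at_leftI: "(f \<longlongrightarrow> l) (at_left \<xi>) \<Longrightarrow> (f \<longlongrightarrow> l) (ess_at_left \<xi>)"
  unfolding ess_at_left_def by (rule tendsto_mono[OF inf_le1])

text \<open>The filters are proper, so the limits along them are unique.\<close>

lemma ess_at_right_neq_bot: "ess_at_right \<xi> \<noteq> bot"
proof
  assume "ess_at_right \<xi> = bot"
  then have "eventually (\<lambda>_. False) (inf (at_right \<xi>) (ae_filter lborel))"
    by (simp add: ess_at_right_def)
  then obtain P Q where P: "eventually P (at_right \<xi>)" and Q: "AE x in lborel. Q x"
    and PQ: "\<And>x. P x \<Longrightarrow> Q x \<Longrightarrow> False"
    unfolding eventually_inf by blast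
  from P obtain b where b: "b > \<xi>" "\<And>y. \<xi> < y \<Longrightarrow> y < b \<Longrightarrow> P y"
    unfolding eventually_at_right_field by blast
  from Q have "AE x in lborel. x \<notin> {\<xi><..<b}"
    by eventually_elim (use b PQ in auto)
  then have "emeasure lborel {\<xi><..<b} = 0"
    by (subst (asm) AE_iff_measurable[where N = "{\<xi><..<b}"]) auto
  with b show False by simp
qed

lemma ess_at_left_neq_bot: "ess_at_left \<xi> \<noteq> bot"
proof
  assume "ess_at_left \<xi> = bot"
  then have "eventually (\<lambda>_. False) (inf (at_left \<xi>) (ae_filter lborel))"
    by (simp add: ess_at_left_def)
  then obtain P Q where P: "eventually P (at_left \<xi>)" and Q: "AE x in lborel. Q x"
    and PQ: "\<And>x. P x \<Longrightarrow> Q x \<Longrightarrow> False"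
    unfolding eventually_inf by blast
  from P obtain b where b: "b < \<xi>" "\<And>y. b < y \<Longrightarrow> y < \<xi> \<Longrightarrow> P y"
    unfolding eventually_at_left_field by blast
  from Q have "AE x in lborel. x \<notin> {b<..<\<xi>}"
    by eventually_elim (use b PQ in auto)
  then have "emeasure lborel {b<..<\<xi>} = 0"
    by (subst (asm) AE_iff_measurable[where N = "{b<..<\<xi>}"]) auto
  with b show False by simp
qed

section \<open>Characteristic functions and symmetrization\<close>

text \<open>Characteristic function on the extended line; at \<open>\<plusminus>\<infinity>\<close> meaningful only if the limit exists.\<close>

definition char_ext :: "real measure \<Rightarrow> ereal \<Rightarrow> complex" where
  "char_ext \<nu> t = (case t of ereal r \<Rightarrow> char \<nu> r
     | PInfty \<Rightarrow> Lim at_top (char \<nu>) | MInfty \<Rightarrow> Lim at_bot (char \<nu>))"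

definition char_zeros :: "real measure \<Rightarrow> ereal set" where
  "char_zeros \<nu> = {t. case t of ereal r \<Rightarrow> char \<nu> r = 0
     | PInfty \<Rightarrow> (char \<nu> \<longlongrightarrow> 0) at_top | MInfty \<Rightarrow> (char \<nu> \<longlongrightarrow> 0) at_bot}"

text \<open>The relation \<open>\<Phi>\<^bsub>\<mu> \<star> \<eta>\<^esub> = \<Phi>\<^bsub>\<mu>\<^esub> \<Phi>\<^bsub>\<eta>\<^esub>\<close> is automatic and hence not listed.\<close>

definition is_symmetrization :: "real measure \<Rightarrow> real measure \<Rightarrow> bool" where
  "is_symmetrization \<mu>s \<mu> \<longleftrightarrow>
     (\<exists>\<eta>. real_distribution \<eta> \<and> \<mu>s = (\<mu> \<star> \<eta>)) \<and>
     (\<forall>\<xi>. (cdf \<mu>s \<longlongrightarrow> 1 - cdf \<mu>s (- \<xi>)) (at_left \<xi>)) \<and>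
     (\<forall>t. char \<mu>s (- t) = char \<mu>s t) \<and>
     (\<forall>t. Im (char \<mu>s t) = 0 \<and> 0 \<le> Re (char \<mu>s t) \<and> Re (char \<mu>s t) \<le> 1) \<and>
     char_zeros \<mu>s = char_zeros \<mu>"

definition char_power :: "real measure \<Rightarrow> ereal \<Rightarrow> nat \<Rightarrow> complex" where
  "char_power \<mu>s t m = (1 - char_ext \<mu>s t) ^ (m + 1)"

section \<open>The deconvolution density\<close>

definition pi_measure :: "real measure \<Rightarrow> real set \<Rightarrow> complex" where
  "pi_measure \<mu>s A = dirac0 A - complex_of_real (measure \<mu>s A)"

definition deconv_kernel :: "real measure \<Rightarrow> real \<Rightarrow> nat \<Rightarrow> complex" where
  "deconv_kernel \<mu>s \<xi> m = (\<Sum>l\<le>m. cm_cdf (cm_conv_power (pi_measure \<mu>s) l) \<xi>)"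

text \<open>Here \<open>g\<close> is the continuous density of the convolution of \<open>chi\<close> and \<open>\<mu>s\<close>.\<close>

definition deconv_density :: "real measure \<Rightarrow> (real \<Rightarrow> real) \<Rightarrow> real \<Rightarrow> nat \<Rightarrow> complex" where
  "deconv_density \<mu>s g \<xi> m =
     cm_integral (stieltjes (\<lambda>x. deconv_kernel \<mu>s x m)) (\<lambda>x. complex_of_real (g (\<xi> - x)))"

section \<open>The limiting terms\<close>

definition fourier :: "(real \<Rightarrow> complex) \<Rightarrow> real \<Rightarrow> complex" where
  "fourier q t = (CLINT x | lborel. iexp (t * x) * q x)"

definition psi :: "real measure \<Rightarrow> real \<Rightarrow> real \<Rightarrow> real \<Rightarrow> complex" where
  "psi chi T0 \<tau> t = 1 / (2 * pi) * indicator {t. \<tau> \<le> \<bar>t\<bar> \<and> \<bar>t\<bar> \<le> T0} t * char chi t"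

text \<open>The function \<open>\<phi>\<close> lives on \<open>[T0,\<infinity>]\<close>; its Stieltjes measure is that of the constant continuation
  to the left of \<open>T0\<close>.  Since \<open>\<phi>\<close> is continuous, there is no mass at the end points.
  The argument \<open>s\<close> corresponds to \<open>-\<xi>\<close>.\<close>

definition theta ::
    "real \<Rightarrow> (real set \<Rightarrow> complex) \<Rightarrow> (ereal \<Rightarrow> complex) \<Rightarrow> real \<Rightarrow> real \<Rightarrow> complex" where
  "theta T0 \<kappa> \<phi> \<tau> s =
     cm_integral \<kappa> (\<lambda>x. cm_integral (stieltjes (\<lambda>u. \<phi> (ereal (max T0 u))))
       (\<lambda>u. indicator {max T0 \<tau>..} u *
          ((iexp ((x + s) * max T0 \<tau>) - iexp ((x + s) * u)) / (\<i> * pi * (x + s)))))"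

definition fourier_psi0 ::
    "real measure \<Rightarrow> real \<Rightarrow> (real set \<Rightarrow> complex) \<Rightarrow> (ereal \<Rightarrow> complex) \<Rightarrow> ereal \<Rightarrow> real \<Rightarrow> complex"
  where
  "fourier_psi0 chi T0 \<kappa> \<phi> \<tau> s = (case \<tau> of
     ereal r \<Rightarrow> (if r < T0 then fourier (psi chi T0 r) s else 0)
                + complex_of_real (Re (theta T0 \<kappa> \<phi> r s))
   | _ \<Rightarrow> 0)"

end

theory Submission
  imports Defs
begin

text \<open>The kernel of the deconvolution density is a finite signed measure whose characteristic function
  is the geometric sum of the powers of \<open>1 - \<Phi>\<close>, where \<open>\<Phi>\<close> is the characteristic function of the
  symmetrization.  Multiplied by \<open>\<Phi>\<close> it becomes \<open>1 - (1 - \<Phi>)\<^sup>m\<^sup>+\<^sup>1\<close>.  Formally, therefore, the deconvolution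
  density is the Fourier inversion of the characteristic function of \<open>chi\<close> times this weight, and since
  \<open>0 \<le> \<Phi> \<le> 1\<close> the weight tends to the indicator of the complement of the zero set.  The limit is thus
  the inversion integral of \<open>chi\<close>, which is its density, minus the part of that integral over the
  zero intervals.  What has to be proved is that the limit may be taken inside an
  inversion integral that converges only conditionally.

  The uniform control comes from the factorization.  Beyond \<open>T0\<close> the characteristic function of \<open>chi\<close> is a
  superposition, over the atoms \<open>x\<close> of \<open>\<kappa>\<close>, of oscillations with amplitude \<open>\<phi>\<close>.
  An oscillation of frequency \<open>x - \<xi>\<close> against an amplitude of bounded variation has an
  integral of size (twice the supremum plus the variation) divided by \<open>\<bar>x - \<xi>\<bar>\<close>, lemma
  \<open>oscillatory_integral_bound\<close>.  The amplitude here is \<open>\<phi>\<close> times the weight; its supremum and variation beyond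
  a large level are small, uniformly in the number of summands, because \<open>\<phi>\<close> vanishes at infinity,
  has small variation there (\<open>var_le_tail\<close>), and the weights have uniformly bounded variations.  Hence the
  tails of the inversion integrals are small uniformly in the number of summands and locally uniformly in
  the point (\<open>uniform_inv_trunc\<close>), and on bounded ranges dominated convergence applies
  (\<open>inv_lim_deconv_tendsto\<close>).

  That the inversion integrals represent the densities pointwise follows from the inversion
  formula of Levy, which represents the measures of intervals.  By local uniform convergence the inversion
  integral is a continuous function near \<open>\<xi>\<close>, so \<open>chi\<close> has a continuous density there
  (\<open>chi_density_eq_inv_lim\<close>).  For the deconvolution density one also needs that the convolutions of \<open>g\<close> with
  the convolution powers of the symmetrization are finite and continuous everywhere, although \<open>g\<close>
  may be unbounded.  This holds because a probability measure whose characteristic function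
  has bounded variation possesses a bounded density away from the origin (\<open>conv_pow_dominated\<close>).

  Finally, integration by parts identifies the Stieltjes integrals in the limiting terms with improper
  inversion integrals (\<open>stieltjes_oscillation_limit\<close>), so that each limiting term is the inversion integral over a
  half-line (\<open>fourier_psi0_limit\<close>), and differences of half-lines make up the zero set (\<open>interval_sum_eq_indicator\<close>).\<close>

section \<open>Jordan decomposition of complex measures\<close>

definition signed_measure :: "(real set \<Rightarrow> real) \<Rightarrow> bool" where
  "signed_measure \<sigma> \<longleftrightarrow> \<sigma> {} = 0 \<and>
     (\<forall>A :: nat \<Rightarrow> real set. range A \<subseteq> sets borel \<and> disjoint_family A \<longrightarrow>
        (\<lambda>n. \<sigma> (A n)) sums \<sigma> (\<Union>n. A n))"

lemma signed_measure_sums: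
  assumes "signed_measure \<sigma>" "range A \<subseteq> sets borel" "disjoint_family (A :: nat \<Rightarrow> real set)"
  shows "(\<lambda>n. \<sigma> (A n)) sums \<sigma> (\<Union>n. A n)"
  using assms unfolding signed_measure_def by blast

lemma complex_measure_sums:
  assumes "complex_measure \<nu>" "range A \<subseteq> sets borel" "disjoint_family (A :: nat \<Rightarrow> real set)"
  shows "(\<lambda>n. \<nu> (A n)) sums \<nu> (\<Union>n. A n)"
  using assms unfolding complex_measure_def by blast

lemma complex_measure_Un:
  assumes \<nu>: "complex_measure \<nu>" and A: "A \<in> sets borel" and B: "B \<in> sets borel" and "A \<inter> B = {}"
  shows "\<nu> (A \<union> B) = \<nu> A + \<nu> B"
proof -
  have "disjoint_family (binaryset A B)"
    using assms(4) by (auto simp: disjoint_family_on_def binaryset_def)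
  moreover have "range (binaryset A B) \<subseteq> sets borel"
    using A B by (auto simp: range_binaryset_eq)
  ultimately have "(\<lambda>n. \<nu> (binaryset A B n)) sums \<nu> (\<Union>n. binaryset A B n)"
    using complex_measure_sums[OF \<nu>] by blast
  moreover have "(\<lambda>n. \<nu> (binaryset A B n)) sums (\<nu> A + \<nu> B)"
    by (rule binaryset_sums) (use \<nu> in \<open>simp add: complex_measure_def\<close>)
  ultimately show ?thesis
    by (simp add: UN_binaryset_eq sums_iff)
qed

lemma signed_measure_Un:
  assumes \<nu>: "signed_measure \<nu>" and A: "A \<in> sets borel" and B: "B \<in> sets borel" and "A \<inter> B = {}"
  shows "\<nu> (A \<union> B) = \<nu> A + \<nu> B"
proof -
  have "disjoint_family (binaryset A B)"
    using assms(4) by (auto simp: disjoint_family_on_def binaryset_def)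
  moreover have "range (binaryset A B) \<subseteq> sets borel"
    using A B by (auto simp: range_binaryset_eq)
  ultimately have "(\<lambda>n. \<nu> (binaryset A B n)) sums \<nu> (\<Union>n. binaryset A B n)"
    using signed_measure_sums[OF \<nu>] by blast
  moreover have "(\<lambda>n. \<nu> (binaryset A B n)) sums (\<nu> A + \<nu> B)"
    by (rule binaryset_sums) (use \<nu> in \<open>simp add: signed_measure_def\<close>)
  ultimately show ?thesis
    by (simp add: UN_binaryset_eq sums_iff)
qed

lemma signed_measure_Re_divide:
  assumes "complex_measure \<nu>"
  shows "signed_measure (\<lambda>A. Re (\<nu> A / c))"
  unfolding signed_measure_def
proof (intro conjI allI impI)
  show "Re (\<nu> {} / c) = 0" using assms by (simp add: complex_measure_def)
  fix A :: "nat \<Rightarrow> real set" assume "range A \<subseteq> sets borel \<and> disjoint_family A"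
  then have "(\<lambda>n. \<nu> (A n)) sums \<nu> (\<Union>n. A n)" using assms complex_measure_sums by blast
  then show "(\<lambda>n. Re (\<nu> (A n) / c)) sums Re (\<nu> (\<Union>n. A n) / c)"
    by (intro sums_Re sums_divide)
qed

lemma signed_measure_uminus: "signed_measure \<sigma> \<Longrightarrow> signed_measure (\<lambda>A. - \<sigma> A)"
  unfolding signed_measure_def by (auto intro: sums_minus)

lemma signed_measure_Diff:
  assumes "signed_measure \<sigma>" "A \<in> sets borel" "B \<in> sets borel" "B \<subseteq> A"
  shows "\<sigma> (A - B) = \<sigma> A - \<sigma> B"
proof -
  have "\<sigma> (B \<union> (A - B)) = \<sigma> B + \<sigma> (A - B)"
    using assms by (intro signed_measure_Un) auto
  moreover have "B \<union> (A - B) = A" using assms by auto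
  ultimately show ?thesis by simp
qed

lemma ennreal_add_le: "ennreal (a + b) \<le> ennreal a + ennreal b"
proof (cases "0 \<le> a \<and> 0 \<le> b")
  case True
  then show ?thesis by simp
next
  case False
  then have "a + b \<le> a \<or> a + b \<le> b" by linarith
  then show ?thesis
    by (metis add.commute add_increasing2 ennreal_leI zero_le)
qed

lemma ennreal_sum_le: "ennreal (sum f I) \<le> (\<Sum>i\<in>I. ennreal (f i))"
proof (induction I rule: infinite_finite_induct)
  case (insert x F)
  then show ?case
    by (simp, metis (no_types, lifting) add_left_mono ennreal_add_le order_trans)
qed auto

definition pos_sup :: "(real set \<Rightarrow> real) \<Rightarrow> real set \<Rightarrow> ennreal" where
  "pos_sup \<sigma> A = (SUP B \<in> {B. B \<in> sets borel \<and> B \<subseteq> A}. ennreal (\<sigma> B))"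

lemma pos_sup_upper: "B \<in> sets borel \<Longrightarrow> B \<subseteq> A \<Longrightarrow> ennreal (\<sigma> B) \<le> pos_sup \<sigma> A"
  unfolding pos_sup_def by (rule SUP_upper) auto

lemma pos_sup_least: "(\<And>B. B \<in> sets borel \<Longrightarrow> B \<subseteq> A \<Longrightarrow> ennreal (\<sigma> B) \<le> c) \<Longrightarrow> pos_sup \<sigma> A \<le> c"
  unfolding pos_sup_def by (rule SUP_least) auto

lemma pos_sup_mono: "A \<subseteq> B \<Longrightarrow> pos_sup \<sigma> A \<le> pos_sup \<sigma> B"
  by (rule pos_sup_least) (auto intro: pos_sup_upper)

text \<open>Pieces on which the values are negative are replaced by the empty set, so that truncation at zero
  does not interfere with additivity.\<close>

lemma pos_sup_superadditive:
  assumes \<sigma>: "signed_measure \<sigma>" and "A \<inter> B = {}"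
  shows "pos_sup \<sigma> A + pos_sup \<sigma> B \<le> pos_sup \<sigma> (A \<union> B)"
proof -
  have 1: "ennreal (\<sigma> C) + ennreal (\<sigma> D) \<le> pos_sup \<sigma> (A \<union> B)"
    if "C \<in> sets borel" "C \<subseteq> A" "D \<in> sets borel" "D \<subseteq> B" for C D
  proof -
    define C' where "C' = (if \<sigma> C \<ge> 0 then C else {})"
    define D' where "D' = (if \<sigma> D \<ge> 0 then D else {})"
    have s0: "\<sigma> {} = 0" using \<sigma> by (simp add: signed_measure_def)
    have sets: "C' \<in> sets borel" "D' \<in> sets borel" "C' \<inter> D' = {}" "C' \<union> D' \<subseteq> A \<union> B"
      using that assms(2) by (auto simp: C'_def D'_def)
    have "ennreal (\<sigma> C) = ennreal (\<sigma> C')" "\<sigma> C' \<ge> 0"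
      "ennreal (\<sigma> D) = ennreal (\<sigma> D')" "\<sigma> D' \<ge> 0"
      using s0 by (auto simp: C'_def D'_def ennreal_neg)
    then have "ennreal (\<sigma> C) + ennreal (\<sigma> D) = ennreal (\<sigma> (C' \<union> D'))"
      using signed_measure_Un[OF \<sigma> sets(1-3)] by (simp add: ennreal_plus)
    also have "\<dots> \<le> pos_sup \<sigma> (A \<union> B)" using sets by (intro pos_sup_upper) auto
    finally show ?thesis .
  qed
  have ne: "{B. B \<in> sets borel \<and> B \<subseteq> X} \<noteq> {}" for X :: "real set" by (auto intro!: exI[of _ "{}"])
  have 2: "ennreal (\<sigma> C) + pos_sup \<sigma> B \<le> pos_sup \<sigma> (A \<union> B)" if "C \<in> sets borel" "C \<subseteq> A" for C
    unfolding pos_sup_def[of \<sigma> B]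
    by (subst ennreal_SUP_add_right[OF ne]) (auto intro!: SUP_least 1 that)
  show ?thesis
    unfolding pos_sup_def[of \<sigma> A]
    by (subst ennreal_SUP_add_left[symmetric, OF ne]) (auto intro!: SUP_least 2)
qed

lemma pos_sup_countably_additive:
  assumes \<sigma>: "signed_measure \<sigma>"
  shows "countably_additive (sets borel) (pos_sup \<sigma>)"
  unfolding countably_additive_def
proof (intro allI impI antisym)
  fix A :: "nat \<Rightarrow> real set"
  assume A: "range A \<subseteq> sets borel" "disjoint_family A"
  have fin: "(\<Sum>i<n. pos_sup \<sigma> (A i)) \<le> pos_sup \<sigma> (\<Union>i<n. A i)" for n
  proof (induction n)
    case (Suc n)
    have "A i \<inter> A n = {}" if "i < n" for i
      using disjoint_family_onD[OF A(2), of i n] that by simp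
    then have "(\<Union>i<n. A i) \<inter> A n = {}" by blast
    then have "pos_sup \<sigma> (\<Union>i<n. A i) + pos_sup \<sigma> (A n) \<le> pos_sup \<sigma> ((\<Union>i<n. A i) \<union> A n)"
      by (rule pos_sup_superadditive[OF \<sigma>])
    also have "(\<Union>i<n. A i) \<union> A n = (\<Union>i<Suc n. A i)" by (simp add: lessThan_Suc Un_commute)
    finally show ?case using order_trans[OF add_right_mono[OF Suc]] by simp
  qed auto
  show "(\<Sum>i. pos_sup \<sigma> (A i)) \<le> pos_sup \<sigma> (\<Union>i. A i)"
    unfolding suminf_eq_SUP
    by (rule SUP_least, rule order_trans[OF fin], rule pos_sup_mono) auto
  show "pos_sup \<sigma> (\<Union>i. A i) \<le> (\<Sum>i. pos_sup \<sigma> (A i))"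
  proof (rule pos_sup_least)
    fix B :: "real set" assume B: "B \<in> sets borel" "B \<subseteq> (\<Union>i. A i)"
    have "(\<lambda>n. \<sigma> (B \<inter> A n)) sums \<sigma> (\<Union>n. B \<inter> A n)"
      using A B by (intro signed_measure_sums[OF \<sigma>]) (auto simp: disjoint_family_on_def)
    also have "(\<Union>n. B \<inter> A n) = B" using B by auto
    finally have lim: "(\<lambda>n. ennreal (\<Sum>i<n. \<sigma> (B \<inter> A i))) \<longlonglongrightarrow> ennreal (\<sigma> B)"
      unfolding sums_def by (rule tendsto_ennrealI)
    show "ennreal (\<sigma> B) \<le> (\<Sum>i. pos_sup \<sigma> (A i))"
    proof (rule LIMSEQ_le_const2[OF lim], intro exI allI impI)
      fix n :: nat
      have "ennreal (\<Sum>i<n. \<sigma> (B \<inter> A i)) \<le> (\<Sum>i<n. ennreal (\<sigma> (B \<inter> A i)))"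
        by (rule ennreal_sum_le)
      also have "\<dots> \<le> (\<Sum>i<n. pos_sup \<sigma> (A i))"
        using A B by (intro sum_mono pos_sup_upper) auto
      also have "\<dots> \<le> (\<Sum>i. pos_sup \<sigma> (A i))" by (rule sum_le_suminf) auto
      finally show "ennreal (\<Sum>i<n. \<sigma> (B \<inter> A i)) \<le> (\<Sum>i. pos_sup \<sigma> (A i))" .
    qed
  qed
qed

lemma sets_jordan_pos [simp, measurable_cong]: "sets (jordan_pos \<sigma>) = sets borel"
  unfolding jordan_pos_def using sets.sigma_sets_eq[of "borel :: real measure"] by simp

lemma space_jordan_pos [simp]: "space (jordan_pos \<sigma>) = UNIV"
  using sets_eq_imp_space_eq[OF sets_jordan_pos] by simp

lemma emeasure_jordan_pos:
  assumes \<sigma>: "signed_measure \<sigma>" and "A \<in> sets borel"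
  shows "emeasure (jordan_pos \<sigma>) A = pos_sup \<sigma> A"
proof (rule emeasure_measure_of[OF jordan_pos_def[folded pos_sup_def]])
  have "pos_sup \<sigma> {} = 0"
    using \<sigma> by (intro antisym pos_sup_least) (auto simp: signed_measure_def)
  then show "positive (sets (jordan_pos \<sigma>)) (pos_sup \<sigma>)" by (simp add: positive_def)
  show "countably_additive (sets (jordan_pos \<sigma>)) (pos_sup \<sigma>)"
    using pos_sup_countably_additive[OF \<sigma>] by simp
qed (use assms in auto)

text \<open>If the supremum were infinite, one could repeatedly split off a piece of mass at least one
  in absolute value from a set on which the supremum is still infinite; the values of a countably
  additive function on these disjoint pieces would not tend to zero.\<close>

lemma pos_sup_finite:
  assumes \<sigma>: "signed_measure \<sigma>"
  shows "pos_sup \<sigma> UNIV < \<infinity>"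
proof (rule ccontr)
  assume "\<not> ?thesis"
  then have inf: "pos_sup \<sigma> UNIV = \<infinity>" by (simp add: less_top[symmetric])
  have split: "\<exists>F. F \<in> sets borel \<and> F \<subseteq> A \<and> 1 \<le> \<bar>\<sigma> (A - F)\<bar> \<and> pos_sup \<sigma> F = \<infinity>"
    if A: "A \<in> sets borel" "pos_sup \<sigma> A = \<infinity>" for A
  proof -
    have "ennreal (\<bar>\<sigma> A\<bar> + 1) < pos_sup \<sigma> A" using A by simp
    then obtain B where B: "B \<in> sets borel" "B \<subseteq> A" "ennreal (\<bar>\<sigma> A\<bar> + 1) < ennreal (\<sigma> B)"
      unfolding pos_sup_def less_SUP_iff by auto
    then have B1: "\<bar>\<sigma> A\<bar> + 1 < \<sigma> B"
      by (metis abs_ge_zero add_nonneg_nonneg ennreal_less_iff zero_le_one)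
    have d: "\<sigma> (A - B) = \<sigma> A - \<sigma> B" using signed_measure_Diff[OF \<sigma>] A B by auto
    have "emeasure (jordan_pos \<sigma>) A = emeasure (jordan_pos \<sigma>) B + emeasure (jordan_pos \<sigma>) (A - B)"
      using A B by (subst plus_emeasure) (auto intro: arg_cong[where f = "emeasure _"])
    then have "pos_sup \<sigma> B + pos_sup \<sigma> (A - B) = \<infinity>"
      using A B by (simp add: emeasure_jordan_pos[OF \<sigma>])
    then consider "pos_sup \<sigma> B = \<infinity>" | "pos_sup \<sigma> (A - B) = \<infinity>"
      by (auto simp: ennreal_add_eq_top)
    then show ?thesis
    proof cases
      case 1 then show ?thesis using B B1 d by (intro exI[of _ B]) auto
    next
      case 2
      moreover have "A - (A - B) = B" using B by auto
      ultimately show ?thesis using A B B1 by (intro exI[of _ "A - B"]) auto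
    qed
  qed
  define P where "P A \<longleftrightarrow> A \<in> sets borel \<and> pos_sup \<sigma> A = \<infinity>" for A
  have "\<exists>S. \<forall>n. P (S n) \<and> (S (Suc n) \<subseteq> S n \<and> 1 \<le> \<bar>\<sigma> (S n - S (Suc n))\<bar>)"
    by (rule dependent_nat_choice) (use inf split in \<open>unfold P_def, auto\<close>)
  then obtain S where S: "\<And>n. S n \<in> sets borel" "\<And>n. S (Suc n) \<subseteq> S n"
    "\<And>n. 1 \<le> \<bar>\<sigma> (S n - S (Suc n))\<bar>"
    unfolding P_def by blast
  have dec: "S n \<subseteq> S m" if "m \<le> n" for m n
    using that by (rule lift_Suc_antimono_le[of S, rotated]) (use S in auto)
  have "disjoint_family (\<lambda>n. S n - S (Suc n))"
    unfolding disjoint_family_on_def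
  proof (intro ballI impI)
    fix m n :: nat assume "m \<noteq> n"
    then show "(S m - S (Suc m)) \<inter> (S n - S (Suc n)) = {}"
      using dec[of "Suc m" n] dec[of "Suc n" m] by (cases m n rule: linorder_cases) auto
  qed
  then have "(\<lambda>n. \<sigma> (S n - S (Suc n))) sums \<sigma> (\<Union>n. S n - S (Suc n))"
    using S by (intro signed_measure_sums[OF \<sigma>]) auto
  then have "(\<lambda>n. \<sigma> (S n - S (Suc n))) \<longlonglongrightarrow> 0"
    using summable_LIMSEQ_zero sums_summable by blast
  then have "(\<lambda>n. \<bar>\<sigma> (S n - S (Suc n))\<bar>) \<longlonglongrightarrow> 0" by (rule tendsto_rabs_zero)
  then have "1 \<le> (0::real)" by (rule LIMSEQ_le_const) (use S in auto)
  then show False by simp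
qed

lemma finite_measure_jordan_pos: "signed_measure \<sigma> \<Longrightarrow> finite_measure (jordan_pos \<sigma>)"
  using pos_sup_finite by (intro finite_measureI) (auto simp: emeasure_jordan_pos less_top)

lemma measure_jordan_pos_upper:
  assumes "signed_measure \<sigma>" "A \<in> sets borel" "B \<in> sets borel" "B \<subseteq> A"
  shows "\<sigma> B \<le> measure (jordan_pos \<sigma>) A"
proof -
  interpret finite_measure "jordan_pos \<sigma>" by (rule finite_measure_jordan_pos) fact
  have "ennreal (\<sigma> B) \<le> ennreal (measure (jordan_pos \<sigma>) A)"
    using assms by (subst emeasure_eq_measure[symmetric]) (simp add: emeasure_jordan_pos pos_sup_upper)
  then show ?thesis by (simp add: ennreal_le_iff)
qed

lemma measure_jordan_pos_least:
  assumes "signed_measure \<sigma>" "A \<in> sets borel" "\<And>B. B \<in> sets borel \<Longrightarrow> B \<subseteq> A \<Longrightarrow> \<sigma> B \<le> c"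
  shows "measure (jordan_pos \<sigma>) A \<le> c"
proof -
  interpret finite_measure "jordan_pos \<sigma>" by (rule finite_measure_jordan_pos) fact
  have "0 \<le> c" using assms(1) assms(3)[of "{}"] by (simp add: signed_measure_def)
  have "emeasure (jordan_pos \<sigma>) A \<le> ennreal c"
    using assms by (simp add: emeasure_jordan_pos pos_sup_least ennreal_leI)
  then show ?thesis using \<open>0 \<le> c\<close> by (simp add: emeasure_eq_measure ennreal_le_iff)
qed

text \<open>Passing from a subset of \<open>A\<close> to its complement in \<open>A\<close> turns the supremum for \<open>\<sigma>\<close> into the one for
  \<open>- \<sigma>\<close>, shifted by \<open>\<sigma> A\<close>.\<close>

lemma jordan_decomposition:
  assumes \<sigma>: "signed_measure \<sigma>" and A: "A \<in> sets borel"
  shows "\<sigma> A = measure (jordan_pos \<sigma>) A - measure (jordan_pos (\<lambda>A. - \<sigma> A)) A"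
proof -
  have le: "measure (jordan_pos \<sigma>) A \<le> \<sigma> A + measure (jordan_pos (\<lambda>A. - \<sigma> A)) A"
    if \<sigma>: "signed_measure \<sigma>" for \<sigma>
  proof (rule measure_jordan_pos_least[OF \<sigma> A])
    fix B assume B: "B \<in> sets borel" "B \<subseteq> A"
    have "- \<sigma> (A - B) \<le> measure (jordan_pos (\<lambda>A. - \<sigma> A)) A"
      by (rule measure_jordan_pos_upper[OF signed_measure_uminus[OF \<sigma>]]) (use A B in auto)
    then show "\<sigma> B \<le> \<sigma> A + measure (jordan_pos (\<lambda>A. - \<sigma> A)) A"
      using signed_measure_Diff[OF \<sigma> A] B by simp
  qed
  from le[OF \<sigma>] le[OF signed_measure_uminus[OF \<sigma>]] show ?thesis by simp
qed

text \<open>Indexing the positive and negative parts of the real and of the imaginary part by the units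
  \<open>1, -1, \<i>, -\<i>\<close> turns a complex measure into one linear combination of finite measures, whose coefficients are
  the indices.  Statements about finite measures then extend by linearity.\<close>

definition phases :: "complex set" where "phases = {1, -1, \<i>, -\<i>}"

definition jordan_part :: "(real set \<Rightarrow> complex) \<Rightarrow> complex \<Rightarrow> real measure" where
  "jordan_part \<nu> c = jordan_pos (\<lambda>A. Re (\<nu> A / c))"

lemma finite_phases [simp]: "finite phases" by (simp add: phases_def)

lemma norm_phases: "c \<in> phases \<Longrightarrow> cmod c = 1" by (auto simp: phases_def)

lemma sum_phases: "(\<Sum>c\<in>phases. f c) = f 1 + f (-1) + f \<i> + f (-\<i>)" for f :: "complex \<Rightarrow> 'a::comm_monoid_add"
  unfolding phases_def by (simp add: complex_eq_iff add.assoc)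

lemma sets_jordan_part [simp, measurable_cong]: "sets (jordan_part \<nu> c) = sets borel"
  by (simp add: jordan_part_def)

lemma space_jordan_part [simp]: "space (jordan_part \<nu> c) = UNIV"
  by (simp add: jordan_part_def)

lemma finite_measure_jordan_part: "complex_measure \<nu> \<Longrightarrow> finite_measure (jordan_part \<nu> c)"
  unfolding jordan_part_def by (intro finite_measure_jordan_pos signed_measure_Re_divide)

lemma cm_integral_eq_sum:
  "cm_integral \<nu> f = (\<Sum>c\<in>phases. c * (CLINT x | jordan_part \<nu> c. f x))"
  by (simp add: sum_phases cm_integral_def jordan_part_def algebra_simps)

lemma complex_measure_eq_sum:
  assumes \<nu>: "complex_measure \<nu>" and A: "A \<in> sets borel"
  shows "\<nu> A = (\<Sum>c\<in>phases. c * measure (jordan_part \<nu> c) A)"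
proof -
  have "Re (\<nu> A / 1) = measure (jordan_part \<nu> 1) A - measure (jordan_part \<nu> (-1)) A"
    using jordan_decomposition[OF signed_measure_Re_divide[OF \<nu>, of 1] A] by (simp add: jordan_part_def)
  moreover have "Re (\<nu> A / \<i>) = measure (jordan_part \<nu> \<i>) A - measure (jordan_part \<nu> (-\<i>)) A"
    using jordan_decomposition[OF signed_measure_Re_divide[OF \<nu>, of \<i>] A] by (simp add: jordan_part_def)
  ultimately show ?thesis
    by (simp add: sum_phases complex_eq_iff)
qed

section \<open>Linear combinations of finite measures\<close>

text \<open>The measures enter only through their values, so the identity is immediate for simple functions;
  one sequence of simple functions approximates the integrand dominatedly for all measures at once.\<close>

lemma sum_integrals_eq_0:
  fixes M :: "'j \<Rightarrow> real measure" and c :: "'j \<Rightarrow> complex" and f :: "real \<Rightarrow> complex"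
  assumes J: "finite J" and M: "\<And>j. j \<in> J \<Longrightarrow> finite_measure (M j)"
    and sets: "\<And>j. j \<in> J \<Longrightarrow> sets (M j) = sets borel"
    and int: "\<And>j. j \<in> J \<Longrightarrow> integrable (M j) f"
    and f: "f \<in> borel_measurable borel"
    and 0: "\<And>A. A \<in> sets borel \<Longrightarrow> (\<Sum>j\<in>J. c j * measure (M j) A) = 0"
  shows "(\<Sum>j\<in>J. c j * (CLINT x | M j. f x)) = 0"
proof -
  obtain F where F: "\<And>i. simple_function borel (F i)" "\<And>x. (\<lambda>i. F i x) \<longlonglongrightarrow> f x"
    "\<And>i x. norm (F i x) \<le> 2 * norm (f x)"
    using borel_measurable_implies_sequence_metric[OF f, of 0] by auto
  have simple: "(CLINT x | M j. F i x) = (\<Sum>y\<in>F i ` UNIV. measure (M j) (F i -` {y}) *\<^sub>R y)"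
    if j: "j \<in> J" for i j
  proof -
    interpret finite_measure "M j" by (rule M[OF j])
    have [measurable_cong]: "sets (M j) = sets borel" by (rule sets[OF j])
    have sp: "space (M j) = UNIV" using sets_eq_imp_space_eq[OF sets[OF j]] by simp
    have meas: "F i -` {y} \<in> sets (M j)" for y
      using simple_functionD(2)[OF F(1), of i "{y}"] by (simp add: sets[OF j])
    have fin: "finite (F i ` UNIV)" using simple_functionD(1)[OF F(1)[of i]] by simp
    have rep: "F i x = (\<Sum>y\<in>F i ` UNIV. indicator (F i -` {y}) x *\<^sub>R y)" for x
      using simple_function_indicator_representation_banach[OF F(1), of x i]
      unfolding space_borel Int_UNIV_right by blast
    have "(CLINT x | M j. F i x) = (CLINT x | M j. (\<Sum>y\<in>F i ` UNIV. indicator (F i -` {y}) x *\<^sub>R y))"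
      by (rule Bochner_Integration.integral_cong[OF refl]) (rule rep)
    also have "\<dots> = (\<Sum>y\<in>F i ` UNIV. (CLINT x | M j. indicator (F i -` {y}) x *\<^sub>R y))"
      by (rule Bochner_Integration.integral_sum)
        (auto intro!: integrable_scaleR_left integrable_real_indicator meas simp: emeasure_eq_measure)
    also have "\<dots> = (\<Sum>y\<in>F i ` UNIV. measure (M j) (F i -` {y}) *\<^sub>R y)"
      using meas by (intro sum.cong refl, subst integral_scaleR_left)
        (auto intro!: integrable_real_indicator simp: emeasure_eq_measure sp)
    finally show ?thesis .
  qed
  have "(\<Sum>j\<in>J. c j * (CLINT x | M j. F i x)) = 0" for i
  proof -
    have "(\<Sum>j\<in>J. c j * (CLINT x | M j. F i x))
        = (\<Sum>j\<in>J. \<Sum>y\<in>F i ` UNIV. c j * (measure (M j) (F i -` {y}) *\<^sub>R y))"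
      by (simp add: simple sum_distrib_left)
    also have "\<dots> = (\<Sum>y\<in>F i ` UNIV. (\<Sum>j\<in>J. c j * measure (M j) (F i -` {y})) * y)"
      by (subst sum.swap) (simp add: sum_distrib_right scaleR_conv_of_real mult.assoc)
    also have "\<dots> = 0"
      using simple_functionD(2)[OF F(1), of i "{_}"] by (intro sum.neutral ballI) (simp add: 0)
    finally show ?thesis .
  qed
  moreover have "(\<lambda>i. CLINT x | M j. F i x) \<longlonglongrightarrow> (CLINT x | M j. f x)" if j: "j \<in> J" for j
  proof (rule integral_dominated_convergence[where w = "\<lambda>x. 2 * norm (f x)"])
    have sp: "borel_measurable (M j) = borel_measurable borel"
      by (rule measurable_cong_sets) (simp_all add: sets[OF j])
    show "f \<in> borel_measurable (M j)" "\<And>i. F i \<in> borel_measurable (M j)"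
      using f F(1)[THEN borel_measurable_simple_function] unfolding sp by auto
  qed (use F int[OF j] in \<open>auto intro!: integrable_norm\<close>)
  then have "(\<lambda>i. \<Sum>j\<in>J. c j * (CLINT x | M j. F i x)) \<longlonglongrightarrow> (\<Sum>j\<in>J. c j * (CLINT x | M j. f x))"
    by (intro tendsto_intros)
  ultimately show ?thesis by (simp add: LIMSEQ_const_iff)
qed

lemma nn_integral_le_sum:
  fixes M :: "'j \<Rightarrow> real measure" and N :: "real measure"
  assumes J: "finite J" and N: "sets N = sets borel" and M: "\<And>j. j \<in> J \<Longrightarrow> sets (M j) = sets borel"
    and le: "\<And>A. A \<in> sets borel \<Longrightarrow> emeasure N A \<le> (\<Sum>j\<in>J. c j * emeasure (M j) A)"
    and f: "f \<in> borel_measurable borel"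
  shows "(\<integral>\<^sup>+x. f x \<partial>N) \<le> (\<Sum>j\<in>J. c j * (\<integral>\<^sup>+x. f x \<partial>M j))"
  using f
proof (induction rule: borel_measurable_induct)
  case (cong f g)
  then have "f = g" by auto
  then show ?case using cong by simp
next
  case (set A)
  then show ?case using le N M by simp
next
  case (mult u v)
  have mb: "u \<in> borel_measurable N" "\<And>j. j \<in> J \<Longrightarrow> u \<in> borel_measurable (M j)"
    using mult(2) by (simp_all cong: measurable_cong_sets add: N M)
  have "(\<integral>\<^sup>+x. v * u x \<partial>N) = v * (\<integral>\<^sup>+x. u x \<partial>N)" by (rule nn_integral_cmult[OF mb(1)])
  also have "\<dots> \<le> v * (\<Sum>j\<in>J. c j * (\<integral>\<^sup>+x. u x \<partial>M j))" using mult by (intro mult_left_mono) auto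
  also have "\<dots> = (\<Sum>j\<in>J. c j * (\<integral>\<^sup>+x. v * u x \<partial>M j))"
    by (auto simp: sum_distrib_left nn_integral_cmult[OF mb(2)] mult_ac intro!: sum.cong)
  finally show ?case .
next
  case (add u v)
  have mb: "w \<in> borel_measurable N" "\<And>j. j \<in> J \<Longrightarrow> w \<in> borel_measurable (M j)" 
    if "w \<in> borel_measurable borel" for w :: "real \<Rightarrow> ennreal"
    using that by (simp_all cong: measurable_cong_sets add: N M)
  show ?case
    using add by (simp add: nn_integral_add mb sum.distrib distrib_left add_mono)
next
  case (seq U)
  have mb: "U i \<in> borel_measurable N" "\<And>j. j \<in> J \<Longrightarrow> U i \<in> borel_measurable (M j)" for i
    using seq(1) by (simp_all cong: measurable_cong_sets add: N M)
  have "(\<integral>\<^sup>+x. (SUP i. U i) x \<partial>N) = (SUP i. \<integral>\<^sup>+x. U i x \<partial>N)"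
    unfolding SUP_apply by (rule nn_integral_monotone_convergence_SUP[OF \<open>incseq U\<close> mb(1)])
  also have "\<dots> \<le> (\<Sum>j\<in>J. c j * (\<integral>\<^sup>+x. (SUP i. U i) x \<partial>M j))"
  proof (rule SUP_least)
    fix i
    have "(\<integral>\<^sup>+x. U i x \<partial>N) \<le> (\<Sum>j\<in>J. c j * (\<integral>\<^sup>+x. U i x \<partial>M j))" by (rule seq)
    also have "\<dots> \<le> (\<Sum>j\<in>J. c j * (\<integral>\<^sup>+x. (SUP i. U i) x \<partial>M j))"
      by (intro sum_mono mult_left_mono nn_integral_mono) (auto intro: SUP_upper)
    finally show "(\<integral>\<^sup>+x. U i x \<partial>N) \<le> (\<Sum>j\<in>J. c j * (\<integral>\<^sup>+x. (SUP i. U i) x \<partial>M j))" .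
  qed
  finally show ?case .
qed

lemma complex_measure_sum:
  fixes M :: "'j \<Rightarrow> real measure" and c :: "'j \<Rightarrow> complex"
  assumes "\<And>j. j \<in> J \<Longrightarrow> finite_measure (M j)" and "\<And>j. j \<in> J \<Longrightarrow> sets (M j) = sets borel"
    and eq: "\<And>A. A \<in> sets borel \<Longrightarrow> \<nu> A = (\<Sum>j\<in>J. c j * measure (M j) A)"
  shows "complex_measure \<nu>"
  unfolding complex_measure_def
proof (intro conjI allI impI)
  show "\<nu> {} = 0" by (simp add: eq)
  fix A :: "nat \<Rightarrow> real set" assume A: "range A \<subseteq> sets borel \<and> disjoint_family A"
  then have A': "A n \<in> sets borel" "(\<Union>n. A n) \<in> sets borel" for n by auto
  have "(\<lambda>n. \<Sum>j\<in>J. c j * measure (M j) (A n)) sums (\<Sum>j\<in>J. c j * measure (M j) (\<Union>n. A n))"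
  proof (intro sums_sum sums_mult sums_of_real)
    fix j assume j: "j \<in> J"
    interpret finite_measure "M j" by (rule assms(1)[OF j])
    show "(\<lambda>n. measure (M j) (A n)) sums measure (M j) (\<Union>n. A n)"
      using A assms(2)[OF j] by (intro finite_measure_UNION) auto
  qed
  then show "(\<lambda>n. \<nu> (A n)) sums \<nu> (\<Union>n. A n)" by (simp add: eq A')
qed

lemma jordan_part_cong:
  assumes "\<And>A. A \<in> sets borel \<Longrightarrow> \<nu> A = \<rho> A"
  shows "jordan_part \<nu> c = jordan_part \<rho> c"
proof -
  have "(\<lambda>A. SUP B \<in> {B. B \<in> sets borel \<and> B \<subseteq> A}. ennreal (Re (\<nu> B / c))) =
    (\<lambda>A. SUP B \<in> {B. B \<in> sets borel \<and> B \<subseteq> A}. ennreal (Re (\<rho> B / c)))"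
    using assms by (intro ext SUP_cong) auto
  then show ?thesis unfolding jordan_part_def jordan_pos_def by simp
qed

lemma cm_integral_cong:
  assumes "\<And>A. A \<in> sets borel \<Longrightarrow> \<nu> A = \<rho> A"
  shows "cm_integral \<nu> f = cm_integral \<rho> f"
  by (simp add: cm_integral_eq_sum jordan_part_cong[OF assms])

text \<open>Every Jordan part is dominated by the combination with coefficients of absolute value, so that
  integrability of unbounded functions carries over.\<close>

lemma integrable_jordan_part_sum:
  fixes M :: "'j \<Rightarrow> real measure" and c :: "'j \<Rightarrow> complex" and f :: "real \<Rightarrow> complex"
  assumes J: "finite J" and M: "\<And>j. j \<in> J \<Longrightarrow> finite_measure (M j)"
    and sets: "\<And>j. j \<in> J \<Longrightarrow> sets (M j) = sets borel"
    and eq: "\<And>A. A \<in> sets borel \<Longrightarrow> \<nu> A = (\<Sum>j\<in>J. c j * measure (M j) A)"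
    and int: "\<And>j. j \<in> J \<Longrightarrow> integrable (M j) f"
    and f: "f \<in> borel_measurable borel" and d: "d \<in> phases"
  shows "integrable (jordan_part \<nu> d) f"
proof -
  have \<nu>: "complex_measure \<nu>" by (rule complex_measure_sum[OF M sets eq])
  interpret N: finite_measure "jordan_part \<nu> d" by (rule finite_measure_jordan_part[OF \<nu>])
  have le: "emeasure (jordan_part \<nu> d) A \<le> (\<Sum>j\<in>J. ennreal (cmod (c j)) * emeasure (M j) A)"
    if A: "A \<in> sets borel" for A
  proof -
    have "measure (jordan_part \<nu> d) A \<le> (\<Sum>j\<in>J. cmod (c j) * measure (M j) A)"
      unfolding jordan_part_def
    proof (rule measure_jordan_pos_least[OF signed_measure_Re_divide[OF \<nu>] A])
      fix B :: "real set" assume B: "B \<in> sets borel" "B \<subseteq> A"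
      have "Re (\<nu> B / d) \<le> cmod (\<nu> B / d)" by (rule complex_Re_le_cmod)
      also have "\<dots> = cmod (\<Sum>j\<in>J. c j * measure (M j) B)"
        using norm_phases[OF d] by (simp add: norm_divide eq[OF B(1)])
      also have "\<dots> \<le> (\<Sum>j\<in>J. cmod (c j) * measure (M j) B)"
        by (rule order_trans[OF norm_sum]) (simp add: norm_mult)
      also have "\<dots> \<le> (\<Sum>j\<in>J. cmod (c j) * measure (M j) A)"
        using A B by (intro sum_mono mult_left_mono finite_measure.finite_measure_mono[OF M]) (auto simp: sets)
      finally show "Re (\<nu> B / d) \<le> (\<Sum>j\<in>J. cmod (c j) * measure (M j) A)" .
    qed
    then have "emeasure (jordan_part \<nu> d) A \<le> ennreal (\<Sum>j\<in>J. cmod (c j) * measure (M j) A)"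
      by (simp add: N.emeasure_eq_measure ennreal_leI)
    also have "\<dots> = (\<Sum>j\<in>J. ennreal (cmod (c j)) * emeasure (M j) A)"
      by (auto simp: sum_ennreal[symmetric] ennreal_mult finite_measure.emeasure_eq_measure[OF M] intro!: sum.cong)
    finally show ?thesis .
  qed
  have "(\<integral>\<^sup>+x. ennreal (norm (f x)) \<partial>jordan_part \<nu> d)
      \<le> (\<Sum>j\<in>J. ennreal (cmod (c j)) * (\<integral>\<^sup>+x. ennreal (norm (f x)) \<partial>M j))"
    by (rule nn_integral_le_sum[OF J _ sets le]) (use f in auto)
  also have "\<dots> < \<infinity>"
  proof -
    have "ennreal (cmod (c j)) * (\<integral>\<^sup>+x. ennreal (norm (f x)) \<partial>M j) < \<infinity>" if "j \<in> J" for j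
      using int[OF that] unfolding integrable_iff_bounded by (simp add: ennreal_mult_less_top)
    then show ?thesis using J by simp
  qed
  finally show ?thesis unfolding integrable_iff_bounded using f by simp
qed

text \<open>The Jordan parts and the given measures, the latter with opposite coefficients, form a vanishing
  linear combination.  Thus integrals do not depend on the chosen representation.\<close>

lemma cm_integral_sum:
  fixes M :: "'j \<Rightarrow> real measure" and c :: "'j \<Rightarrow> complex" and f :: "real \<Rightarrow> complex"
  assumes J: "finite J" and M: "\<And>j. j \<in> J \<Longrightarrow> finite_measure (M j)"
    and sets: "\<And>j. j \<in> J \<Longrightarrow> sets (M j) = sets borel"
    and eq: "\<And>A. A \<in> sets borel \<Longrightarrow> \<nu> A = (\<Sum>j\<in>J. c j * measure (M j) A)"
    and int: "\<And>j. j \<in> J \<Longrightarrow> integrable (M j) f"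
    and f: "f \<in> borel_measurable borel"
  shows "cm_integral \<nu> f = (\<Sum>j\<in>J. c j * (CLINT x | M j. f x))"
proof -
  have \<nu>: "complex_measure \<nu>" by (rule complex_measure_sum[OF M sets eq])
  let ?N = "case_sum (jordan_part \<nu>) M" and ?d = "case_sum (\<lambda>p. p) (\<lambda>j. - c j)"
  have "(\<Sum>j\<in>phases <+> J. ?d j * (CLINT x | ?N j. f x)) = 0"
  proof (rule sum_integrals_eq_0[OF _ _ _ _ f])
    fix A :: "real set" assume A: "A \<in> sets borel"
    have "\<nu> A = (\<Sum>j\<in>phases. j * measure (jordan_part \<nu> j) A)" by (rule complex_measure_eq_sum[OF \<nu> A])
    with eq[OF A] show "(\<Sum>j\<in>phases <+> J. ?d j * measure (?N j) A) = 0"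
      using J by (simp add: sum.Plus sum_negf)
  next
    fix j assume j: "j \<in> phases <+> J"
    show "finite_measure (?N j)" using j by (auto intro: M finite_measure_jordan_part[OF \<nu>])
    show "sets (?N j) = sets borel" using j by (auto simp: sets)
    show "integrable (?N j) f"
      using j by (auto intro: int integrable_jordan_part_sum[OF J M sets eq int f])
  qed (use J in simp)
  then show ?thesis using J by (simp add: sum.Plus sum_negf cm_integral_eq_sum)
qed

lemma complex_measure_Diff:
  assumes "complex_measure \<nu>" "A \<in> sets borel" "B \<in> sets borel" "B \<subseteq> A"
  shows "\<nu> (A - B) = \<nu> A - \<nu> B"
proof -
  have "\<nu> (B \<union> (A - B)) = \<nu> B + \<nu> (A - B)"
    using assms by (intro complex_measure_Un) auto
  moreover have "B \<union> (A - B) = A" using assms by auto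
  ultimately show ?thesis by simp
qed

lemma tendsto_complex_measure_incseq:
  assumes \<nu>: "complex_measure \<nu>" and A: "\<And>n. A n \<in> sets borel" "incseq A"
  shows "(\<lambda>n. \<nu> (A n)) \<longlonglongrightarrow> \<nu> (\<Union>n. A n)"
proof -
  have "(\<lambda>n. measure (jordan_part \<nu> c) (A n)) \<longlonglongrightarrow> measure (jordan_part \<nu> c) (\<Union>n. A n)" for c
    using finite_measure.finite_Lim_measure_incseq[OF finite_measure_jordan_part[OF \<nu>], of A c] A by auto
  then have "(\<lambda>n. \<Sum>c\<in>phases. c * measure (jordan_part \<nu> c) (A n))
      \<longlonglongrightarrow> (\<Sum>c\<in>phases. c * measure (jordan_part \<nu> c) (\<Union>n. A n))"
    by (intro tendsto_intros)
  then show ?thesis using A by (simp add: complex_measure_eq_sum[OF \<nu>])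
qed

text \<open>The half-open intervals are stable under intersection and generate the Borel sets; the whole
  line is an increasing union of them.\<close>

lemma complex_measure_eqI:
  assumes \<nu>: "complex_measure \<nu>" and \<rho>: "complex_measure \<rho>"
    and eq: "\<And>a b. a \<le> b \<Longrightarrow> \<nu> {a<..b} = \<rho> {a<..b}"
    and A: "A \<in> sets borel"
  shows "\<nu> A = \<rho> A"
proof -
  have "(\<lambda>n. \<nu> {- real n<..real n}) \<longlonglongrightarrow> \<nu> (\<Union>n. {- real n<..real n})"
    "(\<lambda>n. \<rho> {- real n<..real n}) \<longlonglongrightarrow> \<rho> (\<Union>n. {- real n<..real n})"
    by (intro tendsto_complex_measure_incseq \<nu> \<rho>; auto simp: incseq_def)+
  then have UNIV: "\<nu> UNIV = \<rho> UNIV"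
    using eq by (simp add: UN_Ioc_eq_UNIV LIMSEQ_unique)
  have "Int_stable (range (\<lambda>(a, b). {a<..b::real}))"
    by (force simp: Int_stable_def)
  moreover have "range (\<lambda>(a, b). {a<..b::real}) \<subseteq> Pow UNIV" by simp
  moreover have "A \<in> sigma_sets UNIV (range (\<lambda>(a, b). {a<..b::real}))"
    using A unfolding borel_sigma_sets_Ioc by simp
  ultimately show ?thesis
  proof (induction rule: sigma_sets_induct_disjoint)
    case (basic A)
    then obtain a b where "A = {a<..b}" by auto
    then show ?case
      using eq[of a b] \<nu> \<rho> by (cases "a \<le> b") (auto simp: complex_measure_def)
  next
    case empty
    then show ?case using \<nu> \<rho> by (simp add: complex_measure_def)
  next
    case (compl A)
    then have "A \<in> sets borel" unfolding borel_sigma_sets_Ioc by simp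
    then show ?case using compl UNIV by (simp add: complex_measure_Diff[OF \<nu>] complex_measure_Diff[OF \<rho>])
  next
    case (union A)
    then have "range A \<subseteq> sets borel" unfolding borel_sigma_sets_Ioc by auto
    then have "(\<lambda>n. \<nu> (A n)) sums \<nu> (\<Union>n. A n)" "(\<lambda>n. \<rho> (A n)) sums \<rho> (\<Union>n. A n)"
      using union(1) by (auto intro: complex_measure_sums[OF \<nu>] complex_measure_sums[OF \<rho>])
    then show ?case using union(3) sums_unique2[of "\<lambda>n. \<rho> (A n)"] by simp
  qed
qed

section \<open>Purely atomic complex measures\<close>

lemma total_variation_finite:
  assumes \<nu>: "complex_measure \<nu>" and "A \<in> sets borel"
  shows "total_variation \<nu> A \<le> ennreal (\<Sum>c\<in>phases. measure (jordan_part \<nu> c) A)"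
  unfolding total_variation_def
proof (rule SUP_least, safe)
  fix P :: "real set set"
  assume P: "finite P" "P \<subseteq> sets borel" "disjoint P" "A = \<Union>P"
  have "(\<Sum>E\<in>P. ennreal (cmod (\<nu> E))) = ennreal (\<Sum>E\<in>P. cmod (\<nu> E))" by (simp add: sum_ennreal)
  also have "\<dots> \<le> ennreal (\<Sum>E\<in>P. \<Sum>c\<in>phases. measure (jordan_part \<nu> c) E)"
  proof (intro ennreal_leI sum_mono)
    fix E assume "E \<in> P"
    then have "\<nu> E = (\<Sum>c\<in>phases. c * measure (jordan_part \<nu> c) E)"
      using P by (intro complex_measure_eq_sum[OF \<nu>]) auto
    also have "cmod \<dots> \<le> (\<Sum>c\<in>phases. measure (jordan_part \<nu> c) E)"
      by (intro sum_norm_le) (simp add: norm_mult norm_phases)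
    finally show "cmod (\<nu> E) \<le> (\<Sum>c\<in>phases. measure (jordan_part \<nu> c) E)" .
  qed
  also have "(\<Sum>E\<in>P. \<Sum>c\<in>phases. measure (jordan_part \<nu> c) E)
      = (\<Sum>c\<in>phases. measure (jordan_part \<nu> c) (\<Union>P))"
  proof (subst sum.swap, intro sum.cong refl)
    fix c
    interpret finite_measure "jordan_part \<nu> c" by (rule finite_measure_jordan_part[OF \<nu>])
    show "(\<Sum>E\<in>P. measure (jordan_part \<nu> c) E) = measure (jordan_part \<nu> c) (\<Union>P)"
      using P finite_measure_finite_Union[of P "\<lambda>E. E"]
      by (auto simp: disjoint_family_on_def disjoint_def)
  qed
  finally show "(\<Sum>E\<in>P. ennreal (cmod (\<nu> E))) \<le> ennreal (\<Sum>c\<in>phases. measure (jordan_part \<nu> c) (\<Union>P))" .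
qed

lemma countable_discontinuities:
  assumes \<nu>: "complex_measure \<nu>"
  shows "countable (discontinuities \<nu>)"
proof (rule countable_subset)
  show "discontinuities \<nu> \<subseteq> (\<Union>c\<in>phases. {x. measure (jordan_part \<nu> c) {x} \<noteq> 0})"
    using complex_measure_eq_sum[OF \<nu>, of "{_}"] by (force simp: discontinuities_def intro: sum.neutral)
  show "countable (\<Union>c\<in>phases. {x. measure (jordan_part \<nu> c) {x} \<noteq> 0})"
    by (intro countable_UN finite_measure.countable_support[OF finite_measure_jordan_part[OF \<nu>]]
        countable_finite) simp
qed

text \<open>A Borel set of nonzero value that avoids the atoms could be added to every partition of the set of atoms, and this
  would increase the total variation, which is finite.\<close>

lemma null_outside_discontinuities:
  assumes \<kappa>: "complex_measure \<kappa>"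
    and tv: "total_variation \<kappa> UNIV = total_variation \<kappa> (discontinuities \<kappa>)"
    and A: "A \<in> sets borel" "A \<inter> discontinuities \<kappa> = {}"
  shows "\<kappa> A = 0"
proof (rule ccontr)
  assume nz: "\<kappa> A \<noteq> 0"
  define D where "D = discontinuities \<kappa>"
  have D: "D \<in> sets borel"
    unfolding D_def using countable_discontinuities[OF \<kappa>] by (auto intro: sets.countable)
  have 1: "(\<Sum>E\<in>P. ennreal (cmod (\<kappa> E))) + ennreal (cmod (\<kappa> A)) \<le> total_variation \<kappa> D"
    if P: "finite P" "P \<subseteq> sets borel" "disjoint P" "\<Union>P = D" for P
  proof -
    have Ane: "A \<noteq> {}" using nz \<kappa> by (auto simp: complex_measure_def)
    have "A \<notin> P" using Ane A(2) P(4) by (auto simp: D_def)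
    then have "(\<Sum>E\<in>P. ennreal (cmod (\<kappa> E))) + ennreal (cmod (\<kappa> A)) = (\<Sum>E\<in>insert A P. ennreal (cmod (\<kappa> E)))"
      using P(1) by (simp add: add.commute del: sum_ennreal)
    also have "\<dots> \<le> (\<Sum>E\<in>insert (- (D \<union> A)) (insert A P). ennreal (cmod (\<kappa> E)))"
      by (rule sum_mono2) (use P in auto)
    also have "\<dots> \<le> total_variation \<kappa> UNIV"
      unfolding total_variation_def
    proof (rule SUP_upper, intro CollectI conjI)
      show "disjoint (insert (- (D \<union> A)) (insert A P))"
        using P(3,4) A(2) by (auto simp: disjoint_def D_def)
    qed (use P A D in auto)
    also have "\<dots> = total_variation \<kappa> D" unfolding D_def by (rule tv)
    finally show ?thesis .
  qed
  have ne: "{P. finite P \<and> P \<subseteq> sets borel \<and> disjoint P \<and> \<Union>P = D} \<noteq> {}"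
    using D by (auto intro!: exI[of _ "{D}"])
  have "total_variation \<kappa> D + ennreal (cmod (\<kappa> A)) \<le> total_variation \<kappa> D"
    by (subst total_variation_def, subst ennreal_SUP_add_left[symmetric, OF ne], rule SUP_least, rule 1) auto
  moreover have "total_variation \<kappa> D < \<infinity>"
    by (rule le_less_trans[OF total_variation_finite[OF \<kappa> D]]) simp
  ultimately have "ennreal (cmod (\<kappa> A)) = 0"
    by (cases "total_variation \<kappa> D") (auto simp: ennreal_plus[symmetric] ennreal_le_iff simp del: ennreal_plus)
  then show False using nz by simp
qed

lemma AE_jordan_part_discontinuities:
  assumes \<kappa>: "complex_measure \<kappa>"
    and tv: "total_variation \<kappa> UNIV = total_variation \<kappa> (discontinuities \<kappa>)"
  shows "AE x in jordan_part \<kappa> c. x \<in> discontinuities \<kappa>"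
proof (rule AE_I)
  define D where "D = discontinuities \<kappa>"
  have D: "D \<in> sets borel"
    unfolding D_def using countable_discontinuities[OF \<kappa>] by (auto intro: sets.countable)
  interpret finite_measure "jordan_part \<kappa> c" by (rule finite_measure_jordan_part[OF \<kappa>])
  show "- discontinuities \<kappa> \<in> sets (jordan_part \<kappa> c)" using D by (simp add: D_def)
  have "measure (jordan_part \<kappa> c) (- discontinuities \<kappa>) \<le> 0"
    unfolding jordan_part_def
  proof (rule measure_jordan_pos_least[OF signed_measure_Re_divide[OF \<kappa>]])
    fix B assume "B \<in> sets borel" "B \<subseteq> - discontinuities \<kappa>"
    then have "\<kappa> B = 0" by (intro null_outside_discontinuities[OF \<kappa> tv]) auto
    then show "Re (\<kappa> B / c) \<le> 0" by simp
  qed (use D in \<open>simp add: D_def\<close>)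
  then show "emeasure (jordan_part \<kappa> c) (- discontinuities \<kappa>) = 0"
    by (simp add: emeasure_eq_measure measure_le_0_iff)
qed auto

section \<open>Functions of bounded variation\<close>

text \<open>Bounded variation on a set of reals, in a form in which the bound is explicit and in which
  infinite suprema do not occur.\<close>

definition var_le :: "(real \<Rightarrow> complex) \<Rightarrow> real set \<Rightarrow> real \<Rightarrow> bool" where
  "var_le f S V \<longleftrightarrow> (\<forall>n t. (\<forall>i\<le>n. t i \<in> S) \<and> (\<forall>i<n. t i \<le> t (Suc i)) \<longrightarrow>
     (\<Sum>i<n. cmod (f (t (Suc i)) - f (t i))) \<le> V)"

lemma var_leD:
  "var_le f S V \<Longrightarrow> (\<And>i. i \<le> n \<Longrightarrow> t i \<in> S) \<Longrightarrow> (\<And>i. i < n \<Longrightarrow> t i \<le> t (Suc i)) \<Longrightarrow>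
    (\<Sum>i<n. cmod (f (t (Suc i)) - f (t i))) \<le> V"
  unfolding var_le_def by blast

lemma var_le_nonneg: "var_le f S V \<Longrightarrow> S \<noteq> {} \<Longrightarrow> 0 \<le> V"
  using var_leD[of f S V 0] by force

lemma var_le_mono: "var_le f S V \<Longrightarrow> T \<subseteq> S \<Longrightarrow> V \<le> W \<Longrightarrow> var_le f T W"
  unfolding var_le_def by (meson order_trans subset_iff)

lemma var_le_dist:
  assumes "var_le f S V" "s \<in> S" "t \<in> S"
  shows "cmod (f t - f s) \<le> V"
proof -
  have 1: "cmod (f t - f s) \<le> V" if "s \<in> S" "t \<in> S" "s \<le> t" for s t
    using var_leD[OF assms(1), of 1 "\<lambda>i. if i = 0 then s else t"] that by auto
  show ?thesis using 1[of s t] 1[of t s] assms by (cases "s \<le> t") (auto simp: norm_minus_commute)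
qed

lemma var_le_mult:
  assumes f: "var_le f S V" "\<And>t. t \<in> S \<Longrightarrow> cmod (f t) \<le> A"
    and g: "var_le g S W" "\<And>t. t \<in> S \<Longrightarrow> cmod (g t) \<le> B"
    and "0 \<le> A" "0 \<le> B"
  shows "var_le (\<lambda>t. f t * g t) S (A * W + V * B)"
  unfolding var_le_def
proof (intro allI impI, elim conjE)
  fix n :: nat and t assume t: "\<forall>i\<le>n. t i \<in> S" "\<forall>i<n. t i \<le> t (Suc i)"
  have "(\<Sum>i<n. cmod (f (t (Suc i)) * g (t (Suc i)) - f (t i) * g (t i)))
     \<le> (\<Sum>i<n. A * cmod (g (t (Suc i)) - g (t i)) + cmod (f (t (Suc i)) - f (t i)) * B)"
  proof (rule sum_mono)
    fix i assume i: "i \<in> {..<n}"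
    have "f (t (Suc i)) * g (t (Suc i)) - f (t i) * g (t i)
      = f (t (Suc i)) * (g (t (Suc i)) - g (t i)) + (f (t (Suc i)) - f (t i)) * g (t i)"
      by (simp add: algebra_simps)
    also have "cmod \<dots> \<le> cmod (f (t (Suc i))) * cmod (g (t (Suc i)) - g (t i)) + cmod (f (t (Suc i)) - f (t i)) * cmod (g (t i))"
      by (rule order_trans[OF norm_triangle_ineq]) (simp add: norm_mult)
    also have "\<dots> \<le> A * cmod (g (t (Suc i)) - g (t i)) + cmod (f (t (Suc i)) - f (t i)) * B"
      using i t f(2) g(2) by (intro add_mono mult_mono) (auto simp: assms)
    finally show "cmod (f (t (Suc i)) * g (t (Suc i)) - f (t i) * g (t i))
      \<le> A * cmod (g (t (Suc i)) - g (t i)) + cmod (f (t (Suc i)) - f (t i)) * B" .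
  qed
  also have "\<dots> = A * (\<Sum>i<n. cmod (g (t (Suc i)) - g (t i))) + (\<Sum>i<n. cmod (f (t (Suc i)) - f (t i))) * B"
    by (simp add: sum.distrib sum_distrib_left sum_distrib_right)
  also have "\<dots> \<le> A * W + V * B"
    using t by (intro add_mono mult_left_mono mult_right_mono var_leD[OF f(1)] var_leD[OF g(1)]) (auto simp: assms)
  finally show "(\<Sum>i<n. cmod (f (t (Suc i)) * g (t (Suc i)) - f (t i) * g (t i))) \<le> A * W + V * B" .
qed

lemma var_le_power:
  assumes f: "var_le f S V" "\<And>t. t \<in> S \<Longrightarrow> cmod (f t) \<le> 1"
  shows "var_le (\<lambda>t. f t ^ n) S (n * V)"
proof (induction n)
  case 0
  then show ?case by (simp add: var_le_def)
next
  case (Suc n)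
  have "var_le (\<lambda>t. f t * f t ^ n) S (1 * (n * V) + V * 1)"
    by (rule var_le_mult[OF f Suc]) (use f(2) in \<open>auto simp: norm_power power_le_one\<close>)
  then show ?case by (simp add: algebra_simps)
qed

lemma var_le_one_minus: "var_le f S V \<Longrightarrow> var_le (\<lambda>t. 1 - f t) S V"
  unfolding var_le_def by (simp add: norm_minus_commute)

lemma variation_imp_var_le:
  assumes "variation f S \<le> ennreal V" "0 \<le> V" "\<And>t. t \<in> T \<Longrightarrow> ereal t \<in> S"
  shows "var_le (\<lambda>t. f (ereal t)) T V"
  unfolding var_le_def
proof (intro allI impI)
  fix n and t :: "nat \<Rightarrow> real" assume t: "(\<forall>i\<le>n. t i \<in> T) \<and> (\<forall>i<n. t i \<le> t (Suc i))"
  let ?t = "\<lambda>i. ereal (t i)"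
  have "ennreal (\<Sum>i<n. cmod (f (?t (Suc i)) - f (?t i))) = (\<Sum>i<n. ennreal (cmod (f (?t (Suc i)) - f (?t i))))"
    by (simp add: sum_ennreal)
  also have "\<dots> \<le> variation f S"
    unfolding variation_def
    by (rule SUP_upper2[of "(n, ?t)"]) (use t assms(3) in auto)
  also note assms(1)
  finally show "(\<Sum>i<n. cmod (f (?t (Suc i)) - f (?t i))) \<le> V" using assms(2) by (simp add: ennreal_le_iff)
qed

lemma variation_lt_top_imp_var_le:
  assumes "variation f S < \<infinity>" "\<And>t. t \<in> T \<Longrightarrow> ereal t \<in> S"
  obtains V where "0 \<le> V" "var_le (\<lambda>t. f (ereal t)) T V"
proof
  show "var_le (\<lambda>t. f (ereal t)) T (enn2real (variation f S))"
    using assms by (intro variation_imp_var_le[of f S]) (auto simp: less_top)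
qed simp

lemma sum_lessThan_add: "(\<Sum>i<a + b. g i) = (\<Sum>i<a. g i) + (\<Sum>i<b. g (a + i))"
  for g :: "nat \<Rightarrow> real"
  by (induction b) (auto simp: add.assoc)

text \<open>A partition that almost exhausts the variation leaves little variation to the right of its
  last point.\<close>

lemma var_le_tail:
  assumes V: "var_le f {T..} V" and e: "0 < e"
  obtains R where "T \<le> R" "var_le f {R..} e"
proof -
  define X where "X = {(\<Sum>i<n. cmod (f (t (Suc i)) - f (t i))) | n t.
    (\<forall>i\<le>n. t i \<in> {T..}) \<and> (\<forall>i<n. t i \<le> t (Suc i))}"
  have X0: "(0::real) \<in> X" unfolding X_def by (intro CollectI exI[of _ 0] exI[of _ "\<lambda>_. T"]) auto
  have bdd: "bdd_above X" unfolding X_def by (rule bdd_aboveI[of _ V]) (use V in \<open>auto simp: var_le_def\<close>)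
  have "\<exists>x\<in>X. Sup X - e < x" using X0 e bdd by (intro less_cSup_iff[THEN iffD1]) auto
  then obtain n t where t: "\<forall>i\<le>n. t i \<in> {T..}" "\<forall>i<n. t i \<le> t (Suc i)"
    and gt: "Sup X - e < (\<Sum>i<n. cmod (f (t (Suc i)) - f (t i)))"
    unfolding X_def by blast
  show ?thesis
  proof
    show "T \<le> t n" using t(1) by auto
    show "var_le f {t n..} e"
      unfolding var_le_def
    proof (intro allI impI, elim conjE)
      fix m :: nat and s assume s: "\<forall>i\<le>m. s i \<in> {t n..}" "\<forall>i<m. s i \<le> s (Suc i)"
      \<comment> \<open>The partition \<open>t\<close>, followed by \<open>s\<close>.\<close>
      define r where "r i = (if i \<le> n then t i else s (i - Suc n))" for i
      define G where "G i = cmod (f (r (Suc i)) - f (r i))" for i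
      have "(\<Sum>i<Suc n + m. G i) \<in> X"
        unfolding X_def G_def
      proof (intro CollectI exI[of _ "Suc n + m"] exI[of _ r] conjI refl allI impI)
        fix i assume "i \<le> Suc n + m"
        then show "r i \<in> {T..}"
          using t(1) s(1) order_trans[of T "t n" "s (i - Suc n)"] by (auto simp: r_def)
      next
        fix i assume i: "i < Suc n + m"
        consider "i < n" | "i = n" | "i > n" by linarith
        then show "r i \<le> r (Suc i)"
        proof cases
          case 3
          then obtain k where "i = Suc n + k" by (metis less_natE add_Suc)
          then show ?thesis using s(2) i by (auto simp: r_def)
        qed (use t(2) s(1) in \<open>auto simp: r_def\<close>)
      qed
      then have "(\<Sum>i<Suc n + m. G i) \<le> Sup X"
        by (rule cSup_upper[OF _ bdd])
      moreover have "(\<Sum>i<Suc n + m. G i) = (\<Sum>i<n. G i) + G n + (\<Sum>i<m. G (Suc n + i))"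
        by (simp only: sum_lessThan_add sum.lessThan_Suc)
      moreover have "(\<Sum>i<n. G i) = (\<Sum>i<n. cmod (f (t (Suc i)) - f (t i)))"
        by (rule sum.cong) (auto simp: G_def r_def)
      moreover have "(\<Sum>i<m. G (Suc n + i)) = (\<Sum>i<m. cmod (f (s (Suc i)) - f (s i)))"
        by (rule sum.cong) (auto simp: G_def r_def)
      moreover have "0 \<le> G n" by (simp add: G_def)
      ultimately show "(\<Sum>i<m. cmod (f (s (Suc i)) - f (s i))) \<le> e"
        using gt by linarith
    qed
  qed
qed

section \<open>Stieltjes measures\<close>

lemma finite_measure_interval_measure:
  assumes mono: "mono H" and cont: "\<And>a. continuous (at_right a) H" and bd: "\<And>x. \<bar>H x\<bar> \<le> B"
  shows "finite_measure (interval_measure H)"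
proof (rule finite_measureI)
  have le: "emeasure (interval_measure H) {- real n<..real n} \<le> ennreal (2 * B)" for n
  proof -
    have "emeasure (interval_measure H) {- real n<..real n} = ennreal (H (real n) - H (- real n))"
      by (rule emeasure_interval_measure_Ioc) (use mono cont in \<open>auto simp: mono_def\<close>)
    also have "\<dots> \<le> ennreal (2 * B)"
      using bd[of "real n"] bd[of "- real n"] by (intro ennreal_leI) linarith
    finally show ?thesis .
  qed
  have "(SUP n. emeasure (interval_measure H) {- real n<..real n}) = emeasure (interval_measure H) (\<Union>n. {- real n<..real n})"
    by (rule SUP_emeasure_incseq) (auto simp: incseq_def)
  then have "emeasure (interval_measure H) UNIV \<le> ennreal (2 * B)"
    using le by (metis (mono_tags, lifting) SUP_least UN_Ioc_eq_UNIV)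
  then show "emeasure (interval_measure H) (space (interval_measure H)) \<noteq> \<infinity>"
    by (auto simp: top_unique)
qed

text \<open>Passing to right limits makes a monotone function right-continuous and does not change a
  right-continuous difference of two monotone functions; so the variation function may be replaced by its
  right limits when the Stieltjes measure is constructed.\<close>

lemma right_regularization:
  assumes mono: "mono h" and bd: "\<And>x::real. \<bar>h x\<bar> \<le> (B::real)"
  obtains H where "mono H" "\<And>x. \<bar>H x\<bar> \<le> B" "\<And>a. continuous (at_right a) H"
    "\<And>x. (h \<longlongrightarrow> H x) (at_right x)"
proof
  define H where "H x = Inf (h ` {x<..})" for x
  have lower: "- B \<le> h x" "h x \<le> B" for x using bd[of x] by auto
  have bb: "bdd_below (h ` S)" for S by (rule bdd_belowI[of _ "- B"]) (use lower in auto)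
  show lim: "(h \<longlongrightarrow> H x) (at_right x)" for x
    using Lim_right_bound[of UNIV x h "- B"] mono lower by (auto simp: H_def mono_def)
  have H_le: "H x \<le> h y" if "x < y" for x y
    unfolding H_def by (rule cInf_lower) (use that bb in auto)
  have H_ge: "h x \<le> H x" for x
    unfolding H_def by (rule cInf_greatest) (use mono in \<open>auto simp: mono_def\<close>)
  show "\<bar>H x\<bar> \<le> B" for x
    using H_le[of x "x + 1"] H_ge[of x] lower[of x] lower[of "x + 1"] by simp
  show mH: "mono H"
    unfolding H_def mono_def by (intro allI impI cInf_superset_mono bb) auto
  show "continuous (at_right a) H" for a
    unfolding continuous_within
  proof (rule tendsto_sandwich)
    show "\<forall>\<^sub>F x in at_right a. H a \<le> H x"
      using mH by (auto simp: eventually_at_filter mono_def)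
    show "\<forall>\<^sub>F x in at_right a. H x \<le> h (2 * x - a)"
      unfolding eventually_at_filter by (rule always_eventually) (auto intro: H_le)
    have "filterlim (\<lambda>x. 2 * x - a) (at_right a) (at_right a)"
      unfolding filterlim_at
    proof
      show "\<forall>\<^sub>F x in at_right a. 2 * x - a \<in> {a<..} \<and> 2 * x - a \<noteq> a"
        unfolding eventually_at_filter by (rule always_eventually) auto
      have "((\<lambda>x. 2 * x - a) \<longlongrightarrow> 2 * a - a) (at_right a)" by (intro tendsto_intros)
      then show "((\<lambda>x. 2 * x - a) \<longlongrightarrow> a) (at_right a)" by simp
    qed
    then show "((\<lambda>x. h (2 * x - a)) \<longlongrightarrow> H a) (at_right a)"
      by (rule filterlim_compose[OF lim])
  qed auto
qed

text \<open>The majorant is the variation to the left of the argument.\<close>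

lemma monotone_majorant:
  assumes V: "var_le F UNIV V"
  obtains v where "mono v" "\<And>x. 0 \<le> v x \<and> v x \<le> V" "\<And>x y. x \<le> y \<Longrightarrow> cmod (F y - F x) \<le> v y - v x"
proof
  define X where "X x = {(\<Sum>i<n. cmod (F (t (Suc i)) - F (t i))) | n t.
    (\<forall>i\<le>n. t i \<le> x) \<and> (\<forall>i<n. t i \<le> t (Suc i))}" for x
  define v where "v x = Sup (X x)" for x
  have X0: "0 \<in> X x" for x
    unfolding X_def by (intro CollectI exI[of _ 0] exI[of _ "\<lambda>_. x"]) auto
  have XV: "s \<le> V" if "s \<in> X x" for s x
    using that V unfolding X_def by (auto simp: var_le_def)
  have bdd: "bdd_above (X x)" for x by (rule bdd_aboveI[of _ V]) (rule XV)
  show "0 \<le> v x \<and> v x \<le> V" for x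
    unfolding v_def using cSup_upper[OF X0 bdd] cSup_least[of "X x" V] XV X0 by blast
  show inc: "cmod (F y - F x) \<le> v y - v x" if xy: "x \<le> y" for x y
  proof -
    have "s + cmod (F y - F x) \<le> v y" if "s \<in> X x" for s
    proof -
      from that obtain n t where t: "\<forall>i\<le>n. t i \<le> x" "\<forall>i<n. t i \<le> t (Suc i)"
        and s: "s = (\<Sum>i<n. cmod (F (t (Suc i)) - F (t i)))"
        unfolding X_def by blast
      define r where "r i = (if i \<le> n then t i else if i = Suc n then x else y)" for i
      define G where "G i = cmod (F (r (Suc i)) - F (r i))" for i
      have "(\<Sum>i<Suc (Suc n). G i) \<in> X y"
        unfolding X_def G_def
        by (intro CollectI exI[of _ "Suc (Suc n)"] exI[of _ r])
          (use t xy in \<open>auto simp: r_def less_Suc_eq le_Suc_eq intro: order_trans\<close>)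
      then have "(\<Sum>i<Suc (Suc n). G i) \<le> v y" unfolding v_def by (rule cSup_upper[OF _ bdd])
      moreover have "(\<Sum>i<n. G i) = s" unfolding s by (rule sum.cong) (auto simp: G_def r_def)
      moreover have "0 \<le> G n" "G (Suc n) = cmod (F y - F x)" by (auto simp: G_def r_def)
      ultimately show ?thesis by simp
    qed
    then have "v x \<le> v y - cmod (F y - F x)"
      unfolding v_def[of x] using X0 by (intro cSup_least) (auto simp: algebra_simps)
    then show ?thesis by simp
  qed
  show "mono v"
    by (rule monoI) (use inc norm_ge_zero order_trans in \<open>metis diff_ge_0_iff_ge\<close>)
qed

text \<open>Real and imaginary part become monotone when the variation function is added, and the latter
  is monotone itself.  Their right-continuous versions generate the measures
  that are combined.\<close>

lemma stieltjes_measure_exists: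
  assumes V: "var_le F UNIV V" and cont: "\<And>x. continuous (at_right x) F"
  shows "\<exists>\<nu>. complex_measure \<nu> \<and> (\<forall>a b. a \<le> b \<longrightarrow> \<nu> {a<..b} = F b - F a)"
proof -
  obtain v where v: "mono v" "\<And>x. 0 \<le> v x \<and> v x \<le> V"
    "\<And>x y. x \<le> y \<Longrightarrow> cmod (F y - F x) \<le> v y - v x"
    using monotone_majorant[OF V] by blast
  define B where "B = cmod (F 0) + 2 * V"
  have F_bd: "cmod (F x) \<le> cmod (F 0) + V" for x
    using norm_triangle_sub[of "F x" "F 0"] var_le_dist[OF V, of 0 x] by simp
  have V0: "0 \<le> V" using v(2)[of 0] by linarith
  define h where "h c x = (if c = 1 then Re (F x) + v x else if c = \<i> then Im (F x) + v x else v x)" for c x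
  have "\<exists>H. mono H \<and> (\<forall>x. \<bar>H x\<bar> \<le> B) \<and> (\<forall>a. continuous (at_right a) H) \<and> (\<forall>x. (h c \<longlongrightarrow> H x) (at_right x))" for c
  proof -
    have "mono (h c)"
    proof (rule monoI)
      fix x y :: real assume "x \<le> y"
      with v(3)[OF this] abs_Re_le_cmod[of "F y - F x"] abs_Im_le_cmod[of "F y - F x"] v(1)
      show "h c x \<le> h c y" by (auto simp: h_def mono_def)
    qed
    moreover have "\<bar>h c x\<bar> \<le> B" for x
      using F_bd[of x] v(2)[of x] abs_Re_le_cmod[of "F x"] abs_Im_le_cmod[of "F x"] V0 norm_ge_zero[of "F 0"]
      unfolding h_def B_def by auto
    ultimately show ?thesis using right_regularization[of "h c" B] by metis
  qed
  then obtain H where H: "\<And>c. mono (H c)" "\<And>c x. \<bar>H c x\<bar> \<le> B" "\<And>c a. continuous (at_right a) (H c)"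
    "\<And>c x. (h c \<longlongrightarrow> H c x) (at_right x)"
    by metis
  define \<nu> where "\<nu> A = (\<Sum>c\<in>phases. c * measure (interval_measure (H c)) A)" for A
  have "complex_measure \<nu>"
    by (rule complex_measure_sum[where J = phases and M = "\<lambda>c. interval_measure (H c)" and c = "\<lambda>c. c"])
      (auto simp: \<nu>_def intro!: finite_measure_interval_measure H)
  moreover have "\<nu> {a<..b} = F b - F a" if "a \<le> b" for a b
  proof -
    have F_eq: "F x = (\<Sum>c\<in>phases. c * H c x)" for x
    proof (rule tendsto_unique[of "at_right x" F])
      have F_h: "F y = (\<Sum>c\<in>phases. c * h c y)" for y
        by (simp add: sum_phases h_def complex_eq_iff)
      show "(F \<longlongrightarrow> F x) (at_right x)" using cont by (simp add: continuous_within)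
      have "((\<lambda>y. \<Sum>c\<in>phases. c * complex_of_real (h c y)) \<longlongrightarrow> (\<Sum>c\<in>phases. c * complex_of_real (H c x))) (at_right x)"
        by (intro tendsto_intros H)
      then show "(F \<longlongrightarrow> (\<Sum>c\<in>phases. c * H c x)) (at_right x)"
        by (subst F_h[abs_def]) simp
    qed simp
    have "measure (interval_measure (H c)) {a<..b} = H c b - H c a" for c
      by (rule measure_interval_measure_Ioc) (use that H in \<open>auto simp: mono_def\<close>)
    then have "\<nu> {a<..b} = (\<Sum>c\<in>phases. c * H c b - c * H c a)"
      by (simp add: \<nu>_def right_diff_distrib)
    then show ?thesis by (simp add: F_eq[of a] F_eq[of b] sum_subtractf)
  qed
  ultimately show ?thesis by blast
qed

lemma
  assumes "\<exists>\<nu>. complex_measure \<nu> \<and> (\<forall>a b. a \<le> b \<longrightarrow> \<nu> {a<..b} = F b - F a)"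
  shows complex_measure_stieltjes: "complex_measure (stieltjes F)"
    and stieltjes_Ioc: "a \<le> b \<Longrightarrow> stieltjes F {a<..b} = F b - F a"
  using someI_ex[OF assms] unfolding stieltjes_def by auto

lemma stieltjes_unique:
  assumes \<nu>: "complex_measure \<nu>" "\<And>a b. a \<le> b \<Longrightarrow> \<nu> {a<..b} = F b - F a" and A: "A \<in> sets borel"
  shows "stieltjes F A = \<nu> A"
proof (rule complex_measure_eqI[OF _ \<nu>(1) _ A])
  have ex: "\<exists>\<nu>. complex_measure \<nu> \<and> (\<forall>a b. a \<le> b \<longrightarrow> \<nu> {a<..b} = F b - F a)"
    using \<nu> by blast
  show "complex_measure (stieltjes F)" by (rule complex_measure_stieltjes[OF ex])
  show "stieltjes F {a<..b} = \<nu> {a<..b}" if "a \<le> b" for a b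
    using stieltjes_Ioc[OF ex that] \<nu>(2)[OF that] by simp
qed

lemma stieltjes_Ioi:
  assumes ex: "\<exists>\<nu>. complex_measure \<nu> \<and> (\<forall>a b. a \<le> b \<longrightarrow> \<nu> {a<..b} = F b - F a)"
    and lim: "(F \<longlongrightarrow> L) at_top"
  shows "stieltjes F {a<..} = L - F a"
proof (rule LIMSEQ_unique)
  have "(\<lambda>n. stieltjes F {a<..a + real n}) \<longlonglongrightarrow> stieltjes F (\<Union>n. {a<..a + real n})"
    by (rule tendsto_complex_measure_incseq[OF complex_measure_stieltjes[OF ex]]) (auto simp: incseq_def)
  also have "(\<Union>n. {a<..a + real n}) = {a<..}"
  proof safe
    fix x assume "a < x"
    obtain n where "x - a \<le> real n" using real_arch_simple by blast
    with \<open>a < x\<close> show "x \<in> (\<Union>n. {a<..a + real n})" by (intro UN_I[of n]) auto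
  qed auto
  finally show "(\<lambda>n. stieltjes F {a<..a + real n}) \<longlonglongrightarrow> stieltjes F {a<..}" .
  have "filterlim (\<lambda>n. a + real n) at_top sequentially"
    by (rule filterlim_tendsto_add_at_top[OF tendsto_const filterlim_real_sequentially])
  then have "(\<lambda>n. F (a + real n)) \<longlonglongrightarrow> L" by (rule filterlim_compose[OF lim])
  then show "(\<lambda>n. stieltjes F {a<..a + real n}) \<longlonglongrightarrow> L - F a"
    by (simp add: stieltjes_Ioc[OF ex] tendsto_diff)
qed

section \<open>Oscillatory integrals\<close>

lemma has_vector_derivative_iexp_mult:
  assumes v: "v \<noteq> 0"
  shows "((\<lambda>s. iexp (v * s) / (\<i> * v)) has_vector_derivative iexp (v * s)) (at s)"
proof -
  have "((\<lambda>z. exp (\<i> * (v * z)) / (\<i> * v)) has_field_derivative exp (\<i> * (v * complex_of_real s))) (at (of_real s))"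
    using v by (auto intro!: derivative_eq_intros simp: algebra_simps)
  from has_vector_derivative_real_field[OF this, of UNIV] show ?thesis by simp
qed

text \<open>On a fine partition the factor of bounded variation is nearly constant between the partition
  points; the primitive of the oscillating factor is bounded by the reciprocal of the frequency, and
  summation by parts moves the differences onto the factor of bounded variation.\<close>

lemma oscillatory_integral_bound_HK:
  fixes b :: "real \<Rightarrow> complex"
  assumes ac: "a \<le> c" and cont: "continuous_on {a..c} b" and V: "var_le b {a..c} V"
    and S: "\<And>t. t \<in> {a..c} \<Longrightarrow> cmod (b t) \<le> S" and v: "v \<noteq> 0"
  shows "cmod (integral {a..c} (\<lambda>t. iexp (v * t) * b t)) \<le> (2 * S + V) / \<bar>v\<bar>"
proof (rule field_le_epsilon)
  fix e' :: real assume e': "0 < e'"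
  define f where "f t = iexp (v * t) * b t" for t
  define e where "e = e' / (c - a + 1)"
  have e: "0 < e" "e * (c - a) \<le> e'" using e' ac by (auto simp: e_def field_simps)
  have "uniformly_continuous_on {a..c} b"
    by (rule compact_uniformly_continuous[OF cont]) simp
  then obtain d where d: "0 < d" "\<And>s t. s \<in> {a..c} \<Longrightarrow> t \<in> {a..c} \<Longrightarrow> dist s t < d \<Longrightarrow> dist (b s) (b t) < e"
    unfolding uniformly_continuous_on_def using e by metis
  \<comment> \<open>The number of partition intervals, chosen such that their length is below the modulus \<open>d\<close> of uniform continuity.\<close>
  obtain n :: nat where n: "(c - a) / d < real n" using reals_Archimedean2 by blast
  with d(1) ac have n0: "0 < real n" by (intro le_less_trans[OF _ n]) simp
  define t where "t i = a + real i * ((c - a) / real n)" for i :: nat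
  have t0: "t 0 = a" and tn: "t n = c" using n0 by (auto simp: t_def)
  have tmono: "t i \<le> t j" if "i \<le> j" for i j
    unfolding t_def using that ac n0 by (intro add_left_mono mult_right_mono) auto
  have tin: "t i \<in> {a..c}" if "i \<le> n" for i
    using tmono[of 0 i] tmono[OF that] t0 tn by auto
  have tdiff: "t (Suc i) - t i < d" for i
  proof -
    have "t (Suc i) - t i = (c - a) / real n" by (simp only: t_def of_nat_Suc distrib_right)
    also have "\<dots> < d" using n n0 d(1) by (simp add: pos_divide_less_eq mult.commute)
    finally show ?thesis .
  qed
  define E where "E s = iexp (v * s) / (\<i> * v)" for s
  have E: "cmod (E s) = 1 / \<bar>v\<bar>" for s by (simp add: E_def norm_divide norm_mult)
  have cf: "continuous_on {a..c} f"
    unfolding f_def by (intro continuous_intros cont)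
  have comb: "integral {a..t k} f = (\<Sum>i<k. integral {t i..t (Suc i)} f)" if "k \<le> n" for k
    using that
  proof (induction k)
    case (Suc k)
    have "integral {a..t k} f + integral {t k..t (Suc k)} f = integral {a..t (Suc k)} f"
      using tmono[of 0 k] tmono[of k "Suc k"] tin[of "Suc k"] Suc.prems
      by (intro Henstock_Kurzweil_Integration.integral_combine integrable_continuous_real
          continuous_on_subset[OF cf]) (auto simp: t0)
    then show ?case using Suc by simp
  qed (simp add: t0)
  have Eint: "((\<lambda>s. iexp (v * s)) has_integral (E (t (Suc i)) - E (t i))) {t i..t (Suc i)}" for i
  proof (rule fundamental_theorem_of_calculus)
    show "t i \<le> t (Suc i)" by (rule tmono) simp
    fix s
    show "(E has_vector_derivative iexp (v * s)) (at s within {t i..t (Suc i)})"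
      using has_vector_derivative_iexp_mult[OF v, of s] unfolding E_def
      by (rule has_vector_derivative_at_within)
  qed
  have piece: "cmod (integral {t i..t (Suc i)} f - b (t i) * (E (t (Suc i)) - E (t i))) \<le> e * (t (Suc i) - t i)"
    if i: "i < n" for i
  proof -
    have sub: "{t i..t (Suc i)} \<subseteq> {a..c}" using tin[of i] tin[of "Suc i"] i by auto
    have "((\<lambda>s. f s - b (t i) * iexp (v * s)) has_integral
       (integral {t i..t (Suc i)} f - b (t i) * (E (t (Suc i)) - E (t i)))) {t i..t (Suc i)}"
      by (intro has_integral_diff has_integral_mult_right Eint integrable_integral
          integrable_continuous_real continuous_on_subset[OF cf sub])
    then have "integral {t i..t (Suc i)} f - b (t i) * (E (t (Suc i)) - E (t i))
        = integral {t i..t (Suc i)} (\<lambda>s. f s - b (t i) * iexp (v * s))"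
      by (simp add: integral_unique)
    also have "cmod \<dots> \<le> e * (t (Suc i) - t i)"
    proof (rule integral_bound)
      show "t i \<le> t (Suc i)" by (rule tmono) simp
      show "continuous_on {t i..t (Suc i)} (\<lambda>s. f s - b (t i) * iexp (v * s))"
        by (intro continuous_intros continuous_on_subset[OF cf sub])
      fix s assume s: "s \<in> {t i..t (Suc i)}"
      have "f s - b (t i) * iexp (v * s) = iexp (v * s) * (b s - b (t i))"
        by (simp add: f_def algebra_simps)
      then have "cmod (f s - b (t i) * iexp (v * s)) = dist (b s) (b (t i))"
        by (simp add: norm_mult dist_norm)
      also have "\<dots> \<le> e"
        using d(2)[of s "t i"] s sub tin[of i] i tdiff[of i] by (auto simp: dist_real_def)
      finally show "cmod (f s - b (t i) * iexp (v * s)) \<le> e" .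
    qed
    finally show ?thesis .
  qed
  \<comment> \<open>Summation by parts.\<close>
  have abel: "(\<Sum>i<k. b (t i) * (E (t (Suc i)) - E (t i)))
     = b (t k) * E (t k) - b (t 0) * E (t 0) - (\<Sum>i<k. (b (t (Suc i)) - b (t i)) * E (t (Suc i)))" for k
    by (induction k) (auto simp: algebra_simps)
  have "cmod (\<Sum>i<n. b (t i) * (E (t (Suc i)) - E (t i)))
     \<le> cmod (b (t n) * E (t n)) + cmod (b (t 0) * E (t 0)) + (\<Sum>i<n. cmod ((b (t (Suc i)) - b (t i)) * E (t (Suc i))))"
    unfolding abel by (rule order_trans[OF norm_triangle_ineq4] add_mono norm_triangle_ineq4 norm_sum)+
  also have "\<dots> = cmod (b (t n)) / \<bar>v\<bar> + cmod (b (t 0)) / \<bar>v\<bar> + (\<Sum>i<n. cmod (b (t (Suc i)) - b (t i))) / \<bar>v\<bar>"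
    by (simp add: norm_mult E sum_divide_distrib)
  also have "\<dots> \<le> S / \<bar>v\<bar> + S / \<bar>v\<bar> + V / \<bar>v\<bar>"
    using tin tmono by (intro add_mono divide_right_mono S var_leD[OF V]) auto
  finally have main: "cmod (\<Sum>i<n. b (t i) * (E (t (Suc i)) - E (t i))) \<le> (2 * S + V) / \<bar>v\<bar>"
    by (simp add: add_divide_distrib)
  have "integral {a..c} f - (\<Sum>i<n. b (t i) * (E (t (Suc i)) - E (t i)))
     = (\<Sum>i<n. integral {t i..t (Suc i)} f - b (t i) * (E (t (Suc i)) - E (t i)))"
    using comb[of n] by (simp add: tn sum_subtractf)
  also have "cmod \<dots> \<le> (\<Sum>i<n. e * (t (Suc i) - t i))"
    by (intro sum_norm_le piece) auto
  also have "\<dots> = e * (c - a)"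
    using sum_lessThan_telescope[of t n] by (simp add: t0 tn flip: sum_distrib_left)
  finally have "cmod (integral {a..c} f - (\<Sum>i<n. b (t i) * (E (t (Suc i)) - E (t i)))) \<le> e'" using e by simp
  then show "cmod (integral {a..c} (\<lambda>t. iexp (v * t) * b t)) \<le> (2 * S + V) / \<bar>v\<bar> + e'"
    using main norm_triangle_sub[of "integral {a..c} f" "\<Sum>i<n. b (t i) * (E (t (Suc i)) - E (t i))"]
    unfolding f_def by linarith
qed

lemma set_integrable_continuous:
  fixes f :: "real \<Rightarrow> complex"
  shows "continuous_on {a..c} f \<Longrightarrow> set_integrable lborel {a..c} f"
  using borel_integrable_compact[of "{a..c}" f] unfolding set_integrable_def by (auto simp: mult.commute)

lemma oscillatory_integral_bound:
  fixes b :: "real \<Rightarrow> complex"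
  assumes "a \<le> c" "continuous_on {a..c} b" "var_le b {a..c} V"
    "\<And>t. t \<in> {a..c} \<Longrightarrow> cmod (b t) \<le> S" "v \<noteq> 0"
  shows "cmod (CLINT t:{a..c}|lborel. iexp (v * t) * b t) \<le> (2 * S + V) / \<bar>v\<bar>"
  using oscillatory_integral_bound_HK[OF assms]
  by (subst set_borel_integral_eq_integral(2)[OF set_integrable_continuous])
    (auto intro!: continuous_intros assms)

section \<open>Interchange of integrals\<close>

lemma
  fixes f :: "real \<Rightarrow> real \<Rightarrow> 'b::{banach, second_countable_topology}"
  assumes A: "sigma_finite_measure A" "sets A = sets borel" and u: "integrable A u" and w: "integrable lborel w"
    and f[measurable]: "(\<lambda>(x, t). f x t) \<in> borel_measurable (borel \<Otimes>\<^sub>M borel)"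
    and le: "\<And>x t. norm (f x t) \<le> u x * w t"
  shows integrable_fubini_dominated1: "integrable A (\<lambda>x. LINT t|lborel. f x t)"
    and integrable_fubini_dominated2: "integrable lborel (\<lambda>t. LINT x|A. f x t)"
    and fubini_dominated: "(LINT x|A. LINT t|lborel. f x t) = (LINT t|lborel. LINT x|A. f x t)"
proof -
  interpret A: sigma_finite_measure A by (rule A)
  interpret P: pair_sigma_finite A lborel ..
  have [measurable_cong]: "sets A = sets borel" by (rule A)
  have [measurable]: "f x \<in> borel_measurable borel" for x
  proof -
    have "(\<lambda>t. (\<lambda>(x, t). f x t) (x, t)) \<in> borel_measurable borel" by measurable
    then show ?thesis by simp
  qed
  have intt: "integrable lborel (f x)" for x
    by (rule Bochner_Integration.integrable_bound[OF integrable_mult_right[OF w, of "u x"]])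
      (auto intro!: AE_I2 order_trans[OF le])
  have *: "integrable (A \<Otimes>\<^sub>M lborel) (\<lambda>(x, t). f x t)"
  proof (rule P.Fubini_integrable)
    show "(\<lambda>(x, t). f x t) \<in> borel_measurable (A \<Otimes>\<^sub>M lborel)" by measurable
    show "integrable A (\<lambda>x. LINT t|lborel. norm (case (x, t) of (x, t) \<Rightarrow> f x t))"
    proof (rule Bochner_Integration.integrable_bound[OF integrable_mult_left[OF u]])
      have "(LINT t|lborel. norm (f x t)) \<le> (LINT t|lborel. u x * w t)" for x
        by (intro integral_mono integrable_norm intt integrable_mult_right w le)
      then have "norm (LINT t|lborel. norm (f x t)) \<le> norm (u x * (LINT t|lborel. w t))" for x
        by (auto simp: integral_nonneg_AE intro: order_trans[OF _ abs_ge_self])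
      then show "AE x in A. norm (LINT t|lborel. norm (case (x, t) of (x, t) \<Rightarrow> f x t)) \<le> norm (u x * (LINT t|lborel. w t))"
        by simp
    qed measurable
    show "AE x in A. integrable lborel (\<lambda>t. case (x, t) of (x, t) \<Rightarrow> f x t)" using intt by simp
  qed
  show "integrable A (\<lambda>x. LINT t|lborel. f x t)" by (rule P.integrable_fst[OF *])
  show "integrable lborel (\<lambda>t. LINT x|A. f x t)" by (rule P.integrable_snd[OF *])
  show "(LINT x|A. LINT t|lborel. f x t) = (LINT t|lborel. LINT x|A. f x t)"
    by (rule P.Fubini_integral[OF *, symmetric])
qed

section \<open>Truncated Fourier inversion\<close>

text \<open>For the characteristic function of a real measure, this is the inversion integral over
  \<open>[-T, T]\<close>, folded onto the positive half-line by Hermitian symmetry.\<close>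

definition inv_trunc :: "(real \<Rightarrow> complex) \<Rightarrow> real \<Rightarrow> real \<Rightarrow> real" where
  "inv_trunc \<Phi> T y = Re (CLINT t:{0..T}|lborel. iexp (- (t * y)) * \<Phi> t) / pi"

lemma char_uminus: "char M (- t) = cnj (char M t)"
proof -
  have eq: "iexp (- t * x) = cnj (iexp (t * x))" for x :: real
    unfolding exp_cnj by simp
  have "char M (- t) = (CLINT x|M. cnj (iexp (t * x)))"
    unfolding char_def by (simp only: eq)
  then show ?thesis
    unfolding char_def by (simp only: Bochner_Integration.integral_cnj)
qed

text \<open>Reflection maps the integral over the negative half-line to the conjugate of the one over
  the positive half-line.\<close>

lemma integral_hermitian:
  fixes h :: "real \<Rightarrow> complex"
  assumes h: "integrable lborel h" and herm: "\<And>t. h (- t) = cnj (h t)"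
  shows "(CLINT t|lborel. h t) = complex_of_real (2 * Re (CLINT t|lborel. indicator {0..} t * h t))"
proof -
  have hm[measurable]: "h \<in> borel_measurable borel" using h by auto
  have i1: "integrable lborel (\<lambda>t. indicator {0..} t * h t)"
    and i2: "integrable lborel (\<lambda>t. indicator {..<0} t * h t)"
    by (rule Bochner_Integration.integrable_bound[OF h]; auto split: split_indicator)+
  have "(CLINT t|lborel. indicator {..<0} t * h t) = (CLINT t|lborel. indicator {..<0} (- t) * h (- t))"
    using lborel_integral_real_affine[of "-1" "\<lambda>t. indicator {..<0} t * h t" 0] by simp
  also have "\<dots> = (CLINT t|lborel. cnj (indicator {0..} t * h t))"
  proof (rule integral_cong_AE)
    show "AE t in lborel. indicator {..<0} (- t) * h (- t) = cnj (indicator {0..} t * h t)"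
      using AE_lborel_singleton[of 0] by eventually_elim (auto simp: herm split: split_indicator)
    show "(\<lambda>t. cnj (indicator {0..} t * h t)) \<in> borel_measurable lborel"
      by (rule borel_measurable_integrable) (use i1 in \<open>simp only: integrable_cnj\<close>)
  qed auto
  also have "\<dots> = cnj (CLINT t|lborel. indicator {0..} t * h t)" by (rule Bochner_Integration.integral_cnj)
  finally have neg: "(CLINT t|lborel. indicator {..<0} t * h t) = cnj (CLINT t|lborel. indicator {0..} t * h t)" .
  have "(CLINT t|lborel. h t) = (CLINT t|lborel. indicator {0..} t * h t + indicator {..<0} t * h t)"
    by (rule Bochner_Integration.integral_cong) (auto split: split_indicator)
  also have "\<dots> = (CLINT t|lborel. indicator {0..} t * h t) + (CLINT t|lborel. indicator {..<0} t * h t)"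
    by (rule Bochner_Integration.integral_add[OF i1 i2])
  finally show ?thesis unfolding neg complex_add_cnj .
qed

lemma integrable_indicator_Icc [simp]: "integrable lborel (indicator {a..b::real} :: real \<Rightarrow> real)"
  by (rule integrable_real_indicator) (simp_all add: emeasure_lborel_Icc_eq)

lemma integrable_indicator_bounded:
  fixes f :: "real \<Rightarrow> complex"
  assumes [measurable]: "f \<in> borel_measurable borel" and le: "\<And>t. t \<in> {a..b} \<Longrightarrow> cmod (f t) \<le> C"
  shows "integrable lborel (\<lambda>t. indicator {a..b} t *\<^sub>R f t)"
proof (rule Bochner_Integration.integrable_bound)
  show "integrable lborel (\<lambda>t. C * indicator {a..b} t :: real)" by simp
  show "AE t in lborel. cmod (indicator {a..b} t *\<^sub>R f t) \<le> norm (C * indicator {a..b} t :: real)"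
    using order_trans[OF le abs_ge_self] by (auto intro!: AE_I2 split: split_indicator)
qed simp

lemma continuous_on_inv_trunc:
  assumes [measurable]: "\<Phi> \<in> borel_measurable borel" and le: "\<And>t. t \<in> {0..T} \<Longrightarrow> cmod (\<Phi> t) \<le> C"
  shows "continuous_on UNIV (inv_trunc \<Phi> T)"
proof (rule continuous_at_imp_continuous_on, rule ballI, rule continuous_at_sequentiallyI)
  fix y :: real and u assume u: "u \<longlonglongrightarrow> y"
  have "(\<lambda>n. CLINT t|lborel. indicator {0..T} t *\<^sub>R (iexp (- (t * u n)) * \<Phi> t))
     \<longlonglongrightarrow> (CLINT t|lborel. indicator {0..T} t *\<^sub>R (iexp (- (t * y)) * \<Phi> t))"
  proof (rule integral_dominated_convergence[where w = "\<lambda>t. C * indicator {0..T} t"])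
    show "AE t in lborel. (\<lambda>n. indicator {0..T} t *\<^sub>R (iexp (- (t * u n)) * \<Phi> t)) \<longlonglongrightarrow> indicator {0..T} t *\<^sub>R (iexp (- (t * y)) * \<Phi> t)"
      by (intro AE_I2 tendsto_intros u)
    show "AE t in lborel. cmod (indicator {0..T} t *\<^sub>R (iexp (- (t * u n)) * \<Phi> t)) \<le> C * indicator {0..T} t" for n
      using le by (auto intro!: AE_I2 simp: norm_mult split: split_indicator)
  qed auto
  then show "(\<lambda>n. inv_trunc \<Phi> T (u n)) \<longlonglongrightarrow> inv_trunc \<Phi> T y"
    unfolding inv_trunc_def set_lebesgue_integral_def by (intro tendsto_intros) auto
qed

lemma inv_trunc_sum:
  assumes [measurable]: "\<And>j. j \<in> J \<Longrightarrow> \<Phi> j \<in> borel_measurable borel"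
    and le: "\<And>j t. j \<in> J \<Longrightarrow> cmod (\<Phi> j t) \<le> 1"
  shows "inv_trunc (\<lambda>t. \<Sum>j\<in>J. complex_of_real (c j) * \<Phi> j t) T y = (\<Sum>j\<in>J. c j * inv_trunc (\<Phi> j) T y)"
proof -
  have "(CLINT t:{0..T}|lborel. iexp (- (t * y)) * (\<Sum>j\<in>J. complex_of_real (c j) * \<Phi> j t))
     = (CLINT t|lborel. \<Sum>j\<in>J. complex_of_real (c j) * (indicator {0..T} t *\<^sub>R (iexp (- (t * y)) * \<Phi> j t)))"
    unfolding set_lebesgue_integral_def
    by (rule Bochner_Integration.integral_cong) (auto simp: sum_distrib_left scaleR_sum_right mult_ac)
  also have "\<dots> = (\<Sum>j\<in>J. (CLINT t|lborel. complex_of_real (c j) * (indicator {0..T} t *\<^sub>R (iexp (- (t * y)) * \<Phi> j t))))"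
    by (rule Bochner_Integration.integral_sum, rule integrable_mult_right, rule integrable_indicator_bounded[where C = 1])
      (auto simp: norm_mult le)
  also have "\<dots> = (\<Sum>j\<in>J. complex_of_real (c j) * (CLINT t:{0..T}|lborel. iexp (- (t * y)) * \<Phi> j t))"
    unfolding set_lebesgue_integral_def by (simp only: integral_mult_right_zero)
  finally show ?thesis
    unfolding inv_trunc_def by (simp add: sum_divide_distrib)
qed

lemma iexp_integral:
  assumes "a \<le> b" "t \<noteq> 0"
  shows "(CLINT y:{a..b}|lborel. iexp (- (t * y))) = (iexp (- (t * a)) - iexp (- (t * b))) / (\<i> * t)"
proof -
  define v where "v = - t"
  have v: "v \<noteq> 0" "t = - v" "\<And>y. - (t * y) = v * y" using assms by (auto simp: v_def)
  have "((\<lambda>y. iexp (v * y)) has_integral (iexp (v * b) / (\<i> * v) - iexp (v * a) / (\<i> * v))) {a..b}"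
    by (rule fundamental_theorem_of_calculus[OF assms(1)])
      (rule has_vector_derivative_at_within[OF has_vector_derivative_iexp_mult[OF v(1)]])
  then have "integral {a..b} (\<lambda>y. iexp (v * y)) = iexp (v * b) / (\<i> * v) - iexp (v * a) / (\<i> * v)"
    by (rule integral_unique)
  moreover have "set_integrable lborel {a..b} (\<lambda>y. iexp (v * y))"
    by (rule set_integrable_continuous) (intro continuous_intros)
  ultimately have "(CLINT y:{a..b}|lborel. iexp (v * y)) = iexp (v * b) / (\<i> * v) - iexp (v * a) / (\<i> * v)"
    using set_borel_integral_eq_integral(2) by metis
  also have "\<dots> = (iexp (v * a) - iexp (v * b)) / (\<i> * t)"
    using v by (simp add: field_simps)
  finally show ?thesis unfolding v(3) .
qed

context real_distribution
begin

lemma inv_trunc_eq: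
  assumes "0 \<le> T"
  shows "(CLINT t:{-T..T}|lborel. iexp (- (t * y)) * char M t) = complex_of_real (2 * pi * inv_trunc (char M) T y)"
proof -
  have "integrable lborel (\<lambda>t. indicator {-T..T} t *\<^sub>R (iexp (- (t * y)) * char M t))"
    by (rule integrable_indicator_bounded[where C = 1]) (auto simp: norm_mult cmod_char_le_1)
  then have "(CLINT t:{-T..T}|lborel. iexp (- (t * y)) * char M t)
    = complex_of_real (2 * Re (CLINT t|lborel. indicator {0..} t * (indicator {-T..T} t *\<^sub>R (iexp (- (t * y)) * char M t))))"
    unfolding set_lebesgue_integral_def
    by (rule integral_hermitian) (auto simp: char_uminus exp_cnj split: split_indicator)
  also have "(CLINT t|lborel. indicator {0..} t * (indicator {-T..T} t *\<^sub>R (iexp (- (t * y)) * char M t)))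
    = (CLINT t:{0..T}|lborel. iexp (- (t * y)) * char M t)"
    unfolding set_lebesgue_integral_def
    by (rule Bochner_Integration.integral_cong) (auto split: split_indicator)
  finally show ?thesis by (simp add: inv_trunc_def)
qed

text \<open>The kernel in the inversion formula of Levy is itself an integral over \<open>[a, b]\<close>, so the order of
  integration can be exchanged.\<close>

lemma Levy_inversion_inv_trunc:
  assumes ab: "a \<le> b" and at: "measure M {a} = 0" "measure M {b} = 0"
  shows "(\<lambda>n. LINT y:{a..b}|lborel. inv_trunc (char M) (real n) y) \<longlonglongrightarrow> measure M {a<..b}"
proof -
  have eq: "1 / (2 * pi) * (CLBINT t=-real n..real n. (iexp (-(t * a)) - iexp (-(t * b))) / (\<i> * t) * char M t)
     = complex_of_real (LINT y:{a..b}|lborel. inv_trunc (char M) (real n) y)" for n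
  proof -
    let ?T = "real n"
    define f where "f y t = indicator {a..b} y *\<^sub>R indicator {-?T..?T} t *\<^sub>R (iexp (- (t * y)) * char M t)" for y t :: real
    have fm: "(\<lambda>(y, t). f y t) \<in> borel_measurable (borel \<Otimes>\<^sub>M borel)" unfolding f_def by measurable
    have fle: "norm (f y t) \<le> indicator {a..b} y * indicator {-?T..?T} t" for y t
      using cmod_char_le_1 by (auto simp: f_def norm_mult split: split_indicator)
    note fub = fubini_dominated[OF lborel.sigma_finite_measure_axioms sets_lborel _ _ fm fle]
    have "(CLBINT t=-?T..?T. (iexp (-(t * a)) - iexp (-(t * b))) / (\<i> * t) * char M t)
       = (CLINT t:{-?T..?T}|lborel. (iexp (-(t * a)) - iexp (-(t * b))) / (\<i> * t) * char M t)"
      by (subst interval_integral_Icc) auto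
    also have "\<dots> = (CLINT t|lborel. CLINT y|lborel. f y t)"
      unfolding set_lebesgue_integral_def
    proof (rule integral_cong_AE)
      show "AE t in lborel. indicator {-?T..?T} t *\<^sub>R ((iexp (-(t * a)) - iexp (-(t * b))) / (\<i> * t) * char M t)
         = (CLINT y|lborel. f y t)"
        using AE_lborel_singleton[of 0]
      proof eventually_elim
        case (elim t)
        have "(CLINT y|lborel. f y t) = (CLINT y|lborel. (indicator {-?T..?T} t *\<^sub>R char M t) * (indicator {a..b} y *\<^sub>R iexp (- (t * y))))"
          by (rule Bochner_Integration.integral_cong) (auto simp: f_def split: split_indicator)
        also have "\<dots> = (indicator {-?T..?T} t *\<^sub>R char M t) * (CLINT y:{a..b}|lborel. iexp (- (t * y)))"
          unfolding set_lebesgue_integral_def by (rule integral_mult_right_zero)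
        finally show ?case unfolding iexp_integral[OF ab elim] by (simp only: mult_scaleR_left mult.commute)
      qed
      show "(\<lambda>t. CLINT y|lborel. f y t) \<in> borel_measurable lborel"
        by (rule borel_measurable_integrable,
            rule integrable_fubini_dominated2[OF lborel.sigma_finite_measure_axioms sets_lborel _ _ fm fle]) auto
    qed auto
    also have "\<dots> = (CLINT y|lborel. CLINT t|lborel. f y t)"
      by (rule fub[symmetric]) auto
    also have "\<dots> = (CLINT y|lborel. complex_of_real (2 * pi * (indicator {a..b} y *\<^sub>R inv_trunc (char M) ?T y)))"
    proof (rule Bochner_Integration.integral_cong[OF refl])
      fix y
      have "(CLINT t|lborel. f y t) = (CLINT t|lborel. indicator {a..b} y * (indicator {-?T..?T} t *\<^sub>R (iexp (- (t * y)) * char M t)))"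
        by (rule Bochner_Integration.integral_cong) (auto simp: f_def split: split_indicator)
      also have "\<dots> = indicator {a..b} y * (CLINT t:{-?T..?T}|lborel. iexp (- (t * y)) * char M t)"
        unfolding set_lebesgue_integral_def by (rule integral_mult_right_zero)
      finally show "(CLINT t|lborel. f y t) = complex_of_real (2 * pi * (indicator {a..b} y *\<^sub>R inv_trunc (char M) ?T y))"
        by (subst (asm) inv_trunc_eq) (auto split: split_indicator)
    qed
    also have "\<dots> = complex_of_real (2 * pi * (LINT y:{a..b}|lborel. inv_trunc (char M) ?T y))"
      unfolding set_lebesgue_integral_def by (simp only: integral_complex_of_real integral_mult_right_zero)
    finally show ?thesis by simp
  qed
  have "(\<lambda>n. complex_of_real (LINT y:{a..b}|lborel. inv_trunc (char M) (real n) y)) \<longlonglongrightarrow> complex_of_real (measure M {a<..b})"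
    by (rule Lim_transform_eventually[OF Levy_Inversion[OF ab at] always_eventually])
      (intro allI, simp only: eq[symmetric] of_int_minus of_int_of_nat_eq of_real_divide of_real_mult of_real_1 of_real_numeral)
  then show ?thesis by (simp only: tendsto_of_real_iff)
qed

end

section \<open>Bounded densities from bounded truncated inversions\<close>

text \<open>The difference of the distribution functions is monotone and right-continuous, hence it
  generates a measure, and by uniqueness this measure is the difference of the two given ones.\<close>

lemma measure_le_if_Ioc_le:
  fixes M N :: "real measure"
  assumes M: "finite_measure M" "sets M = sets borel" and N: "finite_measure N" "sets N = sets borel"
    and le: "\<And>a b. a \<le> b \<Longrightarrow> measure M {a<..b} \<le> measure N {a<..b}" and A: "A \<in> sets borel"
  shows "measure M A \<le> measure N A"
proof -
  interpret M: finite_borel_measure M using M by (simp add: finite_borel_measure_def finite_borel_measure_axioms_def)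
  interpret N: finite_borel_measure N using N by (simp add: finite_borel_measure_def finite_borel_measure_axioms_def)
  define H where "H x = cdf N x - cdf M x" for x
  have H_diff: "H b - H a = measure N {a<..b} - measure M {a<..b}" if "a \<le> b" for a b
    using that N.cdf_diff_eq[of a b] M.cdf_diff_eq[of a b] by (cases "a = b") (auto simp: H_def)
  have mono: "mono H" using H_diff le by (force simp: mono_def)
  have cont: "continuous (at_right a) H" for a
    unfolding H_def by (intro continuous_diff N.cdf_is_right_cont M.cdf_is_right_cont)
  have bd: "\<bar>H x\<bar> \<le> measure N UNIV + measure M UNIV" for x
    using N.cdf_nonneg[of x] N.cdf_bounded[of x] M.cdf_nonneg[of x] M.cdf_bounded[of x]
    by (simp add: H_def M.borel_UNIV N.borel_UNIV)
  define \<nu> where "\<nu> A = complex_of_real (measure N A - measure M A)" for A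
  define \<rho> where "\<rho> A = complex_of_real (measure (interval_measure H) A)" for A
  have "\<nu> A = \<rho> A"
  proof (rule complex_measure_eqI[OF _ _ _ A])
    show "complex_measure \<nu>"
      by (rule complex_measure_sum[where J = UNIV and M = "\<lambda>i. if i then N else M" and c = "\<lambda>i. if i then 1 else -1"])
        (auto simp: \<nu>_def UNIV_bool assms)
    show "complex_measure \<rho>"
      by (rule complex_measure_sum[where J = "{()}" and M = "\<lambda>i. interval_measure H" and c = "\<lambda>i. 1"])
        (auto simp: \<rho>_def intro!: finite_measure_interval_measure mono cont bd)
    fix a b :: real assume "a \<le> b"
    moreover have "measure (interval_measure H) {a<..b} = H b - H a"
      by (rule measure_interval_measure_Ioc) (use mono cont \<open>a \<le> b\<close> in \<open>auto simp: mono_def\<close>)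
    ultimately show "\<nu> {a<..b} = \<rho> {a<..b}" by (simp add: \<nu>_def \<rho>_def H_diff)
  qed
  then have "complex_of_real (measure N A - measure M A) = complex_of_real (measure (interval_measure H) A)"
    by (simp only: \<nu>_def \<rho>_def)
  then have "measure N A - measure M A = measure (interval_measure H) A" by (simp only: of_real_eq_iff)
  then show ?thesis using measure_nonneg[of "interval_measure H" A] by linarith
qed

context real_distribution
begin

lemma no_atom_between:
  assumes "c < (d::real)"
  obtains x where "c < x" "x < d" "measure M {x} = 0"
proof -
  have "countable {x. measure M {x} > 0}" by (rule countable_atoms)
  moreover have "uncountable {c<..<d}" using assms by (simp add: uncountable_open_interval)
  ultimately obtain x where "x \<in> {c<..<d}" "\<not> measure M {x} > 0"
    by (metis (mono_tags, lifting) countable_subset mem_Collect_eq subsetI)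
  then show ?thesis using that[of x] measure_nonneg[of M "{x}"] by auto
qed

context
  fixes c d C :: real
  assumes bound: "\<And>n y. c \<le> y \<Longrightarrow> y \<le> d \<Longrightarrow> \<bar>inv_trunc (char M) (real n) y\<bar> \<le> C"
begin

text \<open>First for intervals whose end points carry no mass, as the inversion formula requires; this excludes
  atoms altogether, since end points without mass are dense.\<close>

lemma measure_Ioc_le_aux:
  assumes "c \<le> a" "a \<le> b" "b \<le> d" "measure M {a} = 0" "measure M {b} = 0"
  shows "measure M {a<..b} \<le> C * (b - a)"
proof -
  have lim: "(\<lambda>n. LINT y:{a..b}|lborel. inv_trunc (char M) (real n) y) \<longlonglongrightarrow> measure M {a<..b}"
    by (rule Levy_inversion_inv_trunc) (use assms in auto)
  have "(LINT y:{a..b}|lborel. inv_trunc (char M) (real n) y) \<le> C * (b - a)" for n :: nat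
  proof -
  have ci: "continuous_on {a..b} (inv_trunc (char M) (real n))"
    by (rule continuous_on_subset[OF continuous_on_inv_trunc[where C = 1]]) (auto simp: cmod_char_le_1)
  have "(LINT y:{a..b}|lborel. inv_trunc (char M) (real n) y) \<le> (LINT y:{a..b}|lborel. C)"
  proof (rule set_integral_mono)
    show "set_integrable lborel {a..b} (inv_trunc (char M) (real n))"
      by (rule borel_integrable_atLeastAtMost'[OF ci])
    show "set_integrable lborel {a..b} (\<lambda>y. C)"
      by (rule borel_integrable_atLeastAtMost') simp
    fix y assume "y \<in> {a..b}"
    then show "inv_trunc (char M) (real n) y \<le> C" using bound[of y n] assms by auto
  qed
  also have "\<dots> = C * (b - a)" using assms by (simp add: set_lebesgue_integral_def)
  finally show ?thesis .
  qed
  with lim show ?thesis by (intro LIMSEQ_le_const2) auto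
qed

lemma no_atoms_aux:
  assumes x: "c < x" "x < d"
  shows "measure M {x} = 0"
proof -
  have "measure M {x} \<le> 0 + e" if e: "0 < e" for e
  proof -
    have C: "0 \<le> C" using bound[of x 0] x by auto
    \<comment> \<open>Half the length of an interval whose mass is at most \<open>e\<close>.\<close>
    define h where "h = e / (2 * (C + 1))"
    have h: "0 < h" using e C by (simp add: h_def)
    obtain a where a: "max c (x - h) < a" "a < x" "measure M {a} = 0"
      using no_atom_between[of "max c (x - h)" x] x h by auto
    obtain b where b: "x < b" "b < min d (x + h)" "measure M {b} = 0"
      using no_atom_between[of x "min d (x + h)"] x h by auto
    have "measure M {x} \<le> measure M {a<..b}"
      by (rule finite_measure_mono) (use a b in auto)
    also have "\<dots> \<le> C * (b - a)" by (rule measure_Ioc_le_aux) (use a b in auto)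
    also have "\<dots> \<le> C * (2 * h)" using a b C by (intro mult_left_mono) auto
    also have "\<dots> \<le> e" using C e by (simp add: h_def field_simps)
    finally show ?thesis by simp
  qed
  then have "measure M {x} \<le> 0" by (rule field_le_epsilon)
  then show ?thesis by (simp add: measure_le_0_iff)
qed

lemma emeasure_le_lborel_aux:
  assumes cd: "c < c'" "d' < d" and A: "A \<in> sets borel"
  shows "emeasure M (A \<inter> {c'<..d'}) \<le> ennreal C * emeasure lborel (A \<inter> {c'<..d'})"
proof (cases "c' \<le> d'")
  case False
  then have "A \<inter> {c'<..d'} = {}" by auto
  then show ?thesis by simp
next
  case True
  have C: "0 \<le> C" using bound[of d' 0] cd True by auto
  let ?I = "{c'<..d'}"
  let ?M = "density M (indicator ?I)" and ?N = "density lborel (\<lambda>x. ennreal C * indicator ?I x)"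
  have eM: "emeasure ?M B = emeasure M (B \<inter> ?I)" if "B \<in> sets borel" for B
    using that by (subst emeasure_density) (auto simp flip: indicator_inter_arith simp: Int_commute)
  have eN: "emeasure ?N B = ennreal C * emeasure lborel (B \<inter> ?I)" if "B \<in> sets borel" for B
    using that by (subst emeasure_density)
      (auto simp: nn_integral_cmult mult.assoc simp flip: indicator_inter_arith, simp add: Int_commute)
  have fM: "finite_measure ?M" by (rule finite_measureI) (simp add: eM)
  have fN: "finite_measure ?N" 
    by (rule finite_measureI) (use True in \<open>simp add: eN ennreal_mult_eq_top_iff\<close>)
  have "measure ?M A \<le> measure ?N A"
  proof (rule measure_le_if_Ioc_le[OF fM _ fN _ _ A])
    fix a b :: real assume ab: "a \<le> b"
    have int: "{a<..b} \<inter> ?I = {max a c'<..min b d'}" by auto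
    have "measure ?M {a<..b} = measure M {max a c'<..min b d'}"
      by (simp add: measure_def eM int)
    moreover have "measure ?N {a<..b} = C * measure lborel {max a c'<..min b d'}"
      using C by (simp add: measure_def eN int enn2real_mult)
    moreover have "measure M {max a c'<..min b d'} \<le> C * measure lborel {max a c'<..min b d'}"
    proof (cases "max a c' \<le> min b d'")
      case le: True
      then have "measure M {max a c'<..min b d'} \<le> C * (min b d' - max a c')"
        using cd True by (intro measure_Ioc_le_aux no_atoms_aux) auto
      with le show ?thesis by simp
    next
      case False
      then have "{max a c'<..min b d'} = {}" by (simp only: greaterThanAtMost_empty_iff not_le less_imp_le)
      then show ?thesis by (simp only: measure_empty)
    qed
    ultimately show "measure ?M {a<..b} \<le> measure ?N {a<..b}" by simp
  qed auto
  then have "emeasure ?M A \<le> emeasure ?N A"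
    using fM fN by (simp add: finite_measure.emeasure_eq_measure ennreal_leI)
  then show ?thesis using A by (simp add: eM eN)
qed

end

lemma emeasure_le_lborel:
  assumes bound: "\<And>n y. 1/2 \<le> \<bar>y\<bar> \<Longrightarrow> \<bar>inv_trunc (char M) (real n) y\<bar> \<le> C"
    and A: "A \<in> sets borel"
  shows "emeasure M (A - {-1<..1}) \<le> ennreal C * emeasure lborel A"
proof -
  have p: "emeasure M (A \<inter> {1<..}) \<le> ennreal C * emeasure lborel (A \<inter> {1<..})"
  proof -
    have "(SUP n. emeasure M (A \<inter> {1<..real n})) = emeasure M (\<Union>n. A \<inter> {1<..real n})"
      by (rule SUP_emeasure_incseq) (use A in \<open>auto simp: incseq_def\<close>)
    also have "(\<Union>n. A \<inter> {1<..real n}) = A \<inter> {1<..}" using real_arch_simple by auto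
    finally have "emeasure M (A \<inter> {1<..}) = (SUP n. emeasure M (A \<inter> {1<..real n}))" ..
    also have "\<dots> \<le> ennreal C * emeasure lborel (A \<inter> {1<..})"
    proof (rule SUP_least)
      fix n :: nat
      have "emeasure M (A \<inter> {1<..real n}) \<le> ennreal C * emeasure lborel (A \<inter> {1<..real n})"
        by (rule emeasure_le_lborel_aux[of "1/2" "real n + 1"]) (use A bound in auto)
      also have "\<dots> \<le> ennreal C * emeasure lborel (A \<inter> {1<..})"
        by (intro mult_left_mono emeasure_mono) (use A in auto)
      finally show "emeasure M (A \<inter> {1<..real n}) \<le> ennreal C * emeasure lborel (A \<inter> {1<..})" .
    qed
    finally show ?thesis .
  qed
  have m: "emeasure M (A \<inter> {..-1}) \<le> ennreal C * emeasure lborel (A \<inter> {..-1})"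
  proof -
    have "(SUP n. emeasure M (A \<inter> {-real n<..-1})) = emeasure M (\<Union>n. A \<inter> {-real n<..-1})"
      by (rule SUP_emeasure_incseq) (use A in \<open>auto simp: incseq_def\<close>)
    also have "(\<Union>n. A \<inter> {-real n<..-1}) = A \<inter> {..-1}"
    proof safe
      fix x :: real assume x: "x \<in> A" "x \<le> -1"
      obtain n :: nat where "- x < real n" using reals_Archimedean2 by blast
      with x show "x \<in> (\<Union>n. A \<inter> {-real n<..-1})" by (intro UN_I[of n]) auto
    qed auto
    finally have "emeasure M (A \<inter> {..-1}) = (SUP n. emeasure M (A \<inter> {-real n<..-1}))" ..
    also have "\<dots> \<le> ennreal C * emeasure lborel (A \<inter> {..-1})"
    proof (rule SUP_least)
      fix n :: nat
      have "emeasure M (A \<inter> {-real n<..-1}) \<le> ennreal C * emeasure lborel (A \<inter> {-real n<..-1})"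
        by (rule emeasure_le_lborel_aux[of "- real n - 1" "-1/2"]) (use A bound in auto)
      also have "\<dots> \<le> ennreal C * emeasure lborel (A \<inter> {..-1})"
        by (intro mult_left_mono emeasure_mono) (use A in auto)
      finally show "emeasure M (A \<inter> {-real n<..-1}) \<le> ennreal C * emeasure lborel (A \<inter> {..-1})" .
    qed
    finally show ?thesis .
  qed
  define X Y where "X = A \<inter> {1<..}" and "Y = A \<inter> {..-1}"
  have XY: "X \<in> sets borel" "Y \<in> sets borel" "X \<inter> Y = {}" "X \<union> Y \<subseteq> A" "A - {-1<..1} = X \<union> Y"
    using A unfolding X_def Y_def by auto
  have "emeasure M (A - {-1<..1}) = emeasure M X + emeasure M Y"
    unfolding XY(5) by (rule plus_emeasure[symmetric]) (simp_all add: XY(1-3))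
  also have "\<dots> \<le> ennreal C * emeasure lborel X + ennreal C * emeasure lborel Y"
    unfolding X_def Y_def by (rule add_mono[OF p m])
  also have "\<dots> = ennreal C * emeasure lborel (X \<union> Y)"
    by (subst plus_emeasure[symmetric, of X lborel Y]) (simp_all add: XY(1-3) distrib_left)
  also have "\<dots> \<le> ennreal C * emeasure lborel A"
    by (intro mult_left_mono emeasure_mono) (use A XY(4) in auto)
  finally show ?thesis .
qed

end

section \<open>Convolution of a continuous density with a measure\<close>

definition conv_fun :: "real measure \<Rightarrow> (real \<Rightarrow> real) \<Rightarrow> real \<Rightarrow> real" where
  "conv_fun M g y = (LINT x|M. g (y - x))"

lemma nn_integral_reflect:
  fixes f :: "real \<Rightarrow> ennreal"
  assumes "f \<in> borel_measurable borel"
  shows "(\<integral>\<^sup>+x. f (y - x) \<partial>lborel) = (\<integral>\<^sup>+x. f x \<partial>lborel)"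
  using nn_integral_real_affine[of f "-1" y] assms by simp

context
  fixes M :: "real measure" and g :: "real \<Rightarrow> real" and C :: real
  assumes M: "real_distribution M"
    and dom: "\<And>A. A \<in> sets borel \<Longrightarrow> emeasure M (A - {-1<..1}) \<le> ennreal C * emeasure lborel A"
    and cont: "continuous_on UNIV g" and nonneg: "\<And>x. 0 \<le> g x"
    and int: "integrable lborel g"
begin

interpretation M: real_distribution M by (rule M)

lemma emeasure_UNIV: "emeasure M UNIV = 1"
  using M.emeasure_space_1 by simp

lemma g_meas: "g \<in> borel_measurable borel"
  by (rule borel_measurable_continuous_onI[OF cont])

text \<open>Near the origin nothing is known about the measure except that it is finite; away from it, the measure
  is dominated by a multiple of Lebesgue measure.\<close>

lemma nn_integral_split_le:
  assumes [measurable]: "u \<in> borel_measurable borel"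
  shows "(\<integral>\<^sup>+x. u x \<partial>M) \<le> (\<integral>\<^sup>+x. u x * indicator {-1<..1} x \<partial>M) + ennreal C * (\<integral>\<^sup>+x. u x \<partial>lborel)"
proof -
  let ?N = "density M (indicator (- {-1<..1}))"
  have "(\<integral>\<^sup>+x. u x \<partial>M) = (\<integral>\<^sup>+x. u x * indicator {-1<..1} x + u x * indicator (- {-1<..1}) x \<partial>M)"
    by (rule nn_integral_cong) (auto split: split_indicator)
  also have "\<dots> = (\<integral>\<^sup>+x. u x * indicator {-1<..1} x \<partial>M) + (\<integral>\<^sup>+x. u x * indicator (- {-1<..1}) x \<partial>M)"
    by (rule nn_integral_add) auto
  also have "(\<integral>\<^sup>+x. u x * indicator (- {-1<..1}) x \<partial>M) = (\<integral>\<^sup>+x. u x \<partial>?N)"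
    by (subst nn_integral_density) (auto simp: mult.commute)
  also have "\<dots> \<le> (\<Sum>j\<in>{()}. ennreal C * (\<integral>\<^sup>+x. u x \<partial>lborel))"
  proof (rule nn_integral_le_sum)
    fix A :: "real set" assume A: "A \<in> sets borel"
    have "emeasure ?N A = (\<integral>\<^sup>+x. indicator (A - {-1<..1}) x \<partial>M)"
      using A by (subst emeasure_density) (auto intro!: nn_integral_cong split: split_indicator simp del: nn_integral_indicator)
    also have "\<dots> = emeasure M (A - {-1<..1})" using A by (intro nn_integral_indicator) auto
    also note dom[OF A]
    finally show "emeasure ?N A \<le> (\<Sum>j\<in>{()}. ennreal C * emeasure lborel A)" by simp
  qed auto
  finally show ?thesis by (simp add: add_left_mono)
qed

lemma bounded_on_interval:
  obtains B where "0 \<le> B" "\<And>x. \<bar>x\<bar> \<le> R \<Longrightarrow> g x \<le> B"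
proof -
  have "bounded (g ` {-R..R})"
    by (intro compact_imp_bounded compact_continuous_image continuous_on_subset[OF cont]) auto
  then obtain B where B: "\<forall>x\<in>g ` {-R..R}. norm x \<le> B" unfolding bounded_iff by blast
  have "g x \<le> max B 0" if "\<bar>x\<bar> \<le> R" for x
  proof -
    have "x \<in> {-R..R}" using that by auto
    with B have "norm (g x) \<le> B" by blast
    then show ?thesis by auto
  qed
  then show ?thesis using that[of "max B 0"] by simp
qed

lemma integrable_conv: "integrable M (\<lambda>x. g (y - x))"
proof -
  note g_meas[measurable]
  obtain B where B: "0 \<le> B" "\<And>x. \<bar>x\<bar> \<le> \<bar>y\<bar> + 1 \<Longrightarrow> g x \<le> B" using bounded_on_interval by blast
  have "(\<integral>\<^sup>+x. ennreal (norm (g (y - x))) \<partial>M)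
      \<le> (\<integral>\<^sup>+x. ennreal (norm (g (y - x))) * indicator {-1<..1} x \<partial>M)
        + ennreal C * (\<integral>\<^sup>+x. ennreal (norm (g (y - x))) \<partial>lborel)"
    by (rule nn_integral_split_le) simp
  also have "(\<integral>\<^sup>+x. ennreal (norm (g (y - x))) * indicator {-1<..1} x \<partial>M) \<le> (\<integral>\<^sup>+x. ennreal B \<partial>M)"
  proof (rule nn_integral_mono)
    fix x
    show "ennreal (norm (g (y - x))) * indicator {-1<..1} x \<le> ennreal B"
      using B(2)[of "y - x"] nonneg[of "y - x"] by (auto split: split_indicator intro!: ennreal_leI)
  qed
  also have "(\<integral>\<^sup>+x. ennreal B \<partial>M) = ennreal B" by (simp add: emeasure_UNIV)
  also have "(\<integral>\<^sup>+x. ennreal (norm (g (y - x))) \<partial>lborel) = (\<integral>\<^sup>+x. ennreal (norm (g x)) \<partial>lborel)"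
    by (rule nn_integral_reflect[of "\<lambda>x. ennreal (norm (g x))"]) simp
  finally have "(\<integral>\<^sup>+x. ennreal (norm (g (y - x))) \<partial>M) \<le> ennreal B + ennreal C * (\<integral>\<^sup>+x. ennreal (norm (g x)) \<partial>lborel)"
    by (simp add: add_mono)
  also have "\<dots> < \<infinity>"
    using int unfolding integrable_iff_bounded by (simp add: ennreal_mult_less_top)
  finally show ?thesis by (simp add: integrable_iff_bounded)
qed

text \<open>Away from the origin the measure has a bounded density, and there the translates of \<open>g\<close>
  converge in mean by Scheffe's lemma, because they all have the same integral.\<close>

lemma continuous_conv_fun: "continuous_on UNIV (conv_fun M g)"
proof (rule continuous_at_imp_continuous_on, rule ballI, rule continuous_at_sequentiallyI)
  note g_meas[measurable]
  fix y :: real and v assume v: "v \<longlonglongrightarrow> y"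
  obtain R where R: "\<And>n. \<bar>v n\<bar> \<le> R" "\<bar>y\<bar> \<le> R"
  proof -
    obtain K where "\<And>n. norm (v n) \<le> K" using Bseq_def convergent_imp_Bseq convergentI[OF v] by metis
    then show ?thesis using that[of "max K \<bar>y\<bar>"] by (simp add: le_max_iff_disj)
  qed
  obtain B where B: "0 \<le> B" "\<And>x. \<bar>x\<bar> \<le> R + 1 \<Longrightarrow> g x \<le> B" using bounded_on_interval by blast
  define w where "w n x = \<bar>g (v n - x) - g (y - x)\<bar>" for n x
  have w[measurable]: "w n \<in> borel_measurable borel" for n unfolding w_def by measurable
  have gy: "(\<lambda>n. g (v n - x)) \<longlonglongrightarrow> g (y - x)" for x
    by (rule continuous_on_tendsto_compose[OF cont tendsto_diff[OF v tendsto_const]]) auto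
  have w0: "(\<lambda>n. w n x) \<longlonglongrightarrow> 0" for x
    unfolding w_def by (rule tendsto_rabs_zero) (use gy[of x] LIM_zero in blast)
  have 1: "(\<lambda>n. \<integral>\<^sup>+x. ennreal (w n x) * indicator {-1<..1} x \<partial>M) \<longlonglongrightarrow> (\<integral>\<^sup>+x. 0 \<partial>M)"
  proof (rule nn_integral_dominated_convergence[where w = "\<lambda>x. ennreal (2 * B)"])
    show "AE x in M. ennreal (w n x) * indicator {-1<..1} x \<le> ennreal (2 * B)" for n
    proof (rule AE_I2)
      fix x
      have "w n x \<le> 2 * B" if "x \<in> {-1<..1}"
      proof -
        have "\<bar>v n - x\<bar> \<le> R + 1" "\<bar>y - x\<bar> \<le> R + 1" using that R(1)[of n] R(2) by auto
        with B show ?thesis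
          using nonneg[of "v n - x"] nonneg[of "y - x"] unfolding w_def by (smt (verit))
      qed
      then show "ennreal (w n x) * indicator {-1<..1} x \<le> ennreal (2 * B)"
        by (auto split: split_indicator intro!: ennreal_leI)
    qed
    show "AE x in M. (\<lambda>n. ennreal (w n x) * indicator {-1<..1} x) \<longlonglongrightarrow> 0"
    proof (rule AE_I2)
      fix x :: real
      have "(\<lambda>n. ennreal (w n x)) \<longlonglongrightarrow> ennreal 0" by (rule tendsto_ennrealI[OF w0])
      then show "(\<lambda>n. ennreal (w n x) * indicator {-1<..1} x) \<longlonglongrightarrow> 0"
        by (auto split: split_indicator)
    qed
    show "(\<integral>\<^sup>+x. ennreal (2 * B) \<partial>M) < \<infinity>" by (simp add: emeasure_UNIV)
  qed auto
  have 2: "(\<lambda>n. \<integral>\<^sup>+x. ennreal (w n x) \<partial>lborel) \<longlonglongrightarrow> 0"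
    unfolding w_def real_norm_def[symmetric]
  proof (rule Scheffe_lemma2)
    show "integrable lborel (\<lambda>x. g (y - x))"
      using lborel_integrable_real_affine[OF int, of "-1" y] by simp
    show "(\<integral>\<^sup>+x. ennreal (norm (g (v n - x))) \<partial>lborel) \<le> (\<integral>\<^sup>+x. ennreal (norm (g (y - x))) \<partial>lborel)" for n
      using nn_integral_reflect[of "\<lambda>x. ennreal (norm (g x))"] by simp
  qed (use gy in auto)
  have 3: "(\<lambda>n. (\<integral>\<^sup>+x. ennreal (w n x) * indicator {-1<..1} x \<partial>M) + ennreal C * (\<integral>\<^sup>+x. ennreal (w n x) \<partial>lborel))
      \<longlonglongrightarrow> 0 + ennreal C * 0"
    using 1 by (intro tendsto_add ennreal_tendsto_cmult 2) auto
  have "(\<lambda>n. ennreal \<bar>conv_fun M g (v n) - conv_fun M g y\<bar>) \<longlonglongrightarrow> 0"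
  proof (rule tendsto_sandwich[OF _ _ tendsto_const])
    show "\<forall>\<^sub>F n in sequentially. ennreal \<bar>conv_fun M g (v n) - conv_fun M g y\<bar>
       \<le> (\<integral>\<^sup>+x. ennreal (w n x) * indicator {-1<..1} x \<partial>M) + ennreal C * (\<integral>\<^sup>+x. ennreal (w n x) \<partial>lborel)"
    proof (rule always_eventually, rule allI)
      fix n
      have "conv_fun M g (v n) - conv_fun M g y = (LINT x|M. g (v n - x) - g (y - x))"
        unfolding conv_fun_def by (intro Bochner_Integration.integral_diff[symmetric] integrable_conv)
      then have "ennreal \<bar>conv_fun M g (v n) - conv_fun M g y\<bar> \<le> (\<integral>\<^sup>+x. ennreal (w n x) \<partial>M)"
        using integral_norm_bound_ennreal[of M "\<lambda>x. g (v n - x) - g (y - x)"] integrable_conv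
        by (simp add: w_def)
      also note nn_integral_split_le[of "\<lambda>x. ennreal (w n x)"]
      finally show "ennreal \<bar>conv_fun M g (v n) - conv_fun M g y\<bar>
        \<le> (\<integral>\<^sup>+x. ennreal (w n x) * indicator {-1<..1} x \<partial>M) + ennreal C * (\<integral>\<^sup>+x. ennreal (w n x) \<partial>lborel)"
        by simp
    qed
    show "(\<lambda>n. (\<integral>\<^sup>+x. ennreal (w n x) * indicator {-1<..1} x \<partial>M) + ennreal C * (\<integral>\<^sup>+x. ennreal (w n x) \<partial>lborel)) \<longlonglongrightarrow> 0"
      using 3 by simp
  qed auto
  then have "(\<lambda>n. \<bar>conv_fun M g (v n) - conv_fun M g y\<bar>) \<longlonglongrightarrow> 0"
    by (subst (asm) ennreal_0[symmetric], subst (asm) tendsto_ennreal_iff) auto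
  then show "(\<lambda>n. conv_fun M g (v n)) \<longlonglongrightarrow> conv_fun M g y"
    using LIM_zero_cancel tendsto_rabs_zero_iff by blast
qed

lemma conv_fun_nonneg: "0 \<le> conv_fun M g z"
  unfolding conv_fun_def by (simp add: integral_nonneg_AE nonneg)

lemma emeasure_convolution_density:
  assumes [measurable]: "A \<in> sets borel"
  shows "emeasure (density lborel g \<star> M) A = (\<integral>\<^sup>+z. ennreal (conv_fun M g z) * indicator A z \<partial>lborel)"
proof -
  note g_meas[measurable]
  let ?D = "density lborel (\<lambda>x. ennreal (g x))"
  have fin: "finite_measure ?D"
    by (rule finite_measureI) (use int nonneg in \<open>simp add: emeasure_density integrable_iff_bounded\<close>)
  interpret P: pair_sigma_finite M lborel ..
  have "emeasure (?D \<star> M) A = (\<integral>\<^sup>+z. indicator A z \<partial>(?D \<star> M))" by simp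
  also have "\<dots> = (\<integral>\<^sup>+x. \<integral>\<^sup>+y. indicator A (x + y) \<partial>M \<partial>?D)"
    by (rule nn_integral_convolution) (use fin M.finite_measure_axioms in auto)
  also have "\<dots> = (\<integral>\<^sup>+x. ennreal (g x) * (\<integral>\<^sup>+y. indicator A (x + y) \<partial>M) \<partial>lborel)"
    by (rule nn_integral_density) measurable
  also have "\<dots> = (\<integral>\<^sup>+x. \<integral>\<^sup>+y. ennreal (g x) * indicator A (x + y) \<partial>M \<partial>lborel)"
    by (intro nn_integral_cong nn_integral_cmult[symmetric]) measurable
  also have "\<dots> = (\<integral>\<^sup>+y. \<integral>\<^sup>+x. ennreal (g x) * indicator A (x + y) \<partial>lborel \<partial>M)"
    by (rule P.Fubini') measurable
  also have "\<dots> = (\<integral>\<^sup>+y. \<integral>\<^sup>+z. ennreal (g (z - y)) * indicator A z \<partial>lborel \<partial>M)"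
  proof (rule nn_integral_cong)
    fix y
    show "(\<integral>\<^sup>+x. ennreal (g x) * indicator A (x + y) \<partial>lborel) = (\<integral>\<^sup>+z. ennreal (g (z - y)) * indicator A z \<partial>lborel)"
      using nn_integral_real_affine[of "\<lambda>x. ennreal (g x) * indicator A (x + y)" 1 "- y"] by simp
  qed
  also have "\<dots> = (\<integral>\<^sup>+z. \<integral>\<^sup>+y. ennreal (g (z - y)) * indicator A z \<partial>M \<partial>lborel)"
    by (rule P.Fubini'[symmetric]) measurable
  also have "\<dots> = (\<integral>\<^sup>+z. ennreal (conv_fun M g z) * indicator A z \<partial>lborel)"
  proof (rule nn_integral_cong)
    fix z
    have "(\<integral>\<^sup>+y. ennreal (g (z - y)) \<partial>M) = ennreal (conv_fun M g z)"
      unfolding conv_fun_def by (rule nn_integral_eq_integral[OF integrable_conv]) (simp add: nonneg)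
    then show "(\<integral>\<^sup>+y. ennreal (g (z - y)) * indicator A z \<partial>M) = ennreal (conv_fun M g z) * indicator A z"
      by (subst nn_integral_multc) auto
  qed
  finally show ?thesis .
qed

lemma measure_convolution_singleton: "measure (density lborel g \<star> M) {a} = 0"
proof -
  have "(\<integral>\<^sup>+z\<in>{a}. ennreal (conv_fun M g z) \<partial>lborel) = 0"
    by (rule nn_integral_null_set) (simp add: null_sets_def)
  then show ?thesis by (simp add: measure_def emeasure_convolution_density)
qed

lemma measure_convolution_Ioc:
  "measure (density lborel g \<star> M) {a<..b} = (LINT z:{a..b}|lborel. conv_fun M g z)"
proof -
  have "emeasure (density lborel g \<star> M) {a<..b} = (\<integral>\<^sup>+z. ennreal (conv_fun M g z) * indicator {a<..b} z \<partial>lborel)"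
    by (rule emeasure_convolution_density) simp
  also have "\<dots> = (\<integral>\<^sup>+z. ennreal (indicator {a..b} z * conv_fun M g z) \<partial>lborel)"
  proof (rule nn_integral_cong_AE)
    show "AE z in lborel. ennreal (conv_fun M g z) * indicator {a<..b} z = ennreal (indicator {a..b} z * conv_fun M g z)"
      using AE_lborel_singleton[of a] by eventually_elim (auto split: split_indicator)
  qed
  also have "\<dots> = ennreal (LINT z:{a..b}|lborel. conv_fun M g z)"
    unfolding set_lebesgue_integral_def real_scaleR_def
  proof (rule nn_integral_eq_integral)
    show "integrable lborel (\<lambda>z. indicator {a..b} z * conv_fun M g z)"
      using borel_integrable_atLeastAtMost'[OF continuous_on_subset[OF continuous_conv_fun], of a b]
      unfolding set_integrable_def by simp
    show "AE z in lborel. 0 \<le> indicator {a..b} z * conv_fun M g z"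
      by (auto intro!: AE_I2 simp: conv_fun_nonneg)
  qed
  finally show ?thesis
    unfolding measure_def set_lebesgue_integral_def
    by (simp add: conv_fun_nonneg integral_nonneg_AE)
qed

end

section \<open>Convolution powers and the deconvolution kernel\<close>

lemma real_distribution_convolution:
  assumes "real_distribution M" "real_distribution N"
  shows "real_distribution (M \<star> N)"
proof -
  interpret M: real_distribution M by fact
  interpret N: real_distribution N by fact
  interpret P: pair_prob_space M N ..
  show ?thesis unfolding convolution_def
    by (rule P.real_distribution_distr) simp
qed

lemma char_convolution:
  assumes "real_distribution M" "real_distribution N"
  shows "char (M \<star> N) t = char M t * char N t"
proof -
  interpret M: real_distribution M by fact
  interpret N: real_distribution N by fact
  interpret P: pair_prob_space M N ..
  have int: "integrable (M \<Otimes>\<^sub>M N) (\<lambda>(x, y). iexp (t * (x + y)))"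
    by (rule P.integrable_const_bound[of _ 1]) (auto simp: split_beta)
  have "char (M \<star> N) t = (CLINT p|M \<Otimes>\<^sub>M N. (case p of (x, y) \<Rightarrow> iexp (t * (x + y))))"
    unfolding char_def convolution_def by (subst integral_distr) (auto simp: case_prod_unfold)
  also have "\<dots> = (CLINT x|M. CLINT y|N. iexp (t * (x + y)))"
    using P.integral_fst'[OF int] by simp
  also have "\<dots> = (CLINT x|M. iexp (t * x) * (CLINT y|N. iexp (t * y)))"
    by (simp add: distrib_left exp_add flip: integral_mult_right_zero)
  also have "\<dots> = char M t * char N t" unfolding char_def by simp
  finally show ?thesis .
qed

primrec conv_pow :: "real measure \<Rightarrow> nat \<Rightarrow> real measure" where
  "conv_pow M 0 = return borel 0"
| "conv_pow M (Suc j) = (conv_pow M j \<star> M)"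

lemma real_distribution_conv_pow:
  assumes "real_distribution M"
  shows "real_distribution (conv_pow M j)"
proof (induction j)
  case 0
  have "prob_space (return borel (0::real))" by (rule prob_space_return) simp
  then show ?case by (simp add: real_distribution_def real_distribution_axioms_def)
qed (simp add: real_distribution_convolution assms)

lemma char_conv_pow:
  assumes "real_distribution M"
  shows "char (conv_pow M j) t = char M t ^ j"
proof (induction j)
  case 0
  show ?case by (simp add: char_def integral_return)
qed (simp add: char_convolution real_distribution_conv_pow assms mult.commute)

lemma sets_conv_pow: "real_distribution M \<Longrightarrow> sets (conv_pow M j) = sets borel"
  using real_distribution.events_eq_borel[OF real_distribution_conv_pow] by blast

lemma sum_coeff_shift:
  fixes X :: "nat \<Rightarrow> complex" and c :: "nat \<Rightarrow> real" and l :: nat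
  defines "c' \<equiv> \<lambda>j. (if j \<le> l then c j else 0) - (if j = 0 then 0 else c (j - 1))"
  shows "(\<Sum>j\<le>Suc l. complex_of_real (c' j) * X j) = (\<Sum>j\<le>l. complex_of_real (c j) * (X j - X (Suc j)))"
proof -
  have "(\<Sum>j\<le>Suc l. complex_of_real (c' j) * X j)
    = (\<Sum>j\<le>Suc l. complex_of_real (if j \<le> l then c j else 0) * X j)
      - (\<Sum>j\<le>Suc l. complex_of_real (if j = 0 then 0 else c (j - 1)) * X j)"
    by (simp add: c'_def left_diff_distrib sum_subtractf)
  also have "(\<Sum>j\<le>Suc l. complex_of_real (if j \<le> l then c j else 0) * X j) = (\<Sum>j\<le>l. complex_of_real (c j) * X j)"
    by simp
  also have "(\<Sum>j\<le>Suc l. complex_of_real (if j = 0 then 0 else c (j - 1)) * X j) = (\<Sum>j\<le>l. complex_of_real (c j) * X (Suc j))"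
    by (subst sum.atMost_Suc_shift) simp
  finally show ?thesis by (simp add: right_diff_distrib sum_subtractf)
qed

text \<open>The coefficients are determined by the polynomial identity, in which the powers of \<open>z\<close> stand for
  the convolution powers.\<close>

lemma cm_conv_power_expansion:
  assumes M: "real_distribution M"
  shows "\<exists>c :: nat \<Rightarrow> real.
    (\<forall>A\<in>sets borel. cm_conv_power (pi_measure M) l A = (\<Sum>j\<le>l. complex_of_real (c j) * measure (conv_pow M j) A)) \<and>
    (\<forall>z::complex. (\<Sum>j\<le>l. complex_of_real (c j) * z ^ j) = (1 - z) ^ l)"
proof (induction l)
  case 0
  have "measure (return borel (0::real)) A = indicator A 0" if "A \<in> sets borel" for A
    using that by (simp add: measure_return)
  then show ?case
    by (intro exI[of _ "\<lambda>_. 1"]) (auto simp: dirac0_def split: split_indicator)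
next
  case (Suc l)
  interpret M: real_distribution M by (rule M)
  from Suc obtain c where c: "\<And>A. A \<in> sets borel \<Longrightarrow>
      cm_conv_power (pi_measure M) l A = (\<Sum>j\<le>l. complex_of_real (c j) * measure (conv_pow M j) A)"
    "\<And>z::complex. (\<Sum>j\<le>l. complex_of_real (c j) * z ^ j) = (1 - z) ^ l"
    by blast
  define c' where "c' j = (if j \<le> l then c j else 0) - (if j = 0 then 0 else c (j - 1))" for j
  show ?case
  proof (intro exI[of _ c'] conjI ballI allI)
    fix A :: "real set" assume A[measurable]: "A \<in> sets borel"
    have Ax: "{y. y + x \<in> A} \<in> sets borel" for x
    proof -
      have "(\<lambda>y. y + x) -` A \<inter> space borel \<in> sets borel" by measurable
      then show ?thesis by (simp add: vimage_def)
    qed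
    have mm: "(\<lambda>x. measure M {y. y + x \<in> A}) \<in> borel_measurable borel"
    proof -
      have "(\<lambda>x. emeasure M (Pair x -` {p \<in> space (borel \<Otimes>\<^sub>M M). snd p + fst p \<in> A})) \<in> borel_measurable borel"
        by (rule M.measurable_emeasure_Pair) measurable
      then show ?thesis by (simp add: space_pair_measure measure_def)
    qed
    define f where "f x = complex_of_real (indicator A x - measure M {y. y + x \<in> A})" for x
    have fm: "f \<in> borel_measurable borel" unfolding f_def using mm by measurable
    have pi_f: "(\<lambda>x. pi_measure M {y. y + x \<in> A}) = f"
      by (auto simp: pi_measure_def dirac0_def f_def fun_eq_iff split: split_indicator)
    have D: "real_distribution (conv_pow M j)" for j by (rule real_distribution_conv_pow[OF M])
    have int1: "integrable (conv_pow M j) (indicator A :: real \<Rightarrow> real)"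
      and int2: "integrable (conv_pow M j) (\<lambda>x. measure M {y. y + x \<in> A})" for j
    proof -
      interpret D: real_distribution "conv_pow M j" by (rule D)
      show "integrable (conv_pow M j) (indicator A :: real \<Rightarrow> real)"
        by (rule D.integrable_const_bound[of _ 1]) (auto split: split_indicator)
      show "integrable (conv_pow M j) (\<lambda>x. measure M {y. y + x \<in> A})"
        by (rule D.integrable_const_bound[of _ 1]) (use mm in auto)
    qed
    have If: "(CLINT x|conv_pow M j. f x) = complex_of_real (measure (conv_pow M j) A - measure (conv_pow M (Suc j)) A)" for j
    proof -
      interpret D: real_distribution "conv_pow M j" by (rule D)
      interpret D': real_distribution "conv_pow M (Suc j)" by (rule D)
      have "emeasure (conv_pow M (Suc j)) A = (\<integral>\<^sup>+x. emeasure M {y. y + x \<in> A} \<partial>conv_pow M j)"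
        by (simp, rule convolution_emeasure)
          (auto simp: D.finite_measure_axioms M.finite_measure_axioms sets_conv_pow[OF M])
      also have "\<dots> = ennreal (LINT x|conv_pow M j. measure M {y. y + x \<in> A})"
        unfolding M.emeasure_eq_measure by (rule nn_integral_eq_integral[OF int2]) simp
      finally have "measure (conv_pow M (Suc j)) A = (LINT x|conv_pow M j. measure M {y. y + x \<in> A})"
        by (simp add: measure_def)
      moreover have "measure (conv_pow M j) A = (LINT x|conv_pow M j. indicator A x)"
        using A by simp
      moreover have "(CLINT x|conv_pow M j. f x) = complex_of_real (LINT x|conv_pow M j. indicator A x - measure M {y. y + x \<in> A})"
        unfolding f_def by (rule integral_complex_of_real)
      ultimately show ?thesis using int1 int2 by (simp add: Bochner_Integration.integral_diff)
    qed
    have "cm_conv_power (pi_measure M) (Suc l) A = cm_integral (cm_conv_power (pi_measure M) l) f"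
      by (simp add: cm_convolution_def pi_f)
    also have "\<dots> = (\<Sum>j\<in>{..l}. complex_of_real (c j) * (CLINT x|conv_pow M j. f x))"
    proof (rule cm_integral_sum)
      fix j
      interpret D: real_distribution "conv_pow M j" by (rule D)
      show "finite_measure (conv_pow M j)" by (rule D.finite_measure_axioms)
      show "sets (conv_pow M j) = sets borel" by (rule sets_conv_pow[OF M])
      show "integrable (conv_pow M j) f"
        unfolding f_def by (intro integrable_of_real Bochner_Integration.integrable_diff int1 int2)
    qed (use c fm in auto)
    also have "\<dots> = (\<Sum>j\<le>Suc l. complex_of_real (c' j) * measure (conv_pow M j) A)"
      using sum_coeff_shift[of l c "\<lambda>j. complex_of_real (measure (conv_pow M j) A)"]
      unfolding c'_def[symmetric] If of_real_diff by (rule sym)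
    finally show "cm_conv_power (pi_measure M) (Suc l) A = (\<Sum>j\<le>Suc l. complex_of_real (c' j) * measure (conv_pow M j) A)" .
  next
    fix z :: complex
    have "(\<Sum>j\<le>Suc l. complex_of_real (c' j) * z ^ j) = (\<Sum>j\<le>l. complex_of_real (c j) * z ^ j) * (1 - z)"
      unfolding c'_def sum_coeff_shift sum_distrib_right by (rule sum.cong) (simp_all add: algebra_simps)
    then show "(\<Sum>j\<le>Suc l. complex_of_real (c' j) * z ^ j) = (1 - z) ^ Suc l"
      by (simp add: c(2))
  qed
qed

text \<open>The second identity is the geometric sum, multiplied by \<open>z\<close> to account for the one
  convolution factor that is already contained in \<open>g\<close>.\<close>

lemma sum_conv_power_expansion:
  assumes M: "real_distribution M"
  shows "\<exists>a :: nat \<Rightarrow> real.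
    (\<forall>A\<in>sets borel. (\<Sum>l\<le>m. cm_conv_power (pi_measure M) l A) = (\<Sum>j\<le>m. complex_of_real (a j) * measure (conv_pow M j) A)) \<and>
    (\<forall>z::complex. (\<Sum>j\<le>m. complex_of_real (a j) * z ^ Suc j) = 1 - (1 - z) ^ Suc m)"
proof -
  from cm_conv_power_expansion[OF M] obtain c where c: "\<And>l A. A \<in> sets borel \<Longrightarrow>
      cm_conv_power (pi_measure M) l A = (\<Sum>j\<le>l. complex_of_real (c l j) * measure (conv_pow M j) A)"
    "\<And>l (z::complex). (\<Sum>j\<le>l. complex_of_real (c l j) * z ^ j) = (1 - z) ^ l"
    by metis
  define a where "a j = (\<Sum>l\<le>m. if j \<le> l then c l j else 0)" for j
  have swap: "(\<Sum>j\<le>m. complex_of_real (a j) * X j) = (\<Sum>l\<le>m. \<Sum>j\<le>l. complex_of_real (c l j) * X j)"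
    for X :: "nat \<Rightarrow> complex"
  proof -
    have "(\<Sum>j\<le>m. complex_of_real (a j) * X j) = (\<Sum>j\<le>m. \<Sum>l\<le>m. if j \<le> l then complex_of_real (c l j) * X j else 0)"
      by (auto simp: a_def sum_distrib_right intro!: sum.cong)
    also have "\<dots> = (\<Sum>l\<le>m. \<Sum>j\<le>m. if j \<le> l then complex_of_real (c l j) * X j else 0)" by (rule sum.swap)
    also have "\<dots> = (\<Sum>l\<le>m. \<Sum>j\<le>l. complex_of_real (c l j) * X j)"
      by (intro sum.cong refl sum.mono_neutral_cong_right) auto
    finally show ?thesis .
  qed
  show ?thesis
  proof (intro exI[of _ a] conjI ballI allI)
    fix A :: "real set" assume "A \<in> sets borel"
    then show "(\<Sum>l\<le>m. cm_conv_power (pi_measure M) l A) = (\<Sum>j\<le>m. complex_of_real (a j) * measure (conv_pow M j) A)"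
      by (simp add: swap c)
  next
    fix z :: complex
    have "(\<Sum>j\<le>m. complex_of_real (a j) * z ^ Suc j) = z * (\<Sum>j\<le>m. complex_of_real (a j) * z ^ j)"
      by (simp add: sum_distrib_left mult_ac)
    also have "\<dots> = z * (\<Sum>l<Suc m. (1 - z) ^ l)" by (simp add: swap c lessThan_Suc_atMost)
    also have "\<dots> = 1 - (1 - z) ^ Suc m" using one_diff_power_eq[of "1 - z" "Suc m"] by simp
    finally show "(\<Sum>j\<le>m. complex_of_real (a j) * z ^ Suc j) = 1 - (1 - z) ^ Suc m" .
  qed
qed

text \<open>The kernel is the distribution function of a linear combination of convolution powers, and
  its Stieltjes measure is unique; thus the deconvolution density is a linear combination of
  convolutions of \<open>g\<close>.\<close>

lemma deconv_density_eq_sum: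
  assumes M: "real_distribution M"
    and a: "\<And>A. A \<in> sets borel \<Longrightarrow> (\<Sum>l\<le>m. cm_conv_power (pi_measure M) l A) = (\<Sum>j\<le>m. complex_of_real (a j) * measure (conv_pow M j) A)"
    and g: "g \<in> borel_measurable borel" and int: "\<And>j. integrable (conv_pow M j) (\<lambda>x. g (\<xi> - x))"
  shows "deconv_density M g \<xi> m = complex_of_real (\<Sum>j\<le>m. a j * conv_fun (conv_pow M j) g \<xi>)"
proof -
  have fm: "finite_measure (conv_pow M j)" for j
  proof -
    interpret D: real_distribution "conv_pow M j" by (rule real_distribution_conv_pow[OF M])
    show ?thesis by (rule D.finite_measure_axioms)
  qed
  define \<nu> where "\<nu> A = (\<Sum>j\<le>m. complex_of_real (a j) * measure (conv_pow M j) A)" for A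
  have \<nu>: "complex_measure \<nu>"
    by (rule complex_measure_sum[where J = "{..m}" and M = "conv_pow M" and c = "\<lambda>j. complex_of_real (a j)"])
      (auto simp: \<nu>_def fm sets_conv_pow[OF M])
  have K: "deconv_kernel M x m = \<nu> {..x}" for x
    using a[of "{..x}"] by (simp add: deconv_kernel_def cm_cdf_def \<nu>_def)
  have Ioc: "\<nu> {u<..v} = deconv_kernel M v m - deconv_kernel M u m" if "u \<le> v" for u v
  proof -
    have "{u<..v} = {..v} - {..u}" by auto
    then show ?thesis using complex_measure_Diff[OF \<nu>, of "{..v}" "{..u}"] that by (simp add: K)
  qed
  have "deconv_density M g \<xi> m = cm_integral \<nu> (\<lambda>x. complex_of_real (g (\<xi> - x)))"
    unfolding deconv_density_def by (rule cm_integral_cong) (rule stieltjes_unique[OF \<nu> Ioc])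
  also have "\<dots> = (\<Sum>j\<in>{..m}. complex_of_real (a j) * (CLINT x|conv_pow M j. complex_of_real (g (\<xi> - x))))"
    by (rule cm_integral_sum) (use g int in \<open>auto simp: \<nu>_def fm sets_conv_pow[OF M] intro: integrable_of_real\<close>)
  finally show ?thesis by (simp add: conv_fun_def)
qed

section \<open>Tails of the inversion integral\<close>

lemma inv_trunc_diff_bound:
  assumes [measurable]: "\<Phi> \<in> borel_measurable borel" and le: "\<And>t. cmod (\<Phi> t) \<le> 1" and R: "0 \<le> R" "R \<le> R'"
    and e: "cmod (CLINT t:{R..R'}|lborel. iexp (- (t * y)) * \<Phi> t) \<le> e"
  shows "\<bar>inv_trunc \<Phi> R' y - inv_trunc \<Phi> R y\<bar> \<le> e"
proof -
  define h where "h a b t = indicator {a..b} t *\<^sub>R (iexp (- (t * y)) * \<Phi> t)" for a b t :: real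
  have h: "integrable lborel (h a b)" for a b
    unfolding h_def by (rule integrable_indicator_bounded[where C = 1]) (auto simp: norm_mult le)
  have "(CLINT t|lborel. h 0 R' t) = (CLINT t|lborel. h 0 R t + h R R' t)"
  proof (rule integral_cong_AE)
    show "AE t in lborel. h 0 R' t = h 0 R t + h R R' t"
      using AE_lborel_singleton[of R] by eventually_elim (use R in \<open>auto simp: h_def split: split_indicator\<close>)
  qed (auto simp: h_def)
  also have "\<dots> = (CLINT t|lborel. h 0 R t) + (CLINT t|lborel. h R R' t)"
    by (rule Bochner_Integration.integral_add[OF h h])
  finally have "inv_trunc \<Phi> R' y - inv_trunc \<Phi> R y = Re (CLINT t|lborel. h R R' t) / pi"
    unfolding inv_trunc_def set_lebesgue_integral_def h_def by (simp add: add_divide_distrib)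
  moreover have "\<bar>Re (CLINT t|lborel. h R R' t) / pi\<bar> \<le> \<bar>Re (CLINT t|lborel. h R R' t)\<bar>"
    using pi_gt3 by (simp add: abs_divide divide_le_eq mult_le_cancel_left1)
  moreover have "\<bar>Re (CLINT t|lborel. h R R' t)\<bar> \<le> e"
    using abs_Re_le_cmod[of "CLINT t|lborel. h R R' t"] e unfolding h_def set_lebesgue_integral_def by linarith
  ultimately show ?thesis by linarith
qed

lemma complex_measure_density:
  assumes h: "integrable lborel (h :: real \<Rightarrow> real)"
  shows "complex_measure (\<lambda>A. complex_of_real (LINT x:A|lborel. h x))"
proof -
  have [measurable]: "h \<in> borel_measurable borel" using h by auto
  define M where "M b = density lborel (\<lambda>x. ennreal (if b then h x else - h x))" for b
  have e: "emeasure (M b) A = (\<integral>\<^sup>+x. ennreal (if b then indicator A x * h x else - (indicator A x * h x)) \<partial>lborel)"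
    if "A \<in> sets borel" for b A
    unfolding M_def using that by (subst emeasure_density) (auto intro!: nn_integral_cong split: split_indicator)
  have fin: "finite_measure (M b)" for b
  proof (rule finite_measureI)
    have "emeasure (M b) UNIV \<le> (\<integral>\<^sup>+x. ennreal (norm (h x)) \<partial>lborel)"
      by (subst e) (auto intro!: nn_integral_mono ennreal_leI)
    also have "\<dots> < \<infinity>" using h by (simp add: integrable_iff_bounded)
    finally show "emeasure (M b) (space (M b)) \<noteq> \<infinity>" by (simp add: M_def)
  qed
  show ?thesis
  proof (rule complex_measure_sum[where J = UNIV and M = M and c = "\<lambda>b. if b then 1 else - 1"])
    fix A :: "real set" assume A: "A \<in> sets borel"
    have "integrable lborel (\<lambda>x. indicator A x * h x)"
      using integrable_mult_indicator[of A lborel h] A h by simp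
    then have "(LINT x:A|lborel. h x) = measure (M True) A - measure (M False) A"
      unfolding set_lebesgue_integral_def real_scaleR_def
      by (subst real_lebesgue_integral_def) (auto simp: measure_def e[OF A])
    then show "complex_of_real (LINT x:A|lborel. h x) = (\<Sum>b\<in>UNIV. (if b then 1 else - 1) * complex_of_real (measure (M b) A))"
      by (simp add: UNIV_bool)
  next
    show "sets (M b) = sets borel" for b by (simp add: M_def)
  qed (rule fin)
qed

text \<open>The analytic data of the problem: \<open>f\<close> is the restriction of the amplitude to the finite part of
  the half-line, with an explicit bound \<open>V0\<close> of its variation.\<close>

locale atomic_factorization =
  fixes chi :: "real measure" and \<kappa> :: "real set \<Rightarrow> complex" and f :: "real \<Rightarrow> complex" and T0 V0 :: real
  assumes chi: "real_distribution chi" and T0: "0 \<le> T0" and \<kappa>: "complex_measure \<kappa>"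
    and atomic: "total_variation \<kappa> UNIV = total_variation \<kappa> (discontinuities \<kappa>)"
    and f_cont: "continuous_on {T0..} f" and f_var: "var_le f {T0..} V0" and f_lim: "(f \<longlongrightarrow> 0) at_top"
    and factor: "\<And>t. T0 \<le> t \<Longrightarrow> char chi t = cm_char \<kappa> t * f t"
begin

interpretation chi: real_distribution chi by (rule chi)

definition far :: "real \<Rightarrow> real \<Rightarrow> bool" where
  "far \<rho> y \<longleftrightarrow> (\<forall>d\<in>discontinuities \<kappa>. \<rho> \<le> \<bar>y - d\<bar>)"

text \<open>Bounds the integral against \<open>\<kappa>\<close> of a function of absolute value at most one.\<close>

definition mass :: real where
  "mass = (\<Sum>c\<in>phases. measure (jordan_part \<kappa> c) UNIV)"

lemma mass_nonneg: "0 \<le> mass" unfolding mass_def by (simp add: sum_nonneg)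

lemma norm_sum_parts_le:
  assumes "\<And>c. c \<in> phases \<Longrightarrow> AE x in jordan_part \<kappa> c. cmod (h x) \<le> B" and "\<And>c. c \<in> phases \<Longrightarrow> integrable (jordan_part \<kappa> c) h"
  shows "cmod (\<Sum>c\<in>phases. c * (CLINT x|jordan_part \<kappa> c. h x)) \<le> mass * B"
proof -
  have "cmod (CLINT x|jordan_part \<kappa> c. h x) \<le> measure (jordan_part \<kappa> c) UNIV * B" if c: "c \<in> phases" for c
  proof -
    interpret finite_measure "jordan_part \<kappa> c" by (rule finite_measure_jordan_part[OF \<kappa>])
    have "cmod (CLINT x|jordan_part \<kappa> c. h x) \<le> (LINT x|jordan_part \<kappa> c. cmod (h x))" by (rule integral_norm_bound)
    also have "\<dots> \<le> (LINT x|jordan_part \<kappa> c. B)"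
      by (rule integral_mono_AE) (use assms c in auto)
    finally show ?thesis by simp
  qed
  then have "cmod (\<Sum>c\<in>phases. c * (CLINT x|jordan_part \<kappa> c. h x)) \<le> (\<Sum>c\<in>phases. measure (jordan_part \<kappa> c) UNIV * B)"
    by (intro sum_norm_le) (simp add: norm_mult norm_phases)
  then show ?thesis by (simp add: mass_def sum_distrib_right)
qed

text \<open>Beyond the threshold the characteristic function is a superposition, with respect to the
  atomic measure, of oscillations with amplitude of bounded variation.\<close>

lemma
  assumes R: "T0 \<le> R" and w: "continuous_on {R..R'} w"
  shows integrable_superposition: "integrable (jordan_part \<kappa> c) (\<lambda>x. CLINT t:{R..R'}|lborel. iexp ((x - y) * t) * (f t * w t))"
    and superposition: "(CLINT t:{R..R'}|lborel. iexp (- (t * y)) * (char chi t * w t))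
      = (\<Sum>c\<in>phases. c * (CLINT x|jordan_part \<kappa> c. CLINT t:{R..R'}|lborel. iexp ((x - y) * t) * (f t * w t)))"
proof -
  have cont: "continuous_on {R..R'} (\<lambda>t. f t * w t)"
    by (intro continuous_intros w continuous_on_subset[OF f_cont]) (use R in auto)
  define B where "B t = indicator {R..R'} t *\<^sub>R (f t * w t)" for t
  have Bm[measurable]: "B \<in> borel_measurable borel"
    unfolding B_def by (rule borel_measurable_continuous_on_indicator[OF _ cont]) simp
  have "bounded ((\<lambda>t. f t * w t) ` {R..R'})" by (intro compact_imp_bounded compact_continuous_image cont) simp
  then obtain S where S: "\<forall>z\<in>(\<lambda>t. f t * w t) ` {R..R'}. cmod z \<le> S" unfolding bounded_iff by blast
  have B_le: "cmod (B t) \<le> S * indicator {R..R'} t" for t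
    using S by (auto simp: B_def split: split_indicator)
  define F where "F x t = iexp ((x - y) * t) * B t" for x t
  have Fm: "(\<lambda>(x, t). F x t) \<in> borel_measurable (borel \<Otimes>\<^sub>M borel)"
    unfolding F_def by measurable
  have F_le: "norm (F x t) \<le> 1 * (S * indicator {R..R'} t)" for x t
    using B_le by (simp add: F_def norm_mult)
  have fm: "finite_measure (jordan_part \<kappa> c)" for c by (rule finite_measure_jordan_part[OF \<kappa>])
  have sf: "sigma_finite_measure (jordan_part \<kappa> c)" for c by (rule finite_measure.sigma_finite_measure[OF fm])
  have i1: "integrable (jordan_part \<kappa> c) (\<lambda>_. 1 :: real)" for c
    using finite_measure.integrable_const[OF fm] .
  have iw: "integrable lborel (\<lambda>t. S * indicator {R..R'} t :: real)" by simp
  note fub = integrable_fubini_dominated1[OF sf sets_jordan_part i1 iw Fm F_le]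
     integrable_fubini_dominated2[OF sf sets_jordan_part i1 iw Fm F_le]
     fubini_dominated[OF sf sets_jordan_part i1 iw Fm F_le]
  have inner: "(CLINT t|lborel. F x t) = (CLINT t:{R..R'}|lborel. iexp ((x - y) * t) * (f t * w t))" for x
    unfolding set_lebesgue_integral_def F_def B_def by (simp add: mult_scaleR_right)
  show "integrable (jordan_part \<kappa> c) (\<lambda>x. CLINT t:{R..R'}|lborel. iexp ((x - y) * t) * (f t * w t))"
    using fub(1) unfolding inner .
  have "(\<Sum>c\<in>phases. c * (CLINT x|jordan_part \<kappa> c. CLINT t:{R..R'}|lborel. iexp ((x - y) * t) * (f t * w t)))
    = (\<Sum>c\<in>phases. c * (CLINT t|lborel. CLINT x|jordan_part \<kappa> c. F x t))"
    by (simp only: fub(3) flip: inner)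
  also have "\<dots> = (\<Sum>c\<in>phases. (CLINT t|lborel. c * (CLINT x|jordan_part \<kappa> c. F x t)))"
    by (simp only: integral_mult_right_zero)
  also have "\<dots> = (CLINT t|lborel. \<Sum>c\<in>phases. c * (CLINT x|jordan_part \<kappa> c. F x t))"
    by (rule Bochner_Integration.integral_sum[symmetric]) (intro integrable_mult_right fub(2))
  also have "\<dots> = (CLINT t:{R..R'}|lborel. iexp (- (t * y)) * (char chi t * w t))"
    unfolding set_lebesgue_integral_def
  proof (rule Bochner_Integration.integral_cong[OF refl])
    fix t
    have "(\<Sum>c\<in>phases. c * (CLINT x|jordan_part \<kappa> c. F x t))
      = (\<Sum>c\<in>phases. c * (CLINT x|jordan_part \<kappa> c. (iexp (- (t * y)) * B t) * iexp (t * x)))"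
      by (intro sum.cong refl arg_cong2[where f = "(*)"] Bochner_Integration.integral_cong)
        (auto simp: F_def algebra_simps simp flip: exp_add)
    also have "\<dots> = (iexp (- (t * y)) * B t) * cm_char \<kappa> t"
      unfolding cm_char_def cm_integral_eq_sum integral_mult_right_zero sum_distrib_left
      by (intro sum.cong) (auto simp: mult_ac)
    also have "\<dots> = indicator {R..R'} t *\<^sub>R (iexp (- (t * y)) * (char chi t * w t))"
      using factor[of t] R by (auto simp: B_def split: split_indicator)
    finally show "(\<Sum>c\<in>phases. c * (CLINT x|jordan_part \<kappa> c. F x t))
      = indicator {R..R'} t *\<^sub>R (iexp (- (t * y)) * (char chi t * w t))" .
  qed
  finally show "(CLINT t:{R..R'}|lborel. iexp (- (t * y)) * (char chi t * w t))
      = (\<Sum>c\<in>phases. c * (CLINT x|jordan_part \<kappa> c. CLINT t:{R..R'}|lborel. iexp ((x - y) * t) * (f t * w t)))" ..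
qed

lemma tail_bound:
  assumes R: "T0 \<le> R" "R \<le> R'" and w: "continuous_on {R..R'} w"
    and V: "var_le (\<lambda>t. f t * w t) {R..R'} V" and S: "\<And>t. t \<in> {R..R'} \<Longrightarrow> cmod (f t * w t) \<le> S"
    and \<rho>: "0 < \<rho>" "far \<rho> y"
  shows "cmod (CLINT t:{R..R'}|lborel. iexp (- (t * y)) * (char chi t * w t)) \<le> mass * ((2 * S + V) / \<rho>)"
  unfolding superposition[OF R(1) w]
proof (rule norm_sum_parts_le)
  fix c
  show "integrable (jordan_part \<kappa> c) (\<lambda>x. CLINT t:{R..R'}|lborel. iexp ((x - y) * t) * (f t * w t))"
    by (rule integrable_superposition[OF R(1) w])
  show "AE x in jordan_part \<kappa> c. cmod (CLINT t:{R..R'}|lborel. iexp ((x - y) * t) * (f t * w t)) \<le> (2 * S + V) / \<rho>"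
    using AE_jordan_part_discontinuities[OF \<kappa> atomic]
  proof eventually_elim
    case (elim x)
    then have x: "\<rho> \<le> \<bar>x - y\<bar>" using \<rho>(2) by (auto simp: far_def abs_minus_commute)
    have "0 \<le> 2 * S + V"
      using order_trans[OF norm_ge_zero S, of R] var_le_nonneg[OF V] R by auto
    have "cmod (CLINT t:{R..R'}|lborel. iexp ((x - y) * t) * (f t * w t)) \<le> (2 * S + V) / \<bar>x - y\<bar>"
      by (rule oscillatory_integral_bound[OF R(2) _ V S])
        (use x \<rho>(1) R in \<open>auto intro!: continuous_intros w continuous_on_subset[OF f_cont]\<close>)
    also have "\<dots> \<le> (2 * S + V) / \<rho>"
      using x \<rho>(1) \<open>0 \<le> 2 * S + V\<close> by (intro divide_left_mono) auto
    finally show ?case .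
  qed
qed

text \<open>Weights are required to be continuous only for nonnegative arguments, where
  the oscillatory integrals live.\<close>

definition weight :: "real \<Rightarrow> (real \<Rightarrow> complex) \<Rightarrow> bool" where
  "weight W w \<longleftrightarrow> w \<in> borel_measurable borel \<and> continuous_on {0..} w \<and> var_le w {0..} W \<and> (\<forall>t. cmod (w t) \<le> 1)"

abbreviation wtrunc :: "(real \<Rightarrow> complex) \<Rightarrow> real \<Rightarrow> real \<Rightarrow> real" where
  "wtrunc w \<equiv> inv_trunc (\<lambda>t. char chi t * w t)"

lemma weight_one: "weight 0 (\<lambda>_. 1)"
  by (auto simp: weight_def var_le_def)

lemma weighted_char:
  assumes "weight W w"
  shows "(\<lambda>t. char chi t * w t) \<in> borel_measurable borel" "cmod (char chi t * w t) \<le> 1"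
  using assms chi.cmod_char_le_1[of t] mult_mono[of "cmod (char chi t)" 1 "cmod (w t)" 1]
  by (auto simp: weight_def norm_mult)

text \<open>The threshold depends on the weight only through a bound on its variation; this uniformity
  is what permits the interchange of limits.\<close>

lemma uniform_inv_trunc:
  assumes \<rho>: "0 < \<rho>" and W: "0 \<le> W" and e: "0 < e"
  shows "\<exists>R0\<ge>T0. \<forall>R R' w y. R0 \<le> R \<longrightarrow> R \<le> R' \<longrightarrow> weight W w \<longrightarrow> far \<rho> y \<longrightarrow>
    \<bar>wtrunc w R' y - wtrunc w R y\<bar> \<le> e"
proof -
  \<comment> \<open>The variation of the product of amplitude and weight is at most \<open>\<eta> * W + \<eta>\<close>, its supremum at most \<open>\<eta>\<close>.\<close>
  define \<eta> where "\<eta> = e * \<rho> / ((mass + 1) * (3 + W))"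
  have m: "0 \<le> mass" by (rule mass_nonneg)
  have \<eta>: "0 < \<eta>" unfolding \<eta>_def using e \<rho> W m by (intro divide_pos_pos mult_pos_pos) auto
  obtain R1 where R1: "T0 \<le> R1" "var_le f {R1..} \<eta>" using var_le_tail[OF f_var \<eta>] by blast
  have "\<forall>\<^sub>F t in at_top. cmod (f t) < \<eta>"
    using tendstoD[OF f_lim \<eta>] by simp
  then obtain R2 where R2: "\<And>t. R2 \<le> t \<Longrightarrow> cmod (f t) < \<eta>" unfolding eventually_at_top_linorder by blast
  show ?thesis
  proof (intro exI[of _ "max R1 R2"] conjI allI impI)
    show "T0 \<le> max R1 R2" using R1 by simp
    fix R R' w y
    assume R: "max R1 R2 \<le> R" "R \<le> R'" and ww: "weight W w" and y: "far \<rho> y"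
    have w: "continuous_on {0..} w" "var_le w {0..} W" "\<And>t. cmod (w t) \<le> 1"
      using ww by (auto simp: weight_def)
    have R0: "T0 \<le> R" "0 \<le> R" using R R1 T0 by auto
    have "cmod (CLINT t:{R..R'}|lborel. iexp (- (t * y)) * (char chi t * w t)) \<le> mass * ((2 * \<eta> + (\<eta> * W + \<eta> * 1)) / \<rho>)"
    proof (rule tail_bound[OF R0(1) R(2) _ _ _ \<rho> y])
      show "continuous_on {R..R'} w" by (rule continuous_on_subset[OF w(1)]) (use R0 in auto)
      show "var_le (\<lambda>t. f t * w t) {R..R'} (\<eta> * W + \<eta> * 1)"
      proof (rule var_le_mult)
        show "var_le f {R..R'} \<eta>" by (rule var_le_mono[OF R1(2)]) (use R in auto)
        show "var_le w {R..R'} W" by (rule var_le_mono[OF w(2)]) (use R0 in auto)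
        show "cmod (f t) \<le> \<eta>" if "t \<in> {R..R'}" for t using R2[of t] R that by auto
      qed (use \<eta> w in auto)
      fix t assume t: "t \<in> {R..R'}"
      have "cmod (f t) * cmod (w t) \<le> \<eta> * 1"
        using R2[of t] w(3)[of t] t R \<eta> by (intro mult_mono) auto
      then show "cmod (f t * w t) \<le> \<eta>" by (simp add: norm_mult)
    qed
    also have "mass * ((2 * \<eta> + (\<eta> * W + \<eta> * 1)) / \<rho>) = mass / (mass + 1) * e"
      unfolding \<eta>_def using m W \<rho> by (simp add: divide_simps) (simp add: algebra_simps)
    also have "\<dots> \<le> e" using m e by (simp add: divide_le_eq mult_le_cancel_right2)
    finally have "cmod (CLINT t:{R..R'}|lborel. iexp (- (t * y)) * (char chi t * w t)) \<le> e" .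
    then show "\<bar>wtrunc w R' y - wtrunc w R y\<bar> \<le> e"
      by (rule inv_trunc_diff_bound[OF weighted_char[OF ww] R0(2) R(2)])
  qed
qed

definition inv_lim :: "(real \<Rightarrow> complex) \<Rightarrow> real \<Rightarrow> real" where
  "inv_lim w y = lim (\<lambda>n. wtrunc w (real n) y)"

lemma inv_trunc_tendsto:
  assumes w: "weight W w" and W: "0 \<le> W" and \<rho>: "0 < \<rho>" "far \<rho> y"
  shows "(\<lambda>n. wtrunc w (real n) y) \<longlonglongrightarrow> inv_lim w y"
proof -
  have "Cauchy (\<lambda>n. wtrunc w (real n) y)"
  proof (rule CauchyI')
    fix e :: real assume e: "0 < e"
    then have e2: "0 < e / 2" by simp
    obtain R0 where R0: "\<forall>R R' w y. R0 \<le> R \<longrightarrow> R \<le> R' \<longrightarrow> weight W w \<longrightarrow> far \<rho> y \<longrightarrow>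
      \<bar>wtrunc w R' y - wtrunc w R y\<bar> \<le> e / 2"
      using uniform_inv_trunc[OF \<rho>(1) W e2] by blast
    obtain N where N: "R0 \<le> real N" using real_arch_simple by blast
    show "\<exists>N. \<forall>m\<ge>N. \<forall>n>m. dist (wtrunc w (real m) y) (wtrunc w (real n) y) < e"
    proof (intro exI[of _ N] allI impI)
      fix m n assume "N \<le> m" "m < n"
      then show "dist (wtrunc w (real m) y) (wtrunc w (real n) y) < e"
        using R0[rule_format, of "real m" "real n" w y] N w \<rho>(2) e by (simp add: dist_real_def abs_minus_commute)
    qed
  qed
  then show ?thesis unfolding inv_lim_def by (intro convergent_LIMSEQ_iff[THEN iffD1] Cauchy_convergent)
qed

lemma inv_lim_approx:
  assumes \<rho>: "0 < \<rho>" and W: "0 \<le> W" and e: "0 < e"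
  shows "\<exists>R0\<ge>T0. \<forall>R w y. R0 \<le> R \<longrightarrow> weight W w \<longrightarrow> far \<rho> y \<longrightarrow>
    \<bar>inv_lim w y - wtrunc w R y\<bar> \<le> e"
proof -
  obtain R0 where R0: "T0 \<le> R0" "\<forall>R R' w y. R0 \<le> R \<longrightarrow> R \<le> R' \<longrightarrow> weight W w \<longrightarrow> far \<rho> y \<longrightarrow>
      \<bar>wtrunc w R' y - wtrunc w R y\<bar> \<le> e"
    using uniform_inv_trunc[OF \<rho> W e] by blast
  show ?thesis
  proof (intro exI[of _ R0] conjI allI impI R0(1))
    fix R w y assume R: "R0 \<le> R" and w: "weight W w" and y: "far \<rho> y"
    have lim: "(\<lambda>n. \<bar>wtrunc w (real n) y - wtrunc w R y\<bar>)
       \<longlonglongrightarrow> \<bar>inv_lim w y - wtrunc w R y\<bar>"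
      by (intro tendsto_intros inv_trunc_tendsto[OF w W \<rho> y])
    obtain N where N: "R \<le> real N" using real_arch_simple by blast
    show "\<bar>inv_lim w y - wtrunc w R y\<bar> \<le> e"
    proof (rule LIMSEQ_le_const2[OF lim], intro exI[of _ N] allI impI)
      fix n assume "N \<le> n"
      then have "R \<le> real n" using N by simp
      then show "\<bar>wtrunc w (real n) y - wtrunc w R y\<bar> \<le> e"
        using R0(2) R w y by blast
    qed
  qed
qed

lemma uniform_limit_inv_lim:
  assumes w: "weight W w" and W: "0 \<le> W" and \<rho>: "0 < \<rho>" "\<And>y. y \<in> I \<Longrightarrow> far \<rho> y"
  shows "uniform_limit I (\<lambda>n. wtrunc w (real n)) (inv_lim w) sequentially"
proof (rule uniform_limitI)
  fix e :: real assume "0 < e"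
  then have e2: "0 < e / 2" by simp
  obtain R0 where R0: "\<forall>R w y. R0 \<le> R \<longrightarrow> weight W w \<longrightarrow> far \<rho> y \<longrightarrow>
    \<bar>inv_lim w y - wtrunc w R y\<bar> \<le> e / 2"
    using inv_lim_approx[OF \<rho>(1) W e2] by blast
  obtain N where N: "R0 \<le> real N" using real_arch_simple by blast
  show "\<forall>\<^sub>F n in sequentially. \<forall>y\<in>I. dist (wtrunc w (real n) y) (inv_lim w y) < e"
  proof (rule eventually_sequentiallyI[of N], rule ballI)
    fix n y assume "N \<le> n" "y \<in> I"
    then show "dist (wtrunc w (real n) y) (inv_lim w y) < e"
      using R0[rule_format, of "real n" w y] N w \<rho>(2)[of y] \<open>0 < e\<close> by (simp add: dist_real_def abs_minus_commute)
  qed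
qed

lemma continuous_inv_trunc_weight:
  assumes w: "weight W w"
  shows "continuous_on I (wtrunc w T)"
  by (rule continuous_on_subset[OF continuous_on_inv_trunc[where C = 1]]) (use weighted_char[OF w] in auto)

lemma continuous_inv_lim:
  assumes w: "weight W w" and W: "0 \<le> W" and \<rho>: "0 < \<rho>" "\<And>y. y \<in> I \<Longrightarrow> far \<rho> y"
  shows "continuous_on I (inv_lim w)"
  by (rule uniform_limit_theorem[OF _ uniform_limit_inv_lim[OF assms]])
    (auto intro!: always_eventually continuous_inv_trunc_weight[OF w])

lemma integral_inv_trunc_tendsto:
  assumes w: "weight W w" and W: "0 \<le> W" and \<rho>: "0 < \<rho>" "\<And>y. y \<in> {a..b} \<Longrightarrow> far \<rho> y"
  shows "(\<lambda>n. LINT y:{a..b}|lborel. wtrunc w (real n) y) \<longlonglongrightarrow> (LINT y:{a..b}|lborel. inv_lim w y)"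
proof -
  have HK: "(LINT y:{a..b}|lborel. h y) = integral {a..b} h" if "continuous_on {a..b} h" for h :: "real \<Rightarrow> real"
    by (rule set_borel_integral_eq_integral(2)[OF borel_integrable_atLeastAtMost'[OF that]])
  obtain I J where IJ: "\<And>n. (wtrunc w (real n) has_integral I n) {a..b}"
      "(inv_lim w has_integral J) {a..b}" "I \<longlonglongrightarrow> J"
    by (rule uniform_limit_integral[OF uniform_limit_inv_lim[OF assms] continuous_inv_trunc_weight[OF w]]) auto
  show ?thesis
  proof -
    have "continuous_on {a..b} (inv_lim w)" by (rule continuous_inv_lim[OF w W \<rho>(1)]) (rule \<rho>(2))
    then have "(LINT y:{a..b}|lborel. inv_lim w y) = J" using HK integral_unique[OF IJ(2)] by metis
    moreover have "(LINT y:{a..b}|lborel. wtrunc w (real n) y) = I n" for n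
      using HK[OF continuous_inv_trunc_weight[OF w]] integral_unique[OF IJ(1)] by metis
    ultimately show ?thesis using IJ(3) by simp
  qed
qed

text \<open>Both functions are integrable on the interval and, by the inversion formula, have the same
  integrals over its subintervals.\<close>

lemma chi_density_eq_inv_lim:
  assumes f_chi: "has_density chi f_chi" and \<rho>: "0 < \<rho>" "\<And>y. y \<in> {c..d} \<Longrightarrow> far \<rho> y"
  shows "AE x in lborel. x \<in> {c<..d} \<longrightarrow> f_chi x = inv_lim (\<lambda>_. 1) x"
proof -
  have fm[measurable]: "f_chi \<in> borel_measurable borel" and f0: "\<And>x. 0 \<le> f_chi x"
    and dens: "chi = density lborel (\<lambda>x. ennreal (f_chi x))"
    using f_chi by (auto simp: has_density_def)
  have fint: "integrable lborel f_chi"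
  proof (rule integrableI_nonneg)
    have "(\<integral>\<^sup>+x. ennreal (f_chi x) \<partial>lborel) = emeasure chi UNIV" by (subst dens) (simp add: emeasure_density)
    also have "\<dots> = 1" using chi.emeasure_space_1 by simp
    finally show "(\<integral>\<^sup>+x. ennreal (f_chi x) \<partial>lborel) < \<infinity>" by simp
  qed (use f0 in auto)
  have meas: "measure chi A = (LINT x|lborel. f_chi x * indicator A x)" if [measurable]: "A \<in> sets borel" for A
  proof -
    have "emeasure chi A = (\<integral>\<^sup>+x. ennreal (f_chi x * indicator A x) \<partial>lborel)"
      by (subst dens) (auto simp: emeasure_density intro!: nn_integral_cong split: split_indicator)
    also have "\<dots> = ennreal (LINT x|lborel. f_chi x * indicator A x)"
      by (rule nn_integral_eq_integral)
        (auto intro!: Bochner_Integration.integrable_bound[OF fint] simp: f0 split: split_indicator)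
    finally show ?thesis by (simp add: measure_def integral_nonneg_AE f0)
  qed
  have atom: "measure chi {x} = 0" for x
  proof -
    have "(\<integral>\<^sup>+y\<in>{x}. ennreal (f_chi y) \<partial>lborel) = 0"
      by (rule nn_integral_null_set) (simp add: null_sets_def)
    then show ?thesis by (subst dens) (simp add: measure_def emeasure_density)
  qed
  define q where "q = inv_lim (\<lambda>_. 1)"
  have cq: "continuous_on {c..d} q" unfolding q_def by (rule continuous_inv_lim[OF weight_one _ \<rho>]) simp
  define I where "I = {c<..d}"
  have qint: "integrable lborel (\<lambda>x. q x * indicator I x)"
  proof (rule Bochner_Integration.integrable_bound)
    have "set_integrable lborel {c..d} q" by (rule borel_integrable_atLeastAtMost'[OF cq])
    then show int: "integrable lborel (\<lambda>x. indicator {c..d} x * q x)" by (simp add: set_integrable_def)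
    have "(\<lambda>x. (indicator {c..d} x * q x) * indicator I x) \<in> borel_measurable lborel"
      by (rule borel_measurable_times[OF borel_measurable_integrable[OF int]]) (simp add: I_def)
    also have "(\<lambda>x. (indicator {c..d} x * q x) * indicator I x) = (\<lambda>x. q x * indicator I x)"
      by (auto simp: I_def fun_eq_iff split: split_indicator)
    finally show "(\<lambda>x. q x * indicator I x) \<in> borel_measurable lborel" .
  qed (auto simp: I_def split: split_indicator)
  have fIint: "integrable lborel (\<lambda>x. f_chi x * indicator I x)"
    by (rule Bochner_Integration.integrable_bound[OF fint]) (auto simp: I_def split: split_indicator)
  have eqI: "measure chi {a<..b} = (LINT x|lborel. q x * indicator {a<..b} x)" if ab: "c \<le> a" "a \<le> b" "b \<le> d" for a b
  proof (rule LIMSEQ_unique)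
    show "(\<lambda>n. LINT y:{a..b}|lborel. inv_trunc (char chi) (real n) y) \<longlonglongrightarrow> measure chi {a<..b}"
      by (rule chi.Levy_inversion_inv_trunc) (use ab atom in auto)
    have "(\<lambda>n. LINT y:{a..b}|lborel. wtrunc (\<lambda>_. 1) (real n) y) \<longlonglongrightarrow> (LINT y:{a..b}|lborel. q y)"
      unfolding q_def by (rule integral_inv_trunc_tendsto[OF weight_one _ \<rho>(1)]) (use ab \<rho>(2) in auto)
    also have "(LINT y:{a..b}|lborel. q y) = (LINT x|lborel. q x * indicator {a<..b} x)"
      unfolding set_lebesgue_integral_def
    proof (rule integral_cong_AE)
      have 1: "continuous_on {a..b} q" by (rule continuous_on_subset[OF cq]) (use ab in auto)
      then show m: "(\<lambda>x. indicator {a..b} x *\<^sub>R q x) \<in> borel_measurable lborel"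
        using borel_measurable_continuous_on_indicator[of "{a..b}" q] by simp
      have "(\<lambda>x. (indicator {a..b} x *\<^sub>R q x) * indicator {a<..b} x) \<in> borel_measurable lborel"
        using m by (intro borel_measurable_times) auto
      also have "(\<lambda>x. (indicator {a..b} x *\<^sub>R q x) * indicator {a<..b} x) = (\<lambda>x. q x * indicator {a<..b} x)"
        by (auto simp: fun_eq_iff split: split_indicator)
      finally show "(\<lambda>x. q x * indicator {a<..b} x) \<in> borel_measurable lborel" .
      show "AE x in lborel. indicator {a..b} x *\<^sub>R q x = q x * indicator {a<..b} x"
        using AE_lborel_singleton[of a] by eventually_elim (auto split: split_indicator)
    qed
    finally show "(\<lambda>n. LINT y:{a..b}|lborel. inv_trunc (char chi) (real n) y) \<longlonglongrightarrow> (LINT x|lborel. q x * indicator {a<..b} x)"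
      by simp
  qed
  have "AE x in lborel. f_chi x * indicator I x = q x * indicator I x"
  proof (rule density_unique_real[OF fIint qint])
    fix A :: "real set" assume "A \<in> sets lborel"
    then have A: "A \<in> sets borel" by simp
    define \<nu> where "\<nu> A = complex_of_real (LINT x:A|lborel. f_chi x * indicator I x)" for A
    define \<rho>' where "\<rho>' A = complex_of_real (LINT x:A|lborel. q x * indicator I x)" for A
    have sI: "I \<in> sets borel" by (simp add: I_def)
    have \<nu>_eq: "\<nu> A = complex_of_real (measure chi (A \<inter> I))" if "A \<in> sets borel" for A
      unfolding \<nu>_def using that sI
      by (subst meas) (auto simp: set_lebesgue_integral_def intro!: Bochner_Integration.integral_cong split: split_indicator)
    have "\<nu> A = \<rho>' A"
    proof (rule complex_measure_eqI[OF _ _ _ A])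
      show "complex_measure \<nu>" unfolding \<nu>_def by (rule complex_measure_density[OF fIint])
      show "complex_measure \<rho>'" unfolding \<rho>'_def by (rule complex_measure_density[OF qint])
      fix a b :: real assume ab: "a \<le> b"
      have int: "{a<..b} \<inter> I = {max a c<..min b d}" by (auto simp: I_def)
      show "\<nu> {a<..b} = \<rho>' {a<..b}"
      proof (cases "max a c \<le> min b d")
        case True
        have "\<rho>' {a<..b} = complex_of_real (LINT x|lborel. q x * indicator {max a c<..min b d} x)"
          unfolding \<rho>'_def set_lebesgue_integral_def int[symmetric]
          by (intro arg_cong[where f = complex_of_real] Bochner_Integration.integral_cong) (auto split: split_indicator)
        also have "\<dots> = \<nu> {a<..b}"
          using True eqI[of "max a c" "min b d"] by (simp add: \<nu>_eq int)
        finally show ?thesis ..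
      next
        case False
        then have e: "{a<..b} \<inter> I = {}" unfolding int by auto
        then have z: "indicator {a<..b} x *\<^sub>R (q x * indicator I x) = 0" for x
          by (auto split: split_indicator)
        have "\<rho>' {a<..b} = 0" unfolding \<rho>'_def set_lebesgue_integral_def z by simp
        with e show ?thesis by (simp add: \<nu>_eq)
      qed
    qed
    then show "(LINT x:A|lborel. f_chi x * indicator I x) = (LINT x:A|lborel. q x * indicator I x)"
      by (simp only: \<nu>_def \<rho>'_def of_real_eq_iff)
  qed
  then show ?thesis by eventually_elim (auto simp: I_def q_def split: split_indicator_asm)
qed

end

section \<open>The deconvolution density as an inversion integral\<close>

text \<open>Both sides are derivatives of the same function.\<close>

lemma continuous_eq_if_integrals_eq:
  fixes F G :: "real \<Rightarrow> real"
  assumes F: "continuous_on {c..d} F" and G: "continuous_on {c..d} G" and cd: "c < d" and x: "x \<in> {c..d}"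
    and eq: "\<And>u. c \<le> u \<Longrightarrow> u \<le> d \<Longrightarrow> (LINT y:{c..u}|lborel. F y) = (LINT y:{c..u}|lborel. G y)"
  shows "F x = G x"
proof -
  have HK: "(LINT y:{c..u}|lborel. h y) = integral {c..u} h" if "continuous_on {c..d} h" "u \<in> {c..d}" for h :: "real \<Rightarrow> real" and u
    using that by (intro set_borel_integral_eq_integral(2) borel_integrable_atLeastAtMost' continuous_on_subset[OF that(1)]) auto
  have "((\<lambda>u. integral {c..u} F) has_vector_derivative F x) (at x within {c..d})"
    by (rule integral_has_vector_derivative[OF F x])
  moreover have "((\<lambda>u. integral {c..u} F) has_vector_derivative G x) (at x within {c..d})"
  proof (rule has_vector_derivative_transform[OF x _ integral_has_vector_derivative[OF G x]])
    fix u assume "u \<in> {c..d}"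
    then show "integral {c..u} F = integral {c..u} G" using eq[of u] HK[OF F] HK[OF G] by simp
  qed
  ultimately show ?thesis
    using vector_derivative_unique_within_closed_interval[of c d x] cd x by (simp add: cbox_interval)
qed

lemma set_integral_sum_continuous:
  fixes h :: "nat \<Rightarrow> real \<Rightarrow> real"
  assumes "\<And>j. continuous_on {a..b} (h j)"
  shows "(LINT y:{a..b}|lborel. \<Sum>j\<le>m. c j * h j y) = (\<Sum>j\<le>m. c j * (LINT y:{a..b}|lborel. h j y))"
proof -
  have int: "integrable lborel (\<lambda>y. indicator {a..b} y * h j y)" for j
    using borel_integrable_atLeastAtMost'[OF assms] by (simp add: set_integrable_def)
  have "(LINT y:{a..b}|lborel. \<Sum>j\<le>m. c j * h j y) = (LINT y|lborel. (\<Sum>j\<le>m. c j * (indicator {a..b} y * h j y)))"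
    unfolding set_lebesgue_integral_def by (simp add: sum_distrib_left mult_ac)
  also have "\<dots> = (\<Sum>j\<le>m. (LINT y|lborel. c j * (indicator {a..b} y * h j y)))"
    by (rule Bochner_Integration.integral_sum) (intro integrable_mult_right int)
  finally show ?thesis unfolding set_lebesgue_integral_def by simp
qed

text \<open>The bound \<open>W\<close> on the variations does not depend on \<open>m\<close>; this carries the uniformity.\<close>

locale deconvolution = atomic_factorization +
  fixes \<mu>s :: "real measure" and g :: "real \<Rightarrow> real" and V1 W :: real
  assumes \<mu>s: "real_distribution \<mu>s" and g: "has_density (chi \<star> \<mu>s) g" and g_cont: "continuous_on UNIV g"
    and char_real: "\<And>t. Im (char \<mu>s t) = 0" and char_nonneg: "\<And>t. 0 \<le> Re (char \<mu>s t)" and char_le_1: "\<And>t. Re (char \<mu>s t) \<le> 1"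
    and char_var: "var_le (char \<mu>s) {0..} V1" and W: "0 \<le> W"
    and power_var: "\<And>m. var_le (\<lambda>t. (1 - char \<mu>s t) ^ Suc m) {0..} W"
begin

interpretation chi: real_distribution chi by (rule chi)
interpretation \<mu>s: real_distribution \<mu>s by (rule \<mu>s)

lemma char_eq: "char \<mu>s t = complex_of_real (Re (char \<mu>s t))"
  by (simp add: complex_eq_iff char_real)

text \<open>The characteristic function of a convolution power has bounded variation, so the oscillatory
  integral bound controls the truncated inversions away from the origin.\<close>

lemma conv_pow_dominated:
  obtains C where "\<And>A. A \<in> sets borel \<Longrightarrow> emeasure (conv_pow \<mu>s j) (A - {-1<..1}) \<le> ennreal C * emeasure lborel A"
proof -
  interpret D: real_distribution "conv_pow \<mu>s j" by (rule real_distribution_conv_pow[OF \<mu>s])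
  define C where "C = 2 * (2 + real j * V1)"
  have V1: "0 \<le> V1" by (rule var_le_nonneg[OF char_var]) auto
  have "\<bar>inv_trunc (char (conv_pow \<mu>s j)) (real n) y\<bar> \<le> C" if y: "1/2 \<le> \<bar>y\<bar>" for n y
  proof -
    have cp: "char (conv_pow \<mu>s j) t = char \<mu>s t ^ j" for t by (rule char_conv_pow[OF \<mu>s])
    have cont: "continuous_on {0..real n} (\<lambda>t. char \<mu>s t ^ j)"
      by (intro continuous_on_power continuous_at_imp_continuous_on ballI \<mu>s.isCont_char)
    have "cmod (CLINT t:{0..real n}|lborel. iexp (- y * t) * char \<mu>s t ^ j) \<le> (2 * 1 + real j * V1) / \<bar>- y\<bar>"
    proof (rule oscillatory_integral_bound[OF _ cont])
      show "var_le (\<lambda>t. char \<mu>s t ^ j) {0..real n} (real j * V1)"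
        by (rule var_le_mono[OF var_le_power[OF char_var]]) (auto simp: \<mu>s.cmod_char_le_1)
      show "cmod (char \<mu>s t ^ j) \<le> 1" for t by (simp add: norm_power power_le_one \<mu>s.cmod_char_le_1)
    qed (use y in auto)
    also have "\<dots> \<le> (2 * 1 + real j * V1) / (1/2)"
      using y V1 by (intro divide_left_mono) auto
    finally have 1: "cmod (CLINT t:{0..real n}|lborel. iexp (- (t * y)) * char (conv_pow \<mu>s j) t) \<le> C"
      by (simp add: C_def cp mult.commute)
    let ?z = "CLINT t:{0..real n}|lborel. iexp (- (t * y)) * char (conv_pow \<mu>s j) t"
    have "\<bar>Re ?z / pi\<bar> \<le> \<bar>Re ?z\<bar>"
      using pi_gt3 by (simp add: abs_divide divide_le_eq mult_le_cancel_left1)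
    then show ?thesis using 1 abs_Re_le_cmod[of ?z] unfolding inv_trunc_def by linarith
  qed
  then show ?thesis using that D.emeasure_le_lborel by blast
qed

lemma g_nonneg: "0 \<le> g x" and g_measurable: "g \<in> borel_measurable borel" and dens: "(chi \<star> \<mu>s) = density lborel g"
  using g by (auto simp: has_density_def)

lemma g_integrable: "integrable lborel g"
proof (rule integrableI_nonneg)
  interpret D: real_distribution "chi \<star> \<mu>s" by (rule real_distribution_convolution[OF chi \<mu>s])
  have "(\<integral>\<^sup>+x. ennreal (g x) \<partial>lborel) = emeasure (chi \<star> \<mu>s) UNIV"
    unfolding dens using g_measurable by (simp add: emeasure_density)
  also have "\<dots> = 1" using D.emeasure_space_1 by simp
  finally show "(\<integral>\<^sup>+x. ennreal (g x) \<partial>lborel) < \<infinity>" by simp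
qed (use g_nonneg g_measurable in auto)

lemma
  shows integrable_g: "integrable (conv_pow \<mu>s j) (\<lambda>x. g (y - x))"
    and continuous_h: "continuous_on UNIV (conv_fun (conv_pow \<mu>s j) g)"
    and measure_h_singleton: "measure ((chi \<star> \<mu>s) \<star> conv_pow \<mu>s j) {a} = 0"
    and measure_h_Ioc: "measure ((chi \<star> \<mu>s) \<star> conv_pow \<mu>s j) {a<..b} = (LINT z:{a..b}|lborel. conv_fun (conv_pow \<mu>s j) g z)"
proof -
  obtain C where C: "\<And>A. A \<in> sets borel \<Longrightarrow> emeasure (conv_pow \<mu>s j) (A - {-1<..1}) \<le> ennreal C * emeasure lborel A"
    using conv_pow_dominated by blast
  note facts = real_distribution_conv_pow[OF \<mu>s] C g_cont g_nonneg g_integrable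
  show "integrable (conv_pow \<mu>s j) (\<lambda>x. g (y - x))" by (rule integrable_conv[OF facts])
  show "continuous_on UNIV (conv_fun (conv_pow \<mu>s j) g)" by (rule continuous_conv_fun[OF facts])
  show "measure ((chi \<star> \<mu>s) \<star> conv_pow \<mu>s j) {a} = 0"
    unfolding dens by (rule measure_convolution_singleton[OF facts])
  show "measure ((chi \<star> \<mu>s) \<star> conv_pow \<mu>s j) {a<..b} = (LINT z:{a..b}|lborel. conv_fun (conv_pow \<mu>s j) g z)"
    unfolding dens by (rule measure_convolution_Ioc[OF facts])
qed

definition deconv_weight :: "nat \<Rightarrow> real \<Rightarrow> complex" where
  "deconv_weight m t = 1 - (1 - char \<mu>s t) ^ Suc m"

lemma weight_deconv: "weight W (deconv_weight m)"
  unfolding weight_def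
proof (intro conjI allI)
  show "deconv_weight m \<in> borel_measurable borel" unfolding deconv_weight_def by measurable
  show "continuous_on {0..} (deconv_weight m)"
    unfolding deconv_weight_def
    by (intro continuous_intros continuous_at_imp_continuous_on ballI \<mu>s.isCont_char)
  show "var_le (deconv_weight m) {0..} W"
    unfolding deconv_weight_def by (rule var_le_one_minus[OF power_var])
  fix t
  define p where "p = Re (char \<mu>s t)"
  have p: "0 \<le> p" "p \<le> 1" using char_nonneg char_le_1 by (auto simp: p_def)
  have "deconv_weight m t = complex_of_real (1 - (1 - p) ^ Suc m)"
    unfolding deconv_weight_def by (subst char_eq) (simp add: p_def)
  moreover have "0 \<le> (1 - p) ^ Suc m" "(1 - p) ^ Suc m \<le> 1" using p by (auto intro!: power_le_one simp del: power_Suc)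
  ultimately show "cmod (deconv_weight m t) \<le> 1" by (simp only: norm_of_real)
qed

lemma far_mono: "far \<rho> \<xi> \<Longrightarrow> \<bar>y - \<xi>\<bar> \<le> \<rho> / 2 \<Longrightarrow> far (\<rho> / 2) y"
  unfolding far_def by (smt (verit) field_sum_of_halves)

text \<open>Both sides are continuous near \<open>\<xi>\<close> and have the same integrals over small intervals.\<close>

lemma deconv_density_eq_inv_lim:
  assumes \<rho>: "0 < \<rho>" "far \<rho> \<xi>"
  shows "deconv_density \<mu>s g \<xi> m = complex_of_real (inv_lim (deconv_weight m) \<xi>)"
proof -
  obtain a :: "nat \<Rightarrow> real" where expansion:
    "\<forall>A\<in>sets borel. (\<Sum>l\<le>m. cm_conv_power (pi_measure \<mu>s) l A) = (\<Sum>j\<le>m. complex_of_real (a j) * measure (conv_pow \<mu>s j) A)"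
    "\<forall>z::complex. (\<Sum>j\<le>m. complex_of_real (a j) * z ^ Suc j) = 1 - (1 - z) ^ Suc m"
    using sum_conv_power_expansion[OF \<mu>s, of m] by blast
  note a = expansion(1)[rule_format] and az = expansion(2)[rule_format]
  let ?h = "\<lambda>j. conv_fun (conv_pow \<mu>s j) g" and ?w = "deconv_weight m"
  define M where "M j = ((chi \<star> \<mu>s) \<star> conv_pow \<mu>s j)" for j
  have M: "real_distribution (M j)" for j
    unfolding M_def by (intro real_distribution_convolution real_distribution_conv_pow chi \<mu>s)
  have charM: "char (M j) t = char chi t * char \<mu>s t ^ Suc j" for j t
    unfolding M_def by (simp add: char_convolution char_conv_pow real_distribution_convolution real_distribution_conv_pow chi \<mu>s)
  have trunc: "wtrunc ?w T y = (\<Sum>j\<le>m. a j * inv_trunc (char (M j)) T y)" for T y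
  proof -
    have "(\<lambda>t. char chi t * ?w t) = (\<lambda>t. \<Sum>j\<le>m. complex_of_real (a j) * char (M j) t)"
    proof
      fix t
      have "(\<Sum>j\<le>m. complex_of_real (a j) * char (M j) t) = char chi t * (\<Sum>j\<le>m. complex_of_real (a j) * char \<mu>s t ^ Suc j)"
        by (simp add: charM sum_distrib_left mult_ac)
      then show "char chi t * ?w t = (\<Sum>j\<le>m. complex_of_real (a j) * char (M j) t)"
        unfolding az deconv_weight_def by (rule sym)
    qed
    then show ?thesis
      using inv_trunc_sum[of "{..m}" "\<lambda>j. char (M j)" a T y]
      by (simp add: real_distribution.char_measurable[OF M] real_distribution.cmod_char_le_1[OF M])
  qed
  define r where "r = \<rho> / 2"
  have r: "0 < r" using \<rho> by (simp add: r_def)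
  have far: "far r y" if "y \<in> {\<xi> - r..\<xi> + r}" for y
    unfolding r_def by (rule far_mono[OF \<rho>(2)]) (use that in \<open>unfold r_def atLeastAtMost_iff, linarith\<close>)
  have "(\<Sum>j\<le>m. a j * ?h j \<xi>) = inv_lim ?w \<xi>"
  proof (rule continuous_eq_if_integrals_eq[of "\<xi> - r" "\<xi> + r" "\<lambda>y. \<Sum>j\<le>m. a j * ?h j y" "inv_lim ?w" \<xi>])
    show "continuous_on {\<xi> - r..\<xi> + r} (\<lambda>y. \<Sum>j\<le>m. a j * ?h j y)"
      by (intro continuous_intros continuous_on_subset[OF continuous_h]) auto
    show "continuous_on {\<xi> - r..\<xi> + r} (inv_lim ?w)"
      by (rule continuous_inv_lim[OF weight_deconv W r far])
    fix u assume u: "\<xi> - r \<le> u" "u \<le> \<xi> + r"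
    let ?c = "\<xi> - r"
    show "(LINT y:{?c..u}|lborel. \<Sum>j\<le>m. a j * ?h j y) = (LINT y:{?c..u}|lborel. inv_lim ?w y)"
    proof (rule LIMSEQ_unique)
      show "(\<lambda>n. LINT y:{?c..u}|lborel. wtrunc ?w (real n) y) \<longlonglongrightarrow> (LINT y:{?c..u}|lborel. inv_lim ?w y)"
        by (rule integral_inv_trunc_tendsto[OF weight_deconv W r far]) (use u in auto)
      have "(\<lambda>n. \<Sum>j\<le>m. a j * (LINT y:{?c..u}|lborel. inv_trunc (char (M j)) (real n) y)) \<longlonglongrightarrow> (\<Sum>j\<le>m. a j * measure (M j) {?c<..u})"
        by (intro tendsto_intros real_distribution.Levy_inversion_inv_trunc[OF M])
          (use u measure_h_singleton in \<open>auto simp: M_def\<close>)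
      moreover have "(LINT y:{?c..u}|lborel. wtrunc ?w (real n) y)
        = (\<Sum>j\<le>m. a j * (LINT y:{?c..u}|lborel. inv_trunc (char (M j)) (real n) y))" for n
        unfolding trunc
        by (rule set_integral_sum_continuous, rule continuous_on_subset[OF continuous_on_inv_trunc[where C = 1]])
          (auto simp: real_distribution.char_measurable[OF M] real_distribution.cmod_char_le_1[OF M])
      moreover have "(LINT y:{?c..u}|lborel. \<Sum>j\<le>m. a j * ?h j y) = (\<Sum>j\<le>m. a j * measure (M j) {?c<..u})"
        unfolding M_def measure_h_Ioc
        by (rule set_integral_sum_continuous) (rule continuous_on_subset[OF continuous_h], simp)
      ultimately show "(\<lambda>n. LINT y:{?c..u}|lborel. wtrunc ?w (real n) y) \<longlonglongrightarrow> (LINT y:{?c..u}|lborel. \<Sum>j\<le>m. a j * ?h j y)"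
        by simp
    qed
  qed (use r in auto)
  then show ?thesis
    by (subst deconv_density_eq_sum[OF \<mu>s a g_measurable integrable_g]) (simp only: refl)+
qed

end

section \<open>The limiting terms as inversion integrals\<close>

lemma var_le_comp_max:
  assumes "var_le f {T0..} V"
  shows "var_le (\<lambda>u. f (max T0 u)) UNIV V"
  unfolding var_le_def
proof (intro allI impI, elim conjE)
  fix n :: nat and t :: "nat \<Rightarrow> real" assume t: "\<forall>i\<le>n. t i \<in> UNIV" "\<forall>i<n. t i \<le> t (Suc i)"
  show "(\<Sum>i<n. cmod (f (max T0 (t (Suc i))) - f (max T0 (t i)))) \<le> V"
    by (rule var_leD[OF assms, of n "\<lambda>i. max T0 (t i)"]) (use t in \<open>auto intro: max.mono\<close>)
qed

context atomic_factorization
begin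

interpretation chi: real_distribution chi by (rule chi)

text \<open>The constant continuation to the left of \<open>T0\<close>, whose Stieltjes measure appears in the limiting terms.\<close>

definition f_ext :: "real \<Rightarrow> complex" where "f_ext u = f (max T0 u)"

lemma f_ext_stieltjes_ex: "\<exists>\<nu>. complex_measure \<nu> \<and> (\<forall>a b. a \<le> b \<longrightarrow> \<nu> {a<..b} = f_ext b - f_ext a)"
proof (rule stieltjes_measure_exists)
  show "var_le f_ext UNIV V0" using var_le_comp_max[OF f_var] by (simp add: f_ext_def[abs_def])
  have "continuous_on UNIV f_ext"
    unfolding f_ext_def[abs_def] by (rule continuous_on_compose2[OF f_cont]) (auto intro!: continuous_intros)
  then show "continuous (at_right x) f_ext" for x
    by (meson UNIV_I continuous_at_imp_continuous_within continuous_on_eq_continuous_at open_UNIV)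
qed

lemma stieltjes_f_ext_Ioi:
  assumes "T0 \<le> t"
  shows "stieltjes f_ext {t<..} = - f t"
proof -
  have lim: "(f_ext \<longlongrightarrow> 0) at_top"
  proof (rule Lim_transform_eventually[OF f_lim])
    show "\<forall>\<^sub>F u in at_top. f u = f_ext u"
      using eventually_ge_at_top[of T0] by eventually_elim (simp add: f_ext_def max_def)
  qed
  show ?thesis using stieltjes_Ioi[OF f_ext_stieltjes_ex lim, of t] assms by (simp add: f_ext_def[of t] max_def)
qed

text \<open>Integration by parts: the Stieltjes integral of the primitive of an oscillation is, up to sign,
  the improper integral of the oscillation against the function itself.\<close>

lemma stieltjes_oscillation_limit:
  assumes M: "T0 \<le> M" and v: "v \<noteq> 0"
  shows "(\<lambda>n. (CLINT t:{M..real n}|lborel. iexp (v * t) * f t) / pi) \<longlonglongrightarrow>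
    cm_integral (stieltjes f_ext) (\<lambda>u. indicator {M..} u * ((iexp (v * M) - iexp (v * u)) / (\<i> * pi * v)))"
proof -
  define \<nu> where "\<nu> = stieltjes f_ext"
  have \<nu>: "complex_measure \<nu>" unfolding \<nu>_def by (rule complex_measure_stieltjes[OF f_ext_stieltjes_ex])
  have fm: "finite_measure (jordan_part \<nu> c)" for c by (rule finite_measure_jordan_part[OF \<nu>])
  have sf: "sigma_finite_measure (jordan_part \<nu> c)" for c by (rule finite_measure.sigma_finite_measure[OF fm])
  \<comment> \<open>Written with a truncation at \<open>n\<close>, the primitive is a genuine integral, to which the theorem of Fubini applies.\<close>
  define E where "E n u t = indicator {M..real n} t *\<^sub>R (if t < u then iexp (v * t) else 0)" for n :: nat and u t :: real
  have Em: "(\<lambda>(u, t). E n u t) \<in> borel_measurable (borel \<Otimes>\<^sub>M borel)" for n unfolding E_def by measurable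
  have Ele: "norm (E n u t) \<le> 1 * indicator {M..real n} t" for n u t by (auto simp: E_def split: split_indicator)
  have i1: "integrable (jordan_part \<nu> c) (\<lambda>_. 1 :: real)" for c
    using finite_measure.integrable_const[OF fm] .
  note fub = integrable_fubini_dominated1[OF sf sets_jordan_part i1 integrable_indicator_Icc Em Ele]
     integrable_fubini_dominated2[OF sf sets_jordan_part i1 integrable_indicator_Icc Em Ele]
     fubini_dominated[OF sf sets_jordan_part i1 integrable_indicator_Icc Em Ele]
  define G where "G n u = (CLINT t|lborel. E n u t)" for n u
  have G_eq: "G n u = (CLINT t:{M..min u (real n)}|lborel. iexp (v * t) * 1)" for n u
    unfolding G_def set_lebesgue_integral_def
  proof (rule integral_cong_AE)
    show "AE t in lborel. E n u t = indicator {M..min u (real n)} t *\<^sub>R (iexp (v * t) * 1)"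
      using AE_lborel_singleton[of u] by eventually_elim (auto simp: E_def split: split_indicator)
    show "E n u \<in> borel_measurable lborel" unfolding E_def by measurable
  qed auto
  have G_le: "cmod (G n u) \<le> 2 / \<bar>v\<bar>" for n u
  proof (cases "M \<le> min u (real n)")
    case True
    have "cmod (CLINT t:{M..min u (real n)}|lborel. iexp (v * t) * 1) \<le> (2 * 1 + 0) / \<bar>v\<bar>"
      by (rule oscillatory_integral_bound[OF True _ _ _ v]) (auto simp: var_le_def)
    then show ?thesis by (simp add: G_eq)
  next
    case False
    then show ?thesis by (simp add: G_eq set_lebesgue_integral_def)
  qed
  define L where "L u = indicator {M..} u * ((iexp (v * u) - iexp (v * M)) / (\<i> * v))" for u
  have G_lim: "(\<lambda>n. G n u) \<longlonglongrightarrow> L u" for u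
  proof (rule tendsto_eventually)
    obtain N where N: "u \<le> real N" using real_arch_simple by blast
    show "\<forall>\<^sub>F n in sequentially. G n u = L u"
    proof (rule eventually_sequentiallyI[of N])
      fix n assume "N \<le> n"
      then have n: "min u (real n) = u" using N by simp
      show "G n u = L u"
      proof (cases "M \<le> u")
        case True
        have e: "iexp (v * t) * 1 = iexp (- (- v * t))" for t by simp
        have "G n u = (iexp (- (- v * M)) - iexp (- (- v * u))) / (\<i> * complex_of_real (- v))"
          unfolding G_eq n e by (rule iexp_integral[OF True]) (use v in simp)
        also have "\<dots> = (iexp (v * u) - iexp (v * M)) / (\<i> * v)"
          using v by (simp add: field_simps)
        finally show ?thesis using True by (simp add: L_def)
      next
        case False
        then show ?thesis unfolding G_eq n by (simp add: L_def set_lebesgue_integral_def)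
      qed
    qed
  qed
  have Lm: "L \<in> borel_measurable borel" unfolding L_def by measurable
  have lim: "(\<lambda>n. \<Sum>c\<in>phases. c * (CLINT u|jordan_part \<nu> c. G n u)) \<longlonglongrightarrow> (\<Sum>c\<in>phases. c * (CLINT u|jordan_part \<nu> c. L u))"
  proof (intro tendsto_sum tendsto_mult tendsto_const)
    fix c
    show "(\<lambda>n. CLINT u|jordan_part \<nu> c. G n u) \<longlonglongrightarrow> (CLINT u|jordan_part \<nu> c. L u)"
    proof (rule integral_dominated_convergence[where w = "\<lambda>_. 2 / \<bar>v\<bar>"])
      show "integrable (jordan_part \<nu> c) (\<lambda>_. 2 / \<bar>v\<bar>)" by (rule finite_measure.integrable_const[OF fm])
      show "G n \<in> borel_measurable (jordan_part \<nu> c)" for n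
        unfolding G_def by (rule borel_measurable_integrable[OF fub(1)])
      show "L \<in> borel_measurable (jordan_part \<nu> c)" using Lm by simp
    qed (use G_lim G_le in auto)
  qed
  have Gsum: "(\<Sum>c\<in>phases. c * (CLINT u|jordan_part \<nu> c. G n u)) = - (CLINT t:{M..real n}|lborel. iexp (v * t) * f t)" for n
  proof -
    have "(\<Sum>c\<in>phases. c * (CLINT u|jordan_part \<nu> c. G n u)) = (\<Sum>c\<in>phases. (CLINT t|lborel. c * (CLINT u|jordan_part \<nu> c. E n u t)))"
      unfolding G_def fub(3) by (simp only: integral_mult_right_zero)
    also have "\<dots> = (CLINT t|lborel. \<Sum>c\<in>phases. c * (CLINT u|jordan_part \<nu> c. E n u t))"
      by (rule Bochner_Integration.integral_sum[symmetric]) (intro integrable_mult_right fub(2))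
    also have "\<dots> = (CLINT t|lborel. - (indicator {M..real n} t *\<^sub>R (iexp (v * t) * f t)))"
    proof (rule Bochner_Integration.integral_cong[OF refl])
      fix t
      define z where "z = indicator {M..real n} t *\<^sub>R iexp (v * t)"
      have inner: "(CLINT u|jordan_part \<nu> c. E n u t) = z * complex_of_real (measure (jordan_part \<nu> c) {t<..})" for c
      proof -
        have "(CLINT u|jordan_part \<nu> c. E n u t) = (CLINT u|jordan_part \<nu> c. z * complex_of_real (indicator {t<..} u))"
          by (rule Bochner_Integration.integral_cong) (auto simp: E_def z_def split: split_indicator)
        then show ?thesis by (simp only: integral_mult_right_zero integral_complex_of_real) simp
      qed
      have "(\<Sum>c\<in>phases. c * (CLINT u|jordan_part \<nu> c. E n u t)) = (\<Sum>c\<in>phases. z * (c * complex_of_real (measure (jordan_part \<nu> c) {t<..})))"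
        by (rule sum.cong) (simp_all only: inner mult.left_commute)
      also have "\<dots> = z * \<nu> {t<..}"
        by (simp add: complex_measure_eq_sum[OF \<nu>, of "{t<..}"] sum_distrib_left)
      also have "\<dots> = - (indicator {M..real n} t *\<^sub>R (iexp (v * t) * f t))"
        using stieltjes_f_ext_Ioi[of t] M by (auto simp: \<nu>_def z_def split: split_indicator)
      finally show "(\<Sum>c\<in>phases. c * (CLINT u|jordan_part \<nu> c. E n u t)) = - (indicator {M..real n} t *\<^sub>R (iexp (v * t) * f t))" .
    qed
    finally show ?thesis unfolding set_lebesgue_integral_def by simp
  qed
  have target: "cm_integral \<nu> (\<lambda>u. indicator {M..} u * ((iexp (v * M) - iexp (v * u)) / (\<i> * pi * v)))
    = - (\<Sum>c\<in>phases. c * (CLINT u|jordan_part \<nu> c. L u)) / pi"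
  proof -
    have "(\<lambda>u. indicator {M..} u * ((iexp (v * M) - iexp (v * u)) / (\<i> * pi * v))) = (\<lambda>u. (- 1 / pi) * L u)"
      using v by (auto simp: fun_eq_iff L_def divide_simps split: split_indicator)
    then have "cm_integral \<nu> (\<lambda>u. indicator {M..} u * ((iexp (v * M) - iexp (v * u)) / (\<i> * pi * v)))
      = (\<Sum>c\<in>phases. c * ((- 1 / pi) * (CLINT u|jordan_part \<nu> c. L u)))"
      unfolding cm_integral_eq_sum by (simp only: integral_mult_right_zero)
    also have "\<dots> = - (\<Sum>c\<in>phases. c * (CLINT u|jordan_part \<nu> c. L u)) / pi"
      by (simp add: sum_divide_distrib sum_negf)
    finally show ?thesis .
  qed
  have "(\<lambda>n. - (\<Sum>c\<in>phases. c * (CLINT u|jordan_part \<nu> c. G n u)) / pi) \<longlonglongrightarrow> - (\<Sum>c\<in>phases. c * (CLINT u|jordan_part \<nu> c. L u)) / pi"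
    by (intro tendsto_intros lim) auto
  then show ?thesis unfolding \<nu>_def[symmetric] target Gsum minus_minus .
qed

text \<open>The limit of the inner integrals is carried through the integral against \<open>\<kappa>\<close> by dominated
  convergence; the bound is available at the atoms, which keep distance \<open>\<rho>\<close> from \<open>\<xi>\<close>.\<close>

lemma theta_limit:
  assumes \<phi>: "\<And>u. f (max T0 u) = \<phi> (ereal (max T0 u))" and \<rho>: "0 < \<rho>" "far \<rho> \<xi>"
  shows "(\<lambda>n. (CLINT t:{max T0 r..real n}|lborel. iexp (- (t * \<xi>)) * char chi t) / pi) \<longlonglongrightarrow> theta T0 \<kappa> \<phi> r (- \<xi>)"
proof -
  define M where "M = max T0 r"
  have M: "T0 \<le> M" by (simp add: M_def)
  have st: "stieltjes (\<lambda>u. \<phi> (ereal (max T0 u))) = stieltjes f_ext" by (simp add: f_ext_def[abs_def] \<phi>)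
  define h where "h x = cm_integral (stieltjes f_ext)
    (\<lambda>u. indicator {M..} u * ((iexp ((x - \<xi>) * M) - iexp ((x - \<xi>) * u)) / (\<i> * pi * (x - \<xi>))))" for x
  have theta: "theta T0 \<kappa> \<phi> r (- \<xi>) = cm_integral \<kappa> h"
    unfolding theta_def st M_def[symmetric] h_def by simp
  define I where "I n x = (CLINT t:{M..real n}|lborel. iexp ((x - \<xi>) * t) * (f t * 1))" for n x
  \<comment> \<open>At \<open>x = \<xi>\<close> the integrand of \<open>theta\<close> vanishes by the convention on division by zero; setting the truncated integrals to zero there makes the convergence hold at every point, so that the limit is measurable.\<close>
  define H where "H n x = (if x = \<xi> then 0 else I n x / pi)" for n x
  have I_int: "integrable (jordan_part \<kappa> c) (I n)" for c n
    unfolding I_def by (rule integrable_superposition[OF M]) simp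
  have H_meas: "H n \<in> borel_measurable (jordan_part \<kappa> c)" for c n
    unfolding H_def
    by (rule measurable_If) (auto intro!: borel_measurable_divide borel_measurable_integrable[OF I_int])
  have H_lim: "(\<lambda>n. H n x) \<longlonglongrightarrow> h x" for x
  proof (cases "x = \<xi>")
    case True
    then show ?thesis by (simp add: H_def h_def cm_integral_eq_sum)
  next
    case False
    then show ?thesis using stieltjes_oscillation_limit[OF M, of "x - \<xi>"] by (simp add: H_def h_def I_def)
  qed
  have h_meas: "h \<in> borel_measurable (jordan_part \<kappa> c)" for c
    by (rule borel_measurable_LIMSEQ_metric[OF H_meas]) (rule H_lim)
  define B where "B = (2 * (cmod (f T0) + V0) + V0) / \<rho>"
  have V0: "0 \<le> V0" by (rule var_le_nonneg[OF f_var]) auto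
  have H_bound: "AE x in jordan_part \<kappa> c. cmod (H n x) \<le> B" for c n
    using AE_jordan_part_discontinuities[OF \<kappa> atomic]
  proof eventually_elim
    case (elim x)
    then have x: "\<rho> \<le> \<bar>x - \<xi>\<bar>" using \<rho>(2) by (auto simp: far_def abs_minus_commute)
    have B0: "0 \<le> B" using V0 \<rho> by (simp add: B_def)
    have Ib: "cmod (I n x) \<le> B"
    proof (cases "M \<le> real n")
      case True
      have "cmod (I n x) \<le> (2 * (cmod (f T0) + V0) + V0) / \<bar>x - \<xi>\<bar>"
        unfolding I_def
      proof (rule oscillatory_integral_bound[OF True])
        show "continuous_on {M..real n} (\<lambda>t. f t * 1)"
          using M by (auto intro!: continuous_on_subset[OF f_cont])
        show "var_le (\<lambda>t. f t * 1) {M..real n} V0"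
          using M by (auto intro!: var_le_mono[OF f_var])
        show "cmod (f t * 1) \<le> cmod (f T0) + V0" if "t \<in> {M..real n}" for t
          using var_le_dist[OF f_var, of T0 t] norm_triangle_sub[of "f t" "f T0"] that M by simp
      qed (use x \<rho> in auto)
      also have "\<dots> \<le> B" unfolding B_def using x \<rho> V0 by (intro divide_left_mono) auto
      finally show ?thesis .
    next
      case False
      then show ?thesis using B0 by (simp add: I_def set_lebesgue_integral_def)
    qed
    have "cmod (I n x / pi) \<le> cmod (I n x)"
      using pi_gt3 by (simp add: norm_divide divide_le_eq mult_le_cancel_left1)
    then show ?case using Ib B0 by (auto simp: H_def)
  qed
  have "(\<lambda>n. \<Sum>c\<in>phases. c * (CLINT x|jordan_part \<kappa> c. H n x)) \<longlonglongrightarrow> (\<Sum>c\<in>phases. c * (CLINT x|jordan_part \<kappa> c. h x))"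
  proof (intro tendsto_sum tendsto_mult tendsto_const)
    fix c
    show "(\<lambda>n. CLINT x|jordan_part \<kappa> c. H n x) \<longlonglongrightarrow> (CLINT x|jordan_part \<kappa> c. h x)"
      by (rule integral_dominated_convergence[where w = "\<lambda>_. B"])
        (use H_meas h_meas H_lim H_bound finite_measure.integrable_const[OF finite_measure_jordan_part[OF \<kappa>]] in auto)
  qed
  moreover have "(\<Sum>c\<in>phases. c * (CLINT x|jordan_part \<kappa> c. H n x)) = (CLINT t:{M..real n}|lborel. iexp (- (t * \<xi>)) * char chi t) / pi" for n
  proof -
    have "(CLINT x|jordan_part \<kappa> c. H n x) = (CLINT x|jordan_part \<kappa> c. I n x / pi)" for c
    proof (rule integral_cong_AE)
      show "AE x in jordan_part \<kappa> c. H n x = I n x / pi"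
        using AE_jordan_part_discontinuities[OF \<kappa> atomic]
        by eventually_elim (use \<rho> in \<open>auto simp: H_def far_def\<close>)
    qed (use H_meas I_int in \<open>auto intro!: borel_measurable_divide\<close>)
    then have "(\<Sum>c\<in>phases. c * (CLINT x|jordan_part \<kappa> c. H n x)) = (\<Sum>c\<in>phases. c * (CLINT x|jordan_part \<kappa> c. I n x)) / pi"
      by (simp add: sum_divide_distrib)
    also have "(\<Sum>c\<in>phases. c * (CLINT x|jordan_part \<kappa> c. I n x)) = (CLINT t:{M..real n}|lborel. iexp (- (t * \<xi>)) * (char chi t * 1))"
      unfolding I_def by (rule superposition[OF M, symmetric]) simp
    finally show ?thesis by simp
  qed
  ultimately show ?thesis unfolding theta cm_integral_eq_sum M_def[symmetric] by simp
qed

lemma integrable_oscillation: "integrable lborel (\<lambda>t. indicator {a..b} t *\<^sub>R (iexp (- (t * \<xi>)) * char chi t))"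
  by (rule integrable_indicator_bounded[where C = 1]) (auto simp: norm_mult chi.cmod_char_le_1)

lemma fourier_psi_eq:
  assumes r: "0 \<le> r"
  shows "fourier (psi chi T0 r) (- \<xi>) = complex_of_real (Re (CLINT t:{r..T0}|lborel. iexp (- (t * \<xi>)) * char chi t) / pi)"
proof -
  define A where "A = {t. r \<le> \<bar>t\<bar> \<and> \<bar>t\<bar> \<le> T0}"
  have [measurable]: "A \<in> sets borel"
  proof -
    have "A = {-T0..-r} \<union> {r..T0}" using r by (auto simp: A_def)
    then show ?thesis by simp
  qed
  define h where "h t = indicator {-T0..T0} t *\<^sub>R (iexp (- \<xi> * t) * (indicator A t * char chi t))" for t
  have h: "integrable lborel h"
    unfolding h_def by (rule integrable_indicator_bounded[where C = 1])
      (auto simp: norm_mult chi.cmod_char_le_1 split: split_indicator)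
  have herm: "h (- t) = cnj (h t)" for t
    by (auto simp: h_def A_def char_uminus exp_cnj split: split_indicator)
  have "fourier (psi chi T0 r) (- \<xi>) = (CLINT t|lborel. (1 / (2 * pi)) * h t)"
    unfolding fourier_def
    by (rule Bochner_Integration.integral_cong) (auto simp: psi_def h_def A_def abs_le_iff split: split_indicator)
  also have "\<dots> = (1 / (2 * pi)) * (CLINT t|lborel. h t)" by (rule integral_mult_right_zero)
  also have "(CLINT t|lborel. h t) = complex_of_real (2 * Re (CLINT t|lborel. indicator {0..} t * h t))"
    by (rule integral_hermitian[OF h herm])
  also have "(CLINT t|lborel. indicator {0..} t * h t) = (CLINT t:{r..T0}|lborel. iexp (- (t * \<xi>)) * char chi t)"
    unfolding set_lebesgue_integral_def
    by (rule Bochner_Integration.integral_cong)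
      (use r in \<open>auto simp: h_def A_def mult.commute split: split_indicator\<close>)
  finally show ?thesis by simp
qed

text \<open>Below \<open>T0\<close> the limiting term is an ordinary Fourier integral, beyond \<open>T0\<close> it is \<open>theta\<close>; together they
  form one improper integral starting at \<open>\<tau>\<close>.  For \<open>\<tau> = \<infinity>\<close> both sides vanish.\<close>

lemma fourier_psi0_limit:
  assumes \<phi>: "\<And>u. f (max T0 u) = \<phi> (ereal (max T0 u))" and \<rho>: "0 < \<rho>" "far \<rho> \<xi>" and \<tau>: "0 \<le> \<tau>"
  shows "(\<lambda>n. complex_of_real (inv_trunc (\<lambda>t. indicator {t. \<tau> \<le> ereal t} t * char chi t) (real n) \<xi>))
    \<longlonglongrightarrow> fourier_psi0 chi T0 \<kappa> \<phi> \<tau> (- \<xi>)"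
proof (cases \<tau>)
  case PInf
  then have "indicator {t. \<tau> \<le> ereal t} t = (0 :: complex)" for t by (simp add: indicator_def)
  then show ?thesis by (simp add: PInf fourier_psi0_def inv_trunc_def set_lebesgue_integral_def)
next
  case MInf
  then show ?thesis using \<tau> by simp
next
  case (real r)
  then have r: "0 \<le> r" using \<tau> by simp
  define I where "I a b = (CLINT t:{a..b}|lborel. iexp (- (t * \<xi>)) * char chi t)" for a b :: real
  have split: "inv_trunc (\<lambda>t. indicator {t. \<tau> \<le> ereal t} t * char chi t) (real n) \<xi>
      = (if r < T0 then Re (I r T0) / pi else 0) + Re (I (max T0 r) (real n) / pi)"
    if n: "max T0 r \<le> real n" for n
  proof -
    let ?h = "\<lambda>a b t. indicator {a..b} t *\<^sub>R (iexp (- (t * \<xi>)) * char chi t)"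
    define X where "X t = (if r < T0 then ?h r T0 t else 0)" for t
    have X: "integrable lborel X" unfolding X_def using integrable_oscillation by (cases "r < T0") auto
    have "(CLINT t:{0..real n}|lborel. iexp (- (t * \<xi>)) * (indicator {t. \<tau> \<le> ereal t} t * char chi t))
      = (CLINT t|lborel. X t + ?h (max T0 r) (real n) t)"
      unfolding set_lebesgue_integral_def
    proof (rule integral_cong_AE)
      show "AE t in lborel. indicator {0..real n} t *\<^sub>R (iexp (- (t * \<xi>)) * (indicator {t. \<tau> \<le> ereal t} t * char chi t))
        = X t + ?h (max T0 r) (real n) t"
        using AE_lborel_singleton[of T0]
        by eventually_elim (use r n T0 in \<open>auto simp: X_def real split: split_indicator\<close>)
      show "(\<lambda>t. X t + ?h (max T0 r) (real n) t) \<in> borel_measurable lborel"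
        by (rule borel_measurable_integrable) (intro Bochner_Integration.integrable_add X integrable_oscillation)
      show "(\<lambda>t. indicator {0..real n} t *\<^sub>R (iexp (- (t * \<xi>)) * (indicator {t. \<tau> \<le> ereal t} t * char chi t))) \<in> borel_measurable lborel"
        unfolding real by simp
    qed
    also have "\<dots> = (CLINT t|lborel. X t) + I (max T0 r) (real n)"
      unfolding I_def set_lebesgue_integral_def by (rule Bochner_Integration.integral_add[OF X integrable_oscillation])
    also have "(CLINT t|lborel. X t) = (if r < T0 then I r T0 else 0)"
      by (simp add: X_def[abs_def] I_def set_lebesgue_integral_def)
    finally show ?thesis unfolding inv_trunc_def by (simp add: add_divide_distrib)
  qed
  have "(\<lambda>n. complex_of_real ((if r < T0 then Re (I r T0) / pi else 0) + Re (I (max T0 r) (real n) / pi)))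
    \<longlonglongrightarrow> complex_of_real ((if r < T0 then Re (I r T0) / pi else 0) + Re (theta T0 \<kappa> \<phi> r (- \<xi>)))"
    unfolding I_def by (intro tendsto_intros theta_limit[OF \<phi> \<rho>])
  also have "complex_of_real ((if r < T0 then Re (I r T0) / pi else 0) + Re (theta T0 \<kappa> \<phi> r (- \<xi>))) = fourier_psi0 chi T0 \<kappa> \<phi> \<tau> (- \<xi>)"
    by (simp add: fourier_psi0_def real fourier_psi_eq[OF r] I_def)
  finally show ?thesis
  proof (rule Lim_transform_eventually)
    obtain N where N: "max T0 r \<le> real N" using real_arch_simple by blast
    show "\<forall>\<^sub>F n in sequentially. complex_of_real ((if r < T0 then Re (I r T0) / pi else 0) + Re (I (max T0 r) (real n) / pi))
      = complex_of_real (inv_trunc (\<lambda>t. indicator {t. \<tau> \<le> ereal t} t * char chi t) (real n) \<xi>)"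
    proof (rule eventually_sequentiallyI[of N])
      fix n assume "N \<le> n"
      then have "max T0 r \<le> real n" using N by linarith
      then show "complex_of_real ((if r < T0 then Re (I r T0) / pi else 0) + Re (I (max T0 r) (real n) / pi))
        = complex_of_real (inv_trunc (\<lambda>t. indicator {t. \<tau> \<le> ereal t} t * char chi t) (real n) \<xi>)"
        by (simp only: split)
    qed
  qed
qed

end

lemma inv_trunc_diff:
  assumes [measurable]: "A \<in> borel_measurable borel" "B \<in> borel_measurable borel"
    and le: "\<And>t. cmod (A t) \<le> 1" "\<And>t. cmod (B t) \<le> 1"
  shows "inv_trunc (\<lambda>t. A t - B t) T y = inv_trunc A T y - inv_trunc B T y"
proof -
  have int: "integrable lborel (\<lambda>t. indicator {0..T} t *\<^sub>R (iexp (- (t * y)) * C t))"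
    if "C \<in> borel_measurable borel" "\<And>t. cmod (C t) \<le> 1" for C
    by (rule integrable_indicator_bounded[where C = 1]) (use that in \<open>auto simp: norm_mult\<close>)
  have "(CLINT t:{0..T}|lborel. iexp (- (t * y)) * (A t - B t))
    = (CLINT t:{0..T}|lborel. iexp (- (t * y)) * A t) - (CLINT t:{0..T}|lborel. iexp (- (t * y)) * B t)"
    unfolding set_lebesgue_integral_def right_diff_distrib scaleR_diff_right
    by (rule Bochner_Integration.integral_diff) (intro int assms)+
  then show ?thesis by (simp add: inv_trunc_def diff_divide_distrib)
qed

lemma inv_trunc_cong_AE:
  assumes [measurable]: "A \<in> borel_measurable borel" "B \<in> borel_measurable borel"
    and eq: "AE t in lborel. 0 \<le> t \<longrightarrow> A t = B t"
  shows "inv_trunc A T y = inv_trunc B T y"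
proof -
  have "(CLINT t|lborel. indicator {0..T} t *\<^sub>R (iexp (- (t * y)) * A t)) = (CLINT t|lborel. indicator {0..T} t *\<^sub>R (iexp (- (t * y)) * B t))"
  proof (rule integral_cong_AE)
    show "AE t in lborel. indicator {0..T} t *\<^sub>R (iexp (- (t * y)) * A t) = indicator {0..T} t *\<^sub>R (iexp (- (t * y)) * B t)"
      using eq by eventually_elim (auto split: split_indicator)
  qed auto
  then show ?thesis by (simp add: inv_trunc_def set_lebesgue_integral_def)
qed

context deconvolution
begin

interpretation chi: real_distribution chi by (rule chi)
interpretation \<mu>s: real_distribution \<mu>s by (rule \<mu>s)

lemma deconv_weight_tendsto: "(\<lambda>m. deconv_weight m t) \<longlonglongrightarrow> 1 - indicator {t. char \<mu>s t = 0} t"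
proof (cases "char \<mu>s t = 0")
  case True
  then show ?thesis by (simp add: deconv_weight_def)
next
  case False
  define p where "p = Re (char \<mu>s t)"
  have p: "0 < p" "p \<le> 1"
    using False char_nonneg[of t] char_le_1[of t] char_real[of t] by (auto simp: p_def complex_eq_iff)
  have "(\<lambda>m. (1 - p) ^ Suc m) \<longlonglongrightarrow> 0"
    by (rule LIMSEQ_Suc[OF LIMSEQ_realpow_zero]) (use p in auto)
  then have "(\<lambda>m. complex_of_real (1 - (1 - p) ^ Suc m)) \<longlonglongrightarrow> complex_of_real (1 - 0)"
    by (intro tendsto_intros)
  moreover have "deconv_weight m t = complex_of_real (1 - (1 - p) ^ Suc m)" for m
    unfolding deconv_weight_def by (subst char_eq) (simp add: p_def)
  ultimately show ?thesis using False by (simp add: indicator_def)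
qed

lemma inv_trunc_deconv_tendsto:
  "(\<lambda>m. wtrunc (deconv_weight m) R \<xi>)
    \<longlonglongrightarrow> inv_trunc (char chi) R \<xi> - inv_trunc (\<lambda>t. indicator {t. char \<mu>s t = 0} t * char chi t) R \<xi>"
proof -
  let ?N = "{t. char \<mu>s t = 0}"
  have N[measurable]: "?N \<in> sets borel"
  proof -
    have "char \<mu>s -` {0} \<inter> space borel \<in> sets borel" by measurable
    then show ?thesis by (simp add: vimage_def)
  qed
  have "(\<lambda>m. CLINT t|lborel. indicator {0..R} t *\<^sub>R (iexp (- (t * \<xi>)) * (char chi t * deconv_weight m t)))
    \<longlonglongrightarrow> (CLINT t|lborel. indicator {0..R} t *\<^sub>R (iexp (- (t * \<xi>)) * (char chi t * (1 - indicator ?N t))))"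
  proof (rule integral_dominated_convergence[where w = "indicator {0..R}"])
    show "(\<lambda>t. indicator {0..R} t *\<^sub>R (iexp (- (t * \<xi>)) * (char chi t * deconv_weight m t))) \<in> borel_measurable lborel" for m
      using weighted_char(1)[OF weight_deconv[of m]] by measurable
    show "AE t in lborel. (\<lambda>m. indicator {0..R} t *\<^sub>R (iexp (- (t * \<xi>)) * (char chi t * deconv_weight m t)))
      \<longlonglongrightarrow> indicator {0..R} t *\<^sub>R (iexp (- (t * \<xi>)) * (char chi t * (1 - indicator ?N t)))"
      by (intro AE_I2 tendsto_intros deconv_weight_tendsto)
    show "AE t in lborel. cmod (indicator {0..R} t *\<^sub>R (iexp (- (t * \<xi>)) * (char chi t * deconv_weight m t))) \<le> indicator {0..R} t" for m
      using weighted_char(2)[OF weight_deconv[of m]] by (auto intro!: AE_I2 simp: norm_mult split: split_indicator)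
  qed auto
  then have "(\<lambda>m. wtrunc (deconv_weight m) R \<xi>) \<longlonglongrightarrow> inv_trunc (\<lambda>t. char chi t * (1 - indicator ?N t)) R \<xi>"
    unfolding inv_trunc_def set_lebesgue_integral_def by (intro tendsto_intros) auto
  also have "(\<lambda>t. char chi t * (1 - indicator ?N t)) = (\<lambda>t. char chi t - indicator ?N t * char chi t)"
    by (simp add: fun_eq_iff algebra_simps)
  also have "inv_trunc \<dots> R \<xi> = inv_trunc (char chi) R \<xi> - inv_trunc (\<lambda>t. indicator ?N t * char chi t) R \<xi>"
    by (rule inv_trunc_diff) (auto simp: chi.cmod_char_le_1 norm_mult split: split_indicator)
  finally show ?thesis .
qed

text \<open>Interchange of the limits in the number of summands and in the truncation level: the truncation
  error is uniformly small in the former.\<close>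

lemma inv_lim_deconv_tendsto:
  assumes \<rho>: "0 < \<rho>" "far \<rho> \<xi>"
    and S: "(\<lambda>n. inv_trunc (\<lambda>t. indicator {t. char \<mu>s t = 0} t * char chi t) (real n) \<xi>) \<longlonglongrightarrow> S"
  shows "(\<lambda>m. inv_lim (deconv_weight m) \<xi>) \<longlonglongrightarrow> inv_lim (\<lambda>_. 1) \<xi> - S"
proof (rule LIMSEQ_I)
  fix e :: real assume "0 < e"
  then have e: "0 < e / 4" by simp
  define D where "D n = inv_trunc (char chi) (real n) \<xi> - inv_trunc (\<lambda>t. indicator {t. char \<mu>s t = 0} t * char chi t) (real n) \<xi>" for n
  obtain R0 where R0: "\<forall>R w y. R0 \<le> R \<longrightarrow> weight W w \<longrightarrow> far \<rho> y \<longrightarrow>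
    \<bar>inv_lim w y - wtrunc w R y\<bar> \<le> e / 4"
    using inv_lim_approx[OF \<rho>(1) W e] by blast
  have "(\<lambda>n. inv_trunc (char chi) (real n) \<xi>) \<longlonglongrightarrow> inv_lim (\<lambda>_. 1) \<xi>"
    using inv_trunc_tendsto[OF weight_one _ \<rho>] by simp
  then have "D \<longlonglongrightarrow> inv_lim (\<lambda>_. 1) \<xi> - S" unfolding D_def by (rule tendsto_diff[OF _ S])
  then obtain N1 where N1: "\<And>n. N1 \<le> n \<Longrightarrow> \<bar>D n - (inv_lim (\<lambda>_. 1) \<xi> - S)\<bar> < e / 4"
    using LIMSEQ_D[OF _ e] by (metis real_norm_def)
  obtain N2 where N2: "R0 \<le> real N2" using real_arch_simple by blast
  define n where "n = max N1 N2"
  have n: "N1 \<le> n" "R0 \<le> real n" using N2 by (auto simp: n_def)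
  obtain m0 where m0: "\<And>m. m0 \<le> m \<Longrightarrow> \<bar>wtrunc (deconv_weight m) (real n) \<xi> - D n\<bar> < e / 4"
    using LIMSEQ_D[OF inv_trunc_deconv_tendsto[of "real n" \<xi>] e] unfolding D_def by (metis real_norm_def)
  show "\<exists>m0. \<forall>m\<ge>m0. norm (inv_lim (deconv_weight m) \<xi> - (inv_lim (\<lambda>_. 1) \<xi> - S)) < e"
  proof (intro exI[of _ m0] allI impI)
    fix m assume "m0 \<le> m"
    then have "\<bar>wtrunc (deconv_weight m) (real n) \<xi> - D n\<bar> < e / 4" by (rule m0)
    moreover have "\<bar>inv_lim (deconv_weight m) \<xi> - wtrunc (deconv_weight m) (real n) \<xi>\<bar> \<le> e / 4"
      using R0 n(2) weight_deconv \<rho>(2) by blast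
    moreover note N1[OF n(1)]
    ultimately show "norm (inv_lim (deconv_weight m) \<xi> - (inv_lim (\<lambda>_. 1) \<xi> - S)) < e"
      using \<open>0 < e\<close> unfolding real_norm_def by linarith
  qed
qed

end

section \<open>Ordered families of zero intervals\<close>

text \<open>Each difference is the indicator of a half-open interval, and the ordering makes the intervals
  disjoint.  Equality fails only at right end points, which is why end points are excluded.\<close>

lemma interval_sum_eq_indicator:
  fixes \<tau> :: "nat \<Rightarrow> ereal"
  assumes odd: "\<And>k. k \<in> {1..2*K} \<Longrightarrow> odd k \<Longrightarrow> \<tau> k \<le> \<tau> (k + 1)"
    and even: "\<And>k. k \<in> {1..<2*K} \<Longrightarrow> even k \<Longrightarrow> \<tau> k < \<tau> (k + 1)"
    and x: "\<And>k. k \<in> {1..2*K} \<Longrightarrow> x \<noteq> \<tau> k"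
  shows "(\<Sum>k=1..K. indicator {t. \<tau> (2*k - 1) \<le> t} x - indicator {t. \<tau> (2*k) \<le> t} x) =
    (indicator (\<Union>k\<in>{1..K}. {\<tau> (2*k - 1)..\<tau> (2*k)}) x :: complex)"
proof -
  define P where "P k \<longleftrightarrow> \<tau> (2*k - 1) \<le> x \<and> x < \<tau> (2*k)" for k
  have step: "\<tau> j \<le> \<tau> (Suc j)" if "1 \<le> j" "j < 2 * K" for j
    using odd[of j] even[of j] that by (cases "even j") auto
  have mono: "\<tau> i \<le> \<tau> j" if ij: "i \<le> j" "1 \<le> i" "j \<le> 2 * K" for i j
    using ij
  proof (induction j rule: dec_induct)
    case (step n)
    then show ?case using \<open>\<And>j. \<lbrakk>1 \<le> j; j < 2 * K\<rbrakk> \<Longrightarrow> \<tau> j \<le> \<tau> (Suc j)\<close>[of n] by (auto intro: order_trans)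
  qed simp
  have le: "\<tau> (2*k - 1) \<le> \<tau> (2*k)" if "k \<in> {1..K}" for k
    by (rule mono) (use that in auto)
  have term_eq: "indicator {t. \<tau> (2*k - 1) \<le> t} x - indicator {t. \<tau> (2*k) \<le> t} x = (if P k then 1 else 0 :: complex)"
    if "k \<in> {1..K}" for k
    using le[OF that] by (auto simp: P_def indicator_def)
  have P_iff: "P k \<longleftrightarrow> x \<in> {\<tau> (2*k - 1)..\<tau> (2*k)}" if "k \<in> {1..K}" for k
    using x[of "2*k"] that by (auto simp: P_def)
  have uniq: "k = l" if "P k" "P l" "k \<in> {1..K}" "l \<in> {1..K}" for k l
  proof -
    have "\<not> i < j" if "P i" "P j" "i \<in> {1..K}" "j \<in> {1..K}" for i j
    proof
      assume ij: "i < j"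
      have "\<tau> (2*i) \<le> \<tau> (2*j - 1)" by (rule mono) (use that ij in auto)
      then show False using that(1,2) unfolding P_def by (meson leD order_trans)
    qed
    then show ?thesis using that by (meson linorder_neqE_nat)
  qed
  have "(\<Sum>k=1..K. indicator {t. \<tau> (2*k - 1) \<le> t} x - indicator {t. \<tau> (2*k) \<le> t} x) = (\<Sum>k=1..K. if P k then 1 else 0 :: complex)"
    by (rule sum.cong[OF refl term_eq])
  also have "\<dots> = indicator (\<Union>k\<in>{1..K}. {\<tau> (2*k - 1)..\<tau> (2*k)}) x"
  proof (cases "\<exists>k\<in>{1..K}. P k")
    case True
    then obtain l where l: "l \<in> {1..K}" "P l" by blast
    then have "(\<Sum>k=1..K. if P k then 1 else 0 :: complex) = (\<Sum>k=1..K. if k = l then 1 else 0)"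
      using uniq by (intro sum.cong) auto
    also have "\<dots> = 1" using l by simp
    also have "\<dots> = indicator (\<Union>k\<in>{1..K}. {\<tau> (2*k - 1)..\<tau> (2*k)}) x"
      using l P_iff[of l] by (auto simp: indicator_def)
    finally show ?thesis .
  next
    case False
    then show ?thesis using P_iff by (auto simp: indicator_def intro!: sum.neutral)
  qed
  finally show ?thesis .
qed

lemma closed_intervals_degenerate:
  fixes a b :: ereal
  assumes N: "{t. ereal t \<in> Z} \<in> sets borel" "emeasure lborel {t. ereal t \<in> Z} = 0"
    and sub: "{a..b} \<subseteq> Z" and ab: "a \<le> b"
  shows "a = b"
proof (rule ccontr)
  assume "a \<noteq> b"
  with ab have "a < b" by simp
  then obtain r where r: "a < ereal r" "ereal r < b" using ereal_dense2 by blast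
  then obtain s where s: "ereal r < ereal s" "ereal s < b" using ereal_dense2[of "ereal r" b] by blast
  have "{r..s} \<subseteq> {t. ereal t \<in> Z}"
  proof
    fix t assume "t \<in> {r..s}"
    then have "ereal r \<le> ereal t" "ereal t \<le> ereal s" by auto
    then have "ereal t \<in> {a..b}"
      using order_trans[OF less_imp_le[OF r(1)]] order_trans[OF _ less_imp_le[OF s(2)]] by auto
    then show "t \<in> {t. ereal t \<in> Z}" using sub by auto
  qed
  then have "emeasure lborel {r..s} \<le> emeasure lborel {t. ereal t \<in> Z}"
    using N(1) by (intro emeasure_mono) auto
  then show False using s N(2) by simp
qed

lemma tendsto_inf_ae_filter:
  assumes "(q \<longlongrightarrow> l) F" "eventually P F" "AE x in lborel. P x \<longrightarrow> q x = h x"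
  shows "(h \<longlongrightarrow> l) (inf F (ae_filter lborel))"
proof (rule Lim_transform_eventually)
  show "(q \<longlongrightarrow> l) (inf F (ae_filter lborel))"
    by (rule tendsto_mono[OF inf_le1 assms(1)])
  show "\<forall>\<^sub>F x in inf F (ae_filter lborel). q x = h x"
    unfolding eventually_inf using assms(2,3) by blast
qed

lemma set_distance_pos_imp:
  assumes "set_distance {\<xi>} D > 0"
  obtains \<rho> where "0 < \<rho>" "\<And>d. d \<in> D \<Longrightarrow> \<rho> \<le> \<bar>\<xi> - d\<bar>"
proof -
  obtain \<rho> where \<rho>: "0 < ereal \<rho>" "ereal \<rho> < set_distance {\<xi>} D" using ereal_dense2[OF assms] by blast
  show ?thesis
  proof
    show "0 < \<rho>" using \<rho> by simp
    fix d assume "d \<in> D"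
    then have "set_distance {\<xi>} D \<le> ereal \<bar>\<xi> - d\<bar>"
      unfolding set_distance_def by (intro INF_lower2[of "(\<xi>, d)"]) auto
    with \<rho>(2) have "ereal \<rho> < ereal \<bar>\<xi> - d\<bar>" by (rule less_le_trans)
    then show "\<rho> \<le> \<bar>\<xi> - d\<bar>" by simp
  qed
qed

section \<open>Limit of the deconvolution density\<close>

theorem theorem6p5:
  fixes chi \<mu> \<mu>s \<iota> :: "real measure"
    and f_chi g f_iota :: "real \<Rightarrow> real"
    and T0 a :: real
    and \<kappa> :: "real set \<Rightarrow> complex"
    and \<phi> :: "ereal \<Rightarrow> complex"
    and K :: nat
    and \<tau> :: "nat \<Rightarrow> ereal"
  assumes "real_distribution chi" and "real_distribution \<mu>"
    and "is_symmetrization \<mu>s \<mu>"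
    and "has_density chi f_chi"
    and "has_density (chi \<star> \<mu>s) g" and "continuous_on UNIV g"
    and "real_distribution \<iota>" and "has_density \<iota> f_iota"
    and "f_iota \<in> O[at_top](\<lambda>x. 1 / x ^ 2)" and "f_iota \<in> O[at_bot](\<lambda>x. 1 / x ^ 2)"
    and "integrable lborel (char \<iota>)"
    and "\<And>t. t \<noteq> 0 \<Longrightarrow> char \<iota> differentiable (at t)"
    and "continuous_on (- {0}) (\<lambda>t. vector_derivative (char \<iota>) (at t))"
    and "a > 2"
    and "(\<lambda>t. cmod (vector_derivative (char \<iota>) (at t))) \<in> O[at_top](\<lambda>t. \<bar>t\<bar> powr (- a))"
    and "(\<lambda>t. cmod (vector_derivative (char \<iota>) (at t))) \<in> O[at_bot](\<lambda>t. \<bar>t\<bar> powr (- a))"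
    and "T0 \<ge> 0"
    and "complex_measure \<kappa>"
    and "total_variation \<kappa> UNIV = total_variation \<kappa> (discontinuities \<kappa>)"
    and "continuous_on {ereal T0..\<infinity>} \<phi>" and "variation \<phi> {ereal T0..\<infinity>} < \<infinity>"
    and "((\<lambda>t. \<phi> (ereal t)) \<longlongrightarrow> 0) at_top"
    and "\<And>t. t \<ge> T0 \<Longrightarrow> char chi t = cm_char \<kappa> t * \<phi> (ereal t)"
    and "\<exists>L. (char \<mu>s \<longlongrightarrow> L) at_top"
    and "(SUP m. variation (\<lambda>t. char_power \<mu>s t m) {0..\<infinity>}) < \<infinity>"
    and "K \<ge> 1"
    and "\<And>k. k \<in> {1..2*K} \<Longrightarrow> \<tau> k \<in> char_zeros \<mu> \<inter> {0..\<infinity>}"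
    and "\<And>k. k \<in> {1..2*K} \<Longrightarrow> odd k \<Longrightarrow> \<tau> k \<le> \<tau> (k + 1) \<and> {\<tau> k..\<tau> (k + 1)} \<subseteq> char_zeros \<mu>"
    and "\<And>k. k \<in> {1..<2*K} \<Longrightarrow> even k \<Longrightarrow> \<tau> k < \<tau> (k + 1)"
    and "char_zeros \<mu> \<inter> {0..\<infinity>} = (\<Union>k\<in>{1..K}. {\<tau> (2*k - 1)..\<tau> (2*k)})"
  shows "\<forall>\<xi>. set_distance {\<xi>} (discontinuities \<kappa>) > 0 \<longrightarrow>
     (\<exists>fp fm. (f_chi \<longlongrightarrow> fp) (ess_at_right \<xi>) \<and> (f_chi \<longlongrightarrow> fm) (ess_at_left \<xi>) \<and>
        ((\<lambda>m. deconv_density \<mu>s g \<xi> m) \<longlongrightarrow>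
           complex_of_real ((fp + fm) / 2)
           - (\<Sum>k=1..K. fourier_psi0 chi T0 \<kappa> \<phi> (\<tau> (2*k - 1)) (- \<xi>)
                         - fourier_psi0 chi T0 \<kappa> \<phi> (\<tau> (2*k)) (- \<xi>))) sequentially) \<and>
     (emeasure lborel {t. ereal t \<in> char_zeros \<mu>} = 0 \<longrightarrow>
        (\<Sum>k=1..K. fourier_psi0 chi T0 \<kappa> \<phi> (\<tau> (2*k - 1)) (- \<xi>)
                    - fourier_psi0 chi T0 \<kappa> \<phi> (\<tau> (2*k)) (- \<xi>)) = 0)"
proof -
  have chi: "real_distribution chi" and \<kappa>: "complex_measure \<kappa>" and T0: "0 \<le> T0"
    and atomic: "total_variation \<kappa> UNIV = total_variation \<kappa> (discontinuities \<kappa>)" using assms by auto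
  have sym: "is_symmetrization \<mu>s \<mu>" by fact
  have zeros: "char_zeros \<mu>s = char_zeros \<mu>"
    and char_real: "\<And>t. Im (char \<mu>s t) = 0" and char_nonneg: "\<And>t. 0 \<le> Re (char \<mu>s t)" and char_le_1: "\<And>t. Re (char \<mu>s t) \<le> 1"
    using sym by (auto simp: is_symmetrization_def)
  have \<mu>s: "real_distribution \<mu>s"
    using sym \<open>real_distribution \<mu>\<close> real_distribution_convolution by (auto simp: is_symmetrization_def)
  define f where "f t = \<phi> (ereal t)" for t
  have f_cont: "continuous_on {T0..} f"
    unfolding f_def by (rule continuous_on_compose2[OF \<open>continuous_on {ereal T0..\<infinity>} \<phi>\<close>]) (auto intro!: continuous_intros)
  obtain V0 where f_var: "var_le f {T0..} V0"
    using variation_lt_top_imp_var_le[OF \<open>variation \<phi> {ereal T0..\<infinity>} < \<infinity>\<close>, of "{T0..}"]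
    by (auto simp: f_def[abs_def])
  have f_lim: "(f \<longlongrightarrow> 0) at_top" using \<open>((\<lambda>t. \<phi> (ereal t)) \<longlongrightarrow> 0) at_top\<close> by (simp add: f_def[abs_def])
  define W where "W = enn2real (SUP m. variation (\<lambda>t. char_power \<mu>s t m) {0..\<infinity>})"
  have W: "0 \<le> W" by (simp add: W_def)
  have power_var: "var_le (\<lambda>t. (1 - char \<mu>s t) ^ Suc m) {0..} W" for m
  proof -
    have "variation (\<lambda>t. char_power \<mu>s t m) {0..\<infinity>} \<le> (SUP m. variation (\<lambda>t. char_power \<mu>s t m) {0..\<infinity>})"
      by (rule SUP_upper) simp
    also have "\<dots> = ennreal W"
      using \<open>(SUP m. variation (\<lambda>t. char_power \<mu>s t m) {0..\<infinity>}) < \<infinity>\<close> by (simp add: W_def less_top)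
    finally have "var_le (\<lambda>t. char_power \<mu>s (ereal t) m) {0..} W"
      by (rule variation_imp_var_le) (use W in auto)
    then show ?thesis by (simp add: char_power_def char_ext_def)
  qed
  have "var_le (\<lambda>t. 1 - (1 - char \<mu>s t)) {0..} W"
    using var_le_one_minus[OF power_var[of 0]] by simp
  then have char_var: "var_le (char \<mu>s) {0..} W" by simp
  interpret deconvolution chi \<kappa> f T0 V0 \<mu>s g W W
  proof (intro deconvolution.intro atomic_factorization.intro deconvolution_axioms.intro)
    show "char chi t = cm_char \<kappa> t * f t" if "T0 \<le> t" for t
      using \<open>\<And>t. t \<ge> T0 \<Longrightarrow> char chi t = cm_char \<kappa> t * \<phi> (ereal t)\<close>[OF that] by (simp only: f_def)
  qed (fact chi T0 \<kappa> atomic f_cont f_var f_lim \<mu>s char_real char_nonneg char_le_1 W power_var char_var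
      \<open>has_density (chi \<star> \<mu>s) g\<close> \<open>continuous_on UNIV g\<close>)+
  interpret chi: real_distribution chi by (rule chi)
  interpret \<mu>s: real_distribution \<mu>s by (rule \<mu>s)
  \<comment> \<open>The finite zeros; those of the symmetrization and of the original measure agree.\<close>
  define N where "N = {t. char \<mu>s t = 0}"
  have N_zeros: "t \<in> N \<longleftrightarrow> ereal t \<in> char_zeros \<mu>" for t
    unfolding zeros[symmetric] by (simp add: N_def char_zeros_def)
  have N_meas[measurable]: "N \<in> sets borel"
  proof -
    have "char \<mu>s -` {0} \<inter> space borel \<in> sets borel" by measurable
    then show ?thesis by (simp add: vimage_def N_def)
  qed
  note \<tau>_mem = \<open>\<And>k. k \<in> {1..2*K} \<Longrightarrow> \<tau> k \<in> char_zeros \<mu> \<inter> {0..\<infinity>}\<close>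
  note \<tau>_odd = \<open>\<And>k. k \<in> {1..2*K} \<Longrightarrow> odd k \<Longrightarrow> \<tau> k \<le> \<tau> (k + 1) \<and> {\<tau> k..\<tau> (k + 1)} \<subseteq> char_zeros \<mu>\<close>
  note \<tau>_even = \<open>\<And>k. k \<in> {1..<2*K} \<Longrightarrow> even k \<Longrightarrow> \<tau> k < \<tau> (k + 1)\<close>
  note \<tau>_cover = \<open>char_zeros \<mu> \<inter> {0..\<infinity>} = (\<Union>k\<in>{1..K}. {\<tau> (2*k - 1)..\<tau> (2*k)})\<close>
  \<comment> \<open>The characteristic function restricted to the half-line from \<open>\<tau> j\<close> on; it vanishes if \<open>\<tau> j\<close> is infinite.\<close>
  define J where "J j t = indicator {t. \<tau> j \<le> ereal t} t * char chi t" for j t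
  have J_meas[measurable]: "J j \<in> borel_measurable borel" for j unfolding J_def by measurable
  have J_le: "cmod (J j t) \<le> 1" for j t
    using chi.cmod_char_le_1[of t] by (simp add: J_def norm_mult split: split_indicator)
  let ?\<psi> = "\<lambda>j \<xi>. fourier_psi0 chi T0 \<kappa> \<phi> (\<tau> j) (- \<xi>)"
  have J_sum: "(\<Sum>k=1..K. inv_trunc (J (2*k - 1)) T \<xi> - inv_trunc (J (2*k)) T \<xi>) = inv_trunc (\<lambda>t. indicator N t * char chi t) T \<xi>" for T \<xi>
  proof -
    have pair: "J (2*k - 1) t - J (2*k) t = (indicator {t. \<tau> (2*k - 1) \<le> t} (ereal t) - indicator {t. \<tau> (2*k) \<le> t} (ereal t)) * char chi t" for k t
      by (simp add: J_def left_diff_distrib indicator_def)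
    have pair_le: "cmod (J (2*k - 1) t - J (2*k) t) \<le> 1" for k t
      using chi.cmod_char_le_1[of t] by (auto simp: J_def split: split_indicator)
    have "(\<Sum>k=1..K. inv_trunc (J (2*k - 1)) T \<xi> - inv_trunc (J (2*k)) T \<xi>)
      = (\<Sum>k=1..K. 1 * inv_trunc (\<lambda>t. J (2*k - 1) t - J (2*k) t) T \<xi>)"
      by (simp add: inv_trunc_diff J_le)
    also have "\<dots> = inv_trunc (\<lambda>t. \<Sum>k=1..K. complex_of_real 1 * (J (2*k - 1) t - J (2*k) t)) T \<xi>"
      by (rule inv_trunc_sum[symmetric], measurable, rule pair_le)
    also have "\<dots> = inv_trunc (\<lambda>t. indicator N t * char chi t) T \<xi>"
    proof (rule inv_trunc_cong_AE)
      have "finite (real_of_ereal ` \<tau> ` {1..2*K})" by simp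
      then have "AE t in lborel. t \<notin> real_of_ereal ` \<tau> ` {1..2*K}"
        by (rule AE_not_in[OF finite_imp_null_set_lborel])
      then show "AE t in lborel. 0 \<le> t \<longrightarrow> (\<Sum>k=1..K. complex_of_real 1 * (J (2*k - 1) t - J (2*k) t)) = indicator N t * char chi t"
      proof eventually_elim
        case (elim t)
        show ?case
        proof
          assume t: "0 \<le> t"
          have ne: "ereal t \<noteq> \<tau> k" if "k \<in> {1..2*K}" for k
          proof
            assume "ereal t = \<tau> k"
            then have "t = real_of_ereal (\<tau> k)" by (metis real_of_ereal.simps(1))
            then show False using elim that by blast
          qed
          have "(\<Sum>k=1..K. complex_of_real 1 * (J (2*k - 1) t - J (2*k) t))
            = (\<Sum>k=1..K. indicator {t. \<tau> (2*k - 1) \<le> t} (ereal t) - indicator {t. \<tau> (2*k) \<le> t} (ereal t)) * char chi t"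
            by (simp only: pair sum_distrib_right of_real_1 mult_1_left)
          also have "(\<Sum>k=1..K. indicator {t. \<tau> (2*k - 1) \<le> t} (ereal t) - indicator {t. \<tau> (2*k) \<le> t} (ereal t))
            = (indicator (\<Union>k\<in>{1..K}. {\<tau> (2*k - 1)..\<tau> (2*k)}) (ereal t) :: complex)"
            by (rule interval_sum_eq_indicator) (use \<tau>_odd \<tau>_even ne in auto)
          also have "\<dots> = indicator N t"
            unfolding \<tau>_cover[symmetric] using t N_zeros[of t] by (auto simp: indicator_def)
          finally show "(\<Sum>k=1..K. complex_of_real 1 * (J (2*k - 1) t - J (2*k) t)) = indicator N t * char chi t" .
        qed
      qed
    qed auto
    finally show ?thesis .
  qed
  show ?thesis
  proof (intro allI impI)
    fix \<xi> assume "set_distance {\<xi>} (discontinuities \<kappa>) > 0"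
    then obtain \<rho> where \<rho>: "0 < \<rho>" "\<And>d. d \<in> discontinuities \<kappa> \<Longrightarrow> \<rho> \<le> \<bar>\<xi> - d\<bar>"
      using set_distance_pos_imp by blast
    then have far: "far \<rho> \<xi>" by (simp add: far_def)
    \<comment> \<open>The continuous version of the density near \<open>\<xi>\<close>; it provides both one-sided limits.\<close>
    define q where "q = inv_lim (\<lambda>_. 1)"
    define I where "I = {\<xi> - \<rho> / 2..\<xi> + \<rho> / 2}"
    have farI: "far (\<rho> / 2) y" if "y \<in> I" for y
      by (rule far_mono[OF far]) (use that in \<open>unfold I_def atLeastAtMost_iff, linarith\<close>)
    have \<rho>2: "0 < \<rho> / 2" using \<rho>(1) by simp
    have "continuous_on I q" unfolding q_def by (rule continuous_inv_lim[OF weight_one order_refl \<rho>2 farI])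
    then have "isCont q \<xi>"
      using \<rho>(1) by (intro continuous_on_interior) (auto simp: I_def)
    then have q_lim: "(q \<longlongrightarrow> q \<xi>) (at \<xi>)" by (simp add: isCont_def)
    have "AE x in lborel. x \<in> {\<xi> - \<rho> / 2<..\<xi> + \<rho> / 2} \<longrightarrow> f_chi x = inv_lim (\<lambda>_. 1) x"
      by (rule chi_density_eq_inv_lim[OF \<open>has_density chi f_chi\<close> \<rho>2]) (rule farI, simp add: I_def)
    then have AE_q: "AE x in lborel. x \<in> {\<xi> - \<rho> / 2<..\<xi> + \<rho> / 2} \<longrightarrow> q x = f_chi x"
      by eventually_elim (simp add: q_def)
    have right: "(f_chi \<longlongrightarrow> q \<xi>) (ess_at_right \<xi>)"
      unfolding ess_at_right_def
    proof (rule tendsto_inf_ae_filter[OF _ _ AE_q])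
      show "(q \<longlongrightarrow> q \<xi>) (at_right \<xi>)" by (rule tendsto_mono[OF _ q_lim]) (simp add: at_le)
      show "\<forall>\<^sub>F x in at_right \<xi>. x \<in> {\<xi> - \<rho> / 2<..\<xi> + \<rho> / 2}"
        using eventually_at_right_real[of \<xi> "\<xi> + \<rho> / 2"] \<rho>(1) by (auto elim: eventually_mono)
    qed
    have left: "(f_chi \<longlongrightarrow> q \<xi>) (ess_at_left \<xi>)"
      unfolding ess_at_left_def
    proof (rule tendsto_inf_ae_filter[OF _ _ AE_q])
      show "(q \<longlongrightarrow> q \<xi>) (at_left \<xi>)" by (rule tendsto_mono[OF _ q_lim]) (simp add: at_le)
      show "\<forall>\<^sub>F x in at_left \<xi>. x \<in> {\<xi> - \<rho> / 2<..\<xi> + \<rho> / 2}"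
        using eventually_at_left_real[of "\<xi> - \<rho> / 2" \<xi>] \<rho>(1) by (auto elim: eventually_mono)
    qed
    define Z where "Z = (\<Sum>k=1..K. ?\<psi> (2*k - 1) \<xi> - ?\<psi> (2*k) \<xi>)"
    have \<psi>_lim: "(\<lambda>n. complex_of_real (inv_trunc (J j) (real n) \<xi>)) \<longlonglongrightarrow> ?\<psi> j \<xi>" if "j \<in> {1..2*K}" for j
      unfolding J_def using \<tau>_mem[OF that]
      by (intro fourier_psi0_limit[OF _ \<rho>(1) far]) (auto simp: f_def)
    have Z_lim: "(\<lambda>n. complex_of_real (inv_trunc (\<lambda>t. indicator N t * char chi t) (real n) \<xi>)) \<longlonglongrightarrow> Z"
    proof -
      have "(\<lambda>n. \<Sum>k=1..K. complex_of_real (inv_trunc (J (2*k - 1)) (real n) \<xi>) - complex_of_real (inv_trunc (J (2*k)) (real n) \<xi>)) \<longlonglongrightarrow> Z"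
        unfolding Z_def by (intro tendsto_sum tendsto_diff \<psi>_lim) auto
      also have "(\<lambda>n. \<Sum>k=1..K. complex_of_real (inv_trunc (J (2*k - 1)) (real n) \<xi>) - complex_of_real (inv_trunc (J (2*k)) (real n) \<xi>))
        = (\<lambda>n. complex_of_real (\<Sum>k=1..K. inv_trunc (J (2*k - 1)) (real n) \<xi> - inv_trunc (J (2*k)) (real n) \<xi>))"
        by (simp only: of_real_sum of_real_diff)
      finally show ?thesis unfolding J_sum .
    qed
    have Re_lim: "(\<lambda>n. inv_trunc (\<lambda>t. indicator N t * char chi t) (real n) \<xi>) \<longlonglongrightarrow> Re Z"
      using tendsto_Re[OF Z_lim] by simp
    have Z_real: "Z = complex_of_real (Re Z)"
      by (rule LIMSEQ_unique[OF Z_lim tendsto_of_real[OF Re_lim]])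
    have "(\<lambda>m. complex_of_real (inv_lim (deconv_weight m) \<xi>)) \<longlonglongrightarrow> complex_of_real (q \<xi> - Re Z)"
      unfolding q_def by (intro tendsto_of_real inv_lim_deconv_tendsto[OF \<rho>(1) far]) (use Re_lim in \<open>simp add: N_def\<close>)
    also have "complex_of_real (q \<xi> - Re Z) = complex_of_real ((q \<xi> + q \<xi>) / 2) - Z"
      by (subst (2) Z_real) simp
    finally have main: "(\<lambda>m. deconv_density \<mu>s g \<xi> m) \<longlonglongrightarrow> complex_of_real ((q \<xi> + q \<xi>) / 2) - Z"
      by (simp only: deconv_density_eq_inv_lim[OF \<rho>(1) far])
    have null: "Z = 0" if "emeasure lborel {t. ereal t \<in> char_zeros \<mu>} = 0"
    proof -
      have "\<tau> (2*k - 1) = \<tau> (2*k)" if k: "k \<in> {1..K}" for k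
      proof -
        have "2*k - 1 \<in> {1..2*K}" "odd (2*k - 1)" "2*k - 1 + 1 = 2*k" using k by auto
        then have "\<tau> (2*k - 1) \<le> \<tau> (2*k) \<and> {\<tau> (2*k - 1)..\<tau> (2*k)} \<subseteq> char_zeros \<mu>"
          using \<tau>_odd[of "2*k - 1"] by simp
        moreover have "{t. ereal t \<in> char_zeros \<mu>} \<in> sets borel"
          using N_meas N_zeros by (simp add: set_eq_iff[of N] Collect_mem_eq flip: N_zeros)
        ultimately show ?thesis using that closed_intervals_degenerate[of "char_zeros \<mu>"] \<open>emeasure lborel _ = 0\<close> by blast
      qed
      then show ?thesis unfolding Z_def by (intro sum.neutral) auto
    qed
    show "(\<exists>fp fm. (f_chi \<longlongrightarrow> fp) (ess_at_right \<xi>) \<and> (f_chi \<longlongrightarrow> fm) (ess_at_left \<xi>) \<and>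
        ((\<lambda>m. deconv_density \<mu>s g \<xi> m) \<longlongrightarrow>
           complex_of_real ((fp + fm) / 2)
           - (\<Sum>k=1..K. fourier_psi0 chi T0 \<kappa> \<phi> (\<tau> (2*k - 1)) (- \<xi>)
                         - fourier_psi0 chi T0 \<kappa> \<phi> (\<tau> (2*k)) (- \<xi>))) sequentially) \<and>
     (emeasure lborel {t. ereal t \<in> char_zeros \<mu>} = 0 \<longrightarrow>
        (\<Sum>k=1..K. fourier_psi0 chi T0 \<kappa> \<phi> (\<tau> (2*k - 1)) (- \<xi>)
                    - fourier_psi0 chi T0 \<kappa> \<phi> (\<tau> (2*k)) (- \<xi>)) = 0)"
      unfolding Z_def[symmetric] using right left main null by blast
  qed
qed

end
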